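(* Let $\mathcal{B}^{+}$ and $\mathcal{B}^{-}$ be the species of positive and negative ballot matrices, let $\mathcal{I}$ be the species of interval orders, and let $\theta$ be the map on ballot matrices that performs the move (split or merge) at the least row admitting one and leaves the matrix unchanged if there is none. Then $\theta$ restricts to a natural isomorphism from the non-fixed points of $\mathcal{B}^{+}$ to $\mathcal{B}^{-}$, and $A\mapsto P(A)$ is a natural isomorphism $\mathrm{Fix}(\theta)\to\mathcal{I}$, where $\mathrm{Fix}(\theta)$ is the species of ballot matrices fixed by $\theta$. Consequently, as species, $$\mathcal{B}^{+}=\mathcal{B}^{-}+\mathcal{I},$$ and, in the ring of virtual species, $\mathcal{I}=\sum_{m\ge0}(-1)^m\prod_{i=1}^m\bigl((E^{-1})^i-1\bigr)$.
   Context: A species is a functor $F$ from the category of finite sets and bijections to the category of finite sets and functions ($F[\sigma]$ is called transport). Equality of species means natural isomorphism. Sum: $(F+G)[U]=F[U]\sqcup G[U]$; product: $(FG)[U]=\bigsqcup_{U=U_1\sqcup U_2}F[U_1]\times G[U_2]$. $1$ has one structure on $\emptyset$ and none elsewhere; $E$ has exactly one structure on every finite set; $E_+$ is its restriction to nonempty sets. The ring of virtual species is $\mathrm{Virt}=(\mathrm{Spe}\times\mathrm{Spe})/\!\sim$, with $(F,G)\sim(H,K)$ iff $F+K=G+H$; the class of $(F,G)$ is $F-G$, and $F$ is identified with $F-0$. Infinite sums are summable (on each finite set only finitely many summands contribute). $E^{-1}=\sum_{k\ge0}(-1)^kE_+^k$ is the multiplicative inverse of $E$. $\mathcal{I}[U]$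 is the set of $(2{+}2)$-free posets on $U$, i.e. irreflexive transitive relations with no induced subposet isomorphic to the disjoint union of two two-element chains; transport is by relabeling. A ballot on a finite set is a (possibly empty) sequence of pairwise disjoint nonempty sets, called blocks, whose union is that set. A ballot matrix of dimension $m\ge 0$ on a finite set $U$ is an upper triangular $m\times m$ array (positions $(i,j)$, $1\le i\le j\le m$) of ballots on pairwise disjoint sets with union $U$ such that every row contains at least one element of $U$. Transport along $\sigma$ replaces every block $B$ by $\sigma(B)$. A ballot matrix of dimension $m$ with $k$ blocks in total is positive if $k+m$ is even and negative if $k+m$ is odd; $\mathcal{B}^{+}[U]$, $\mathcal{B}^{-}[U]$ are the sets of positive and negative ballot matrices on $U$. For a ballot matrix $A$ on $U$ and $x\in U$, let $(\mathrm{row}(x),\mathrm{col}(x))$ be the position of the entry containing $x$. $P(A)$ is the interval order on $U$ given by $x<y\iff \mathrm{col}(x)<\mathrm{row}(y)$. Moves. Let $A$ have dimension $m$. For each row $i$, let $f_i$ be the column of its first nonempty entry, and let $S\subseteq[m]$ be the set of empty columns (necessarily $m\notin S$ if $m\ge1$). Row $i$ is splittable if it contains at least two blocks. Row $i$ is mergeable if it contains exactly one block, $i\in S$ and $f_{i+1}\ge f_i$ (so $i<m$). A row admits a move if it is splittable or mergeable (never both). Split at a splittable row $i$: let $(i,j)$, $j=f_i$, be the first nonempty entry of row $i$ and $B$ the first block of its ballot. Remove $B$ from it, insert an empty row and an empty column at index $i$ (old indices $\ge i$ increase by one), and place the one-block ballot $B$ at $(i,j+1)$; the remainder of the ballot from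 which $B$ was removed is now at $(i+1,j+1)$. Merge at a mergeable row $i$: let $B$ be its unique block, at $(i,f_i)$; since column $i$ is empty, $f_i>i$. Move $B$ to $(i+1,f_i)$, ahead of any blocks already there, and delete row $i$ and column $i$ (indices larger than $i$ decrease by one). *)

theory Defs
  imports Complex_Main "HOL-Library.Countable_Set"
begin

section \<open>Species\<close>

text \<open>
  Labels are drawn from a type \<open>'a\<close>: a species is a functor from the category of finite subsets of
  \<open>'a\<close> and bijections between them, which for infinite \<open>'a\<close> is equivalent to the category of all
  finite sets and bijections. A bijection \<open>\<sigma> : U \<rightarrow> V\<close> is represented by a function on \<open>'a\<close> with
  \<open>bij_betw \<sigma> U V\<close>; the transport along it is \<open>transport F U \<sigma> : structs F U \<rightarrow> structs F V\<close>,
  and the last axiom of \<open>is_species\<close> says that it depends only on the values of \<open>\<sigma>\<close> on \<open>U\<close>.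
\<close>

datatype ('a, 's) species =
  Species (structs: "'a set \<Rightarrow> 's set") (transport: "'a set \<Rightarrow> ('a \<Rightarrow> 'a) \<Rightarrow> 's \<Rightarrow> 's")

definition is_species :: "('a, 's) species \<Rightarrow> bool" where
  "is_species F \<longleftrightarrow>
     (\<forall>U. finite U \<longrightarrow> finite (structs F U)) \<and>
     (\<forall>U V \<sigma>. finite U \<longrightarrow> bij_betw \<sigma> U V \<longrightarrow> (\<forall>s\<in>structs F U. transport F U \<sigma> s \<in> structs F V)) \<and>
     (\<forall>U. finite U \<longrightarrow> (\<forall>s\<in>structs F U. transport F U id s = s)) \<and>
     (\<forall>U V W \<sigma> \<tau>. finite U \<longrightarrow> bij_betw \<sigma> U V \<longrightarrow> bij_betw \<tau> V W \<longrightarrow>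
        (\<forall>s\<in>structs F U. transport F U (\<tau> \<circ> \<sigma>) s = transport F V \<tau> (transport F U \<sigma> s))) \<and>
     (\<forall>U V \<sigma> \<sigma>'. finite U \<longrightarrow> bij_betw \<sigma> U V \<longrightarrow> (\<forall>x\<in>U. \<sigma> x = \<sigma>' x) \<longrightarrow>
        (\<forall>s\<in>structs F U. transport F U \<sigma> s = transport F U \<sigma>' s))"

definition natural_iso ::
  "('a, 's) species \<Rightarrow> ('a, 't) species \<Rightarrow> ('a set \<Rightarrow> 's \<Rightarrow> 't) \<Rightarrow> bool" where
  "natural_iso F G \<eta> \<longleftrightarrow> is_species F \<and> is_species G \<and>
     (\<forall>U. finite U \<longrightarrow> bij_betw (\<eta> U) (structs F U) (structs G U)) \<and>
     (\<forall>U V \<sigma>. finite U \<longrightarrow> bij_betw \<sigma> U V \<longrightarrow>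
        (\<forall>s\<in>structs F U. \<eta> V (transport F U \<sigma> s) = transport G U \<sigma> (\<eta> U s)))"

definition isomorphic :: "('a, 's) species \<Rightarrow> ('a, 't) species \<Rightarrow> bool" (infix "\<cong>" 50) where
  "F \<cong> G \<longleftrightarrow> (\<exists>\<eta>. natural_iso F G \<eta>)"

definition species_zero :: "('a, unit) species" where
  "species_zero = Species (\<lambda>U. {}) (\<lambda>U \<sigma> s. s)"

definition species_E :: "('a, unit) species" where
  "species_E = Species (\<lambda>U. {()}) (\<lambda>U \<sigma> s. s)"

definition species_restrict :: "('a set \<Rightarrow> bool) \<Rightarrow> ('a, 's) species \<Rightarrow> ('a, 's) species" where
  "species_restrict P F = Species (\<lambda>U. if P U then structs F U else {}) (transport F)"

definition species_one :: "('a, unit) species" where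
  "species_one = species_restrict (\<lambda>U. U = {}) species_E"

definition species_E_plus :: "('a, unit) species" where
  "species_E_plus = species_restrict (\<lambda>U. U \<noteq> {}) species_E"

definition species_sum :: "('a, 's) species \<Rightarrow> ('a, 't) species \<Rightarrow> ('a, 's + 't) species"
    (infixl "\<oplus>" 65) where
  "F \<oplus> G = Species (\<lambda>U. structs F U <+> structs G U)
     (\<lambda>U \<sigma>. map_sum (transport F U \<sigma>) (transport G U \<sigma>))"

definition species_prod ::
  "('a, 's) species \<Rightarrow> ('a, 't) species \<Rightarrow> ('a, ('a set \<times> 'a set) \<times> ('s \<times> 't)) species"
    (infixl "\<otimes>" 70) where
  "F \<otimes> G = Species
     (\<lambda>U. {((U1, U2), (s, t)) | U1 U2 s t.
             U1 \<union> U2 = U \<and> U1 \<inter> U2 = {} \<and> s \<in> structs F U1 \<and> t \<in> structs G U2})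
     (\<lambda>U \<sigma> ((U1, U2), (s, t)). ((\<sigma> ` U1, \<sigma> ` U2), (transport F U1 \<sigma> s, transport G U2 \<sigma> t)))"


subsection \<open>Basic facts on species and natural isomorphisms\<close>

lemma is_speciesI:
  assumes "\<And>U. finite U \<Longrightarrow> finite (structs F U)"
    and "\<And>U V \<sigma> s. finite U \<Longrightarrow> bij_betw \<sigma> U V \<Longrightarrow> s \<in> structs F U \<Longrightarrow> transport F U \<sigma> s \<in> structs F V"
    and "\<And>U s. finite U \<Longrightarrow> s \<in> structs F U \<Longrightarrow> transport F U id s = s"
    and "\<And>U V W \<sigma> \<tau> s. finite U \<Longrightarrow> bij_betw \<sigma> U V \<Longrightarrow> bij_betw \<tau> V W \<Longrightarrow> s \<in> structs F U \<Longrightarrow>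
           transport F U (\<tau> \<circ> \<sigma>) s = transport F V \<tau> (transport F U \<sigma> s)"
    and "\<And>U V \<sigma> \<sigma>' s. finite U \<Longrightarrow> bij_betw \<sigma> U V \<Longrightarrow> (\<And>x. x \<in> U \<Longrightarrow> \<sigma> x = \<sigma>' x) \<Longrightarrow>
           s \<in> structs F U \<Longrightarrow> transport F U \<sigma> s = transport F U \<sigma>' s"
  shows "is_species F"
  unfolding is_species_def
proof (intro conjI allI impI ballI)
qed (fact assms(1) | rule assms(2), assumption+ | rule assms(3), assumption+
  | rule assms(4), assumption+ | rule assms(5), assumption+, erule (1) bspec, assumption)+

lemma
  assumes "is_species F"
  shows species_finite: "finite U \<Longrightarrow> finite (structs F U)"
    and species_transport: "finite U \<Longrightarrow> bij_betw \<sigma> U V \<Longrightarrow> s \<in> structs F U \<Longrightarrow> transport F U \<sigma> s \<in> structs F V"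
    and species_id: "finite U \<Longrightarrow> s \<in> structs F U \<Longrightarrow> transport F U id s = s"
    and species_comp: "finite U \<Longrightarrow> bij_betw \<sigma> U V \<Longrightarrow> bij_betw \<tau> V W \<Longrightarrow> s \<in> structs F U \<Longrightarrow>
           transport F U (\<tau> \<circ> \<sigma>) s = transport F V \<tau> (transport F U \<sigma> s)"
    and species_cong: "finite U \<Longrightarrow> bij_betw \<sigma> U V \<Longrightarrow> (\<And>x. x \<in> U \<Longrightarrow> \<sigma> x = \<sigma>' x) \<Longrightarrow>
           s \<in> structs F U \<Longrightarrow> transport F U \<sigma> s = transport F U \<sigma>' s"
proof -
  note d = assms[unfolded is_species_def]
  note d1 = d[THEN conjunct1] and d' = d[THEN conjunct2]
  note d2 = d'[THEN conjunct1] and dd2 = d'[THEN conjunct2]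
  note d3 = dd2[THEN conjunct1] and dd3 = dd2[THEN conjunct2]
  note d4 = dd3[THEN conjunct1] and d5 = dd3[THEN conjunct2]
  show "finite U \<Longrightarrow> finite (structs F U)" by (rule d1[rule_format])
  show "finite U \<Longrightarrow> bij_betw \<sigma> U V \<Longrightarrow> s \<in> structs F U \<Longrightarrow> transport F U \<sigma> s \<in> structs F V"
    by (rule d2[rule_format])
  show "finite U \<Longrightarrow> s \<in> structs F U \<Longrightarrow> transport F U id s = s" by (rule d3[rule_format])
  show "finite U \<Longrightarrow> bij_betw \<sigma> U V \<Longrightarrow> bij_betw \<tau> V W \<Longrightarrow> s \<in> structs F U \<Longrightarrow>
      transport F U (\<tau> \<circ> \<sigma>) s = transport F V \<tau> (transport F U \<sigma> s)"
    by (rule d4[rule_format])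
  show "finite U \<Longrightarrow> bij_betw \<sigma> U V \<Longrightarrow> (\<And>x. x \<in> U \<Longrightarrow> \<sigma> x = \<sigma>' x) \<Longrightarrow>
      s \<in> structs F U \<Longrightarrow> transport F U \<sigma> s = transport F U \<sigma>' s"
    by (rule d5[rule_format])
qed

lemma natural_isoI:
  assumes "is_species F" "is_species G"
    and "\<And>U. finite U \<Longrightarrow> bij_betw (\<eta> U) (structs F U) (structs G U)"
    and "\<And>U V \<sigma> s. finite U \<Longrightarrow> bij_betw \<sigma> U V \<Longrightarrow> s \<in> structs F U \<Longrightarrow>
           \<eta> V (transport F U \<sigma> s) = transport G U \<sigma> (\<eta> U s)"
  shows "natural_iso F G \<eta>"
  unfolding natural_iso_def
proof (intro conjI allI impI ballI)
qed (fact assms(1) | fact assms(2) | rule assms(3), assumption | rule assms(4), assumption+)+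

lemma
  assumes "natural_iso F G \<eta>"
  shows natural_iso_species1: "is_species F"
    and natural_iso_species2: "is_species G"
    and natural_iso_bij: "finite U \<Longrightarrow> bij_betw (\<eta> U) (structs F U) (structs G U)"
    and natural_iso_natural: "finite U \<Longrightarrow> bij_betw \<sigma> U V \<Longrightarrow> s \<in> structs F U \<Longrightarrow>
           \<eta> V (transport F U \<sigma> s) = transport G U \<sigma> (\<eta> U s)"
proof -
  note d = assms[unfolded natural_iso_def]
  note d' = d[THEN conjunct2]
  note d3 = d'[THEN conjunct2, THEN conjunct1] and d4 = d'[THEN conjunct2, THEN conjunct2]
  show "is_species F" "is_species G" using d by simp_all
  show "finite U \<Longrightarrow> bij_betw (\<eta> U) (structs F U) (structs G U)" by (rule d3[rule_format])
  show "finite U \<Longrightarrow> bij_betw \<sigma> U V \<Longrightarrow> s \<in> structs F U \<Longrightarrow>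
      \<eta> V (transport F U \<sigma> s) = transport G U \<sigma> (\<eta> U s)" by (rule d4[rule_format])
qed

lemma is_species_transfer:
  assumes F: "is_species F"
    and bij: "\<And>U. finite U \<Longrightarrow> bij_betw (\<eta> U) (structs F U) (structs G U)"
    and nat: "\<And>U V \<sigma> s. finite U \<Longrightarrow> bij_betw \<sigma> U V \<Longrightarrow> s \<in> structs F U \<Longrightarrow>
           \<eta> V (transport F U \<sigma> s) = transport G U \<sigma> (\<eta> U s)"
  shows "is_species G"
proof -
  have ex: "\<exists>s\<in>structs F U. t = \<eta> U s" if "finite U" "t \<in> structs G U" for U t
    using bij[OF that(1)] that(2) unfolding bij_betw_def by auto
  have mem: "\<eta> U s \<in> structs G U" if "finite U" "s \<in> structs F U" for U s
    using bij[OF that(1)] that(2) unfolding bij_betw_def by auto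
  show ?thesis
  proof (rule is_speciesI)
    fix U :: "'a set" assume "finite U"
    then show "finite (structs G U)"
      using bij_betw_finite[OF bij] species_finite[OF F] by blast
  next
    fix U V :: "'a set" and \<sigma> t assume a: "finite U" "bij_betw \<sigma> U V" "t \<in> structs G U"
    have "finite V" using a bij_betw_finite by blast
    from ex[OF a(1,3)] obtain s where "s \<in> structs F U" "t = \<eta> U s" by blast
    then show "transport G U \<sigma> t \<in> structs G V"
      using nat[OF a(1,2)] mem[OF \<open>finite V\<close>] species_transport[OF F a(1,2)] by metis
  next
    fix U :: "'a set" and t assume a: "finite U" "t \<in> structs G U"
    from ex[OF a] obtain s where "s \<in> structs F U" "t = \<eta> U s" by blast
    then show "transport G U id t = t"
      using nat[OF a(1), of id U] species_id[OF F a(1)] by (metis bij_betw_id)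
  next
    fix U V W :: "'a set" and \<sigma> \<tau> t
    assume a: "finite U" "bij_betw \<sigma> U V" "bij_betw \<tau> V W" "t \<in> structs G U"
    have V: "finite V" using a bij_betw_finite by blast
    from ex[OF a(1,4)] obtain s where s: "s \<in> structs F U" "t = \<eta> U s" by blast
    have "transport G U (\<tau> \<circ> \<sigma>) t = \<eta> W (transport F U (\<tau> \<circ> \<sigma>) s)"
      using nat[OF a(1) bij_betw_trans[OF a(2,3)] s(1)] s(2) by simp
    also have "\<dots> = \<eta> W (transport F V \<tau> (transport F U \<sigma> s))"
      using species_comp[OF F a(1-3) s(1)] by simp
    also have "\<dots> = transport G V \<tau> (transport G U \<sigma> t)"
      using nat[OF V a(3) species_transport[OF F a(1,2) s(1)]] nat[OF a(1,2) s(1)] s(2) by simp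
    finally show "transport G U (\<tau> \<circ> \<sigma>) t = transport G V \<tau> (transport G U \<sigma> t)" .
  next
    fix U V :: "'a set" and \<sigma> \<sigma>' t
    assume a: "finite U" "bij_betw \<sigma> U V" "\<And>x. x \<in> U \<Longrightarrow> \<sigma> x = \<sigma>' x" "t \<in> structs G U"
    have b: "bij_betw \<sigma>' U V" using a(2) bij_betw_cong[of U \<sigma> \<sigma>' V] a(3) by blast
    from ex[OF a(1,4)] obtain s where s: "s \<in> structs F U" "t = \<eta> U s" by blast
    show "transport G U \<sigma> t = transport G U \<sigma>' t"
      using nat[OF a(1,2) s(1)] nat[OF a(1) b s(1)] species_cong[OF F a(1-3) s(1)] s(2) by metis
  qed
qed

lemma isomorphicI: "natural_iso F G \<eta> \<Longrightarrow> F \<cong> G"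
  unfolding isomorphic_def by (rule exI)

lemma isomorphic_species:
  assumes "F \<cong> G" shows "is_species F" "is_species G"
proof -
  from assms obtain \<eta> where "natural_iso F G \<eta>" unfolding isomorphic_def ..
  then show "is_species F" "is_species G"
    by (rule natural_iso_species1) (rule natural_iso_species2[OF \<open>natural_iso F G \<eta>\<close>])
qed

lemma isomorphic_refl: "is_species F \<Longrightarrow> F \<cong> F"
  by (rule isomorphicI[where \<eta> = "\<lambda>U s. s"], rule natural_isoI) (simp_all add: bij_betw_def)

lemma isomorphic_sym:
  assumes "F \<cong> G" shows "G \<cong> F"
proof -
  from assms obtain \<eta> where n: "natural_iso F G \<eta>" unfolding isomorphic_def ..
  note b = natural_iso_bij[OF n]
  show ?thesis
  proof (rule isomorphicI[where \<eta> = "\<lambda>U. inv_into (structs F U) (\<eta> U)"], rule natural_isoI[OF natural_iso_species2[OF n] natural_iso_species1[OF n]])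
    fix U :: "'a set" assume "finite U"
    then show "bij_betw (inv_into (structs F U) (\<eta> U)) (structs G U) (structs F U)"
      by (intro bij_betw_inv_into b)
  next
    fix U V :: "'a set" and \<sigma> t assume a: "finite U" "bij_betw \<sigma> U V" "t \<in> structs G U"
    have V: "finite V" using a bij_betw_finite by blast
    obtain s where s: "s \<in> structs F U" "t = \<eta> U s"
      using b[OF a(1)] a(3) unfolding bij_betw_def by auto
    have s': "transport F U \<sigma> s \<in> structs F V"
      using species_transport[OF natural_iso_species1[OF n] a(1,2) s(1)] .
    show "inv_into (structs F V) (\<eta> V) (transport G U \<sigma> t)
        = transport F U \<sigma> (inv_into (structs F U) (\<eta> U) t)"
      using natural_iso_natural[OF n a(1,2) s(1)] s s'
        bij_betw_inv_into_left[OF b[OF a(1)] s(1)] bij_betw_inv_into_left[OF b[OF V] s'] by simp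
  qed
qed

lemma isomorphic_trans:
  assumes "F \<cong> G" "G \<cong> H" shows "F \<cong> H"
proof -
  from assms obtain \<eta> \<theta> where n: "natural_iso F G \<eta>" "natural_iso G H \<theta>"
    unfolding isomorphic_def by blast
  show ?thesis
  proof (rule isomorphicI[where \<eta> = "\<lambda>U. \<theta> U \<circ> \<eta> U"], rule natural_isoI[OF natural_iso_species1[OF n(1)] natural_iso_species2[OF n(2)]])
    fix U :: "'a set" assume "finite U"
    then show "bij_betw (\<theta> U \<circ> \<eta> U) (structs F U) (structs H U)"
      by (intro bij_betw_trans[OF natural_iso_bij[OF n(1)] natural_iso_bij[OF n(2)]])
  next
    fix U V :: "'a set" and \<sigma> s assume a: "finite U" "bij_betw \<sigma> U V" "s \<in> structs F U"
    have "\<eta> U s \<in> structs G U"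
      using natural_iso_bij[OF n(1) a(1)] a(3) unfolding bij_betw_def by auto
    then show "(\<theta> V \<circ> \<eta> V) (transport F U \<sigma> s) = transport H U \<sigma> ((\<theta> U \<circ> \<eta> U) s)"
      using natural_iso_natural[OF n(1) a] natural_iso_natural[OF n(2) a(1,2)] by simp
  qed
qed

lemma is_species_zero: "is_species species_zero"
  by (rule is_speciesI) (auto simp: species_zero_def)

lemma is_species_E: "is_species species_E"
  by (rule is_speciesI) (auto simp: species_E_def)

lemma is_species_restrict:
  assumes "is_species F" "\<And>U V \<sigma>. finite U \<Longrightarrow> bij_betw \<sigma> U V \<Longrightarrow> P U \<Longrightarrow> P V"
  shows "is_species (species_restrict P F)"
proof (rule is_speciesI)
  note r = species_restrict_def
  show "finite (structs (species_restrict P F) U)" if "finite U" for U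
    using species_finite[OF assms(1) that] by (simp add: r)
  show "transport (species_restrict P F) U \<sigma> s \<in> structs (species_restrict P F) V"
    if "finite U" "bij_betw \<sigma> U V" "s \<in> structs (species_restrict P F) U" for U V \<sigma> s
    using species_transport[OF assms(1) that(1,2)] assms(2)[OF that(1,2)] that(3)
    by (simp add: r split: if_splits)
  show "transport (species_restrict P F) U id s = s"
    if "finite U" "s \<in> structs (species_restrict P F) U" for U s
    using species_id[OF assms(1) that(1)] that(2) by (simp add: r split: if_splits)
  show "transport (species_restrict P F) U (\<tau> \<circ> \<sigma>) s
      = transport (species_restrict P F) V \<tau> (transport (species_restrict P F) U \<sigma> s)"
    if "finite U" "bij_betw \<sigma> U V" "bij_betw \<tau> V W" "s \<in> structs (species_restrict P F) U"
    for U V W \<sigma> \<tau> s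
    using species_comp[OF assms(1) that(1-3)] that(4) by (simp add: r split: if_splits)
  show "transport (species_restrict P F) U \<sigma> s = transport (species_restrict P F) U \<sigma>' s"
    if "finite U" "bij_betw \<sigma> U V" "\<And>x. x \<in> U \<Longrightarrow> \<sigma> x = \<sigma>' x" "s \<in> structs (species_restrict P F) U"
    for U V \<sigma> \<sigma>' s
    using species_cong[OF assms(1) that(1-3)] that(4) by (simp add: r split: if_splits)
qed

lemma is_species_one: "is_species species_one"
  unfolding species_one_def by (rule is_species_restrict[OF is_species_E]) (auto simp: bij_betw_def)

lemma is_species_E_plus: "is_species species_E_plus"
  unfolding species_E_plus_def by (rule is_species_restrict[OF is_species_E]) (auto simp: bij_betw_def)

lemma is_species_sum:
  assumes "is_species F" "is_species G" shows "is_species (F \<oplus> G)"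
proof (rule is_speciesI)
  note r = species_sum_def
  show "finite (structs (F \<oplus> G) U)" if "finite U" for U
    using species_finite[OF assms(1) that] species_finite[OF assms(2) that] by (simp add: r)
  show "transport (F \<oplus> G) U \<sigma> s \<in> structs (F \<oplus> G) V"
    if "finite U" "bij_betw \<sigma> U V" "s \<in> structs (F \<oplus> G) U" for U V \<sigma> s
    using species_transport[OF assms(1) that(1,2)] species_transport[OF assms(2) that(1,2)] that(3)
    by (cases s) (auto simp: r)
  show "transport (F \<oplus> G) U id s = s" if "finite U" "s \<in> structs (F \<oplus> G) U" for U s
    using species_id[OF assms(1) that(1)] species_id[OF assms(2) that(1)] that(2)
    by (cases s) (auto simp: r)
  show "transport (F \<oplus> G) U (\<tau> \<circ> \<sigma>) s = transport (F \<oplus> G) V \<tau> (transport (F \<oplus> G) U \<sigma> s)"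
    if "finite U" "bij_betw \<sigma> U V" "bij_betw \<tau> V W" "s \<in> structs (F \<oplus> G) U" for U V W \<sigma> \<tau> s
    using species_comp[OF assms(1) that(1-3)] species_comp[OF assms(2) that(1-3)] that(4)
    by (cases s) (auto simp: r)
  show "transport (F \<oplus> G) U \<sigma> s = transport (F \<oplus> G) U \<sigma>' s"
    if "finite U" "bij_betw \<sigma> U V" "\<And>x. x \<in> U \<Longrightarrow> \<sigma> x = \<sigma>' x" "s \<in> structs (F \<oplus> G) U"
    for U V \<sigma> \<sigma>' s
    using species_cong[OF assms(1) that(1-3)] species_cong[OF assms(2) that(1-3)] that(4)
    by (cases s) (auto simp: r)
qed

lemma structs_prod: "x \<in> structs (F \<otimes> G) U \<longleftrightarrow> (\<exists>U1 U2 s t. x = ((U1, U2), (s, t)) \<and>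
    U1 \<union> U2 = U \<and> U1 \<inter> U2 = {} \<and> s \<in> structs F U1 \<and> t \<in> structs G U2)"
  unfolding species_prod_def by auto

lemma transport_prod: "transport (F \<otimes> G) U \<sigma> ((U1, U2), (s, t)) =
    ((\<sigma> ` U1, \<sigma> ` U2), (transport F U1 \<sigma> s, transport G U2 \<sigma> t))"
  unfolding species_prod_def by auto

lemma bij_betw_Un_parts:
  assumes "bij_betw \<sigma> (U1 \<union> U2) V" "U1 \<inter> U2 = {}"
  shows "bij_betw \<sigma> U1 (\<sigma> ` U1)" "bij_betw \<sigma> U2 (\<sigma> ` U2)" "\<sigma> ` U1 \<union> \<sigma> ` U2 = V"
    "\<sigma> ` U1 \<inter> \<sigma> ` U2 = {}"
proof -
  have i: "inj_on \<sigma> (U1 \<union> U2)" using assms(1) by (simp add: bij_betw_def)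
  show "bij_betw \<sigma> U1 (\<sigma> ` U1)" "bij_betw \<sigma> U2 (\<sigma> ` U2)"
    using i inj_on_subset by (blast intro: inj_on_imp_bij_betw)+
  show "\<sigma> ` U1 \<union> \<sigma> ` U2 = V" using assms(1) by (auto simp: bij_betw_def)
  show "\<sigma> ` U1 \<inter> \<sigma> ` U2 = {}" using inj_on_image_Int[OF i, of U1 U2] assms(2) by auto
qed

lemma is_species_prod:
  assumes F: "is_species F" and G: "is_species G" shows "is_species (F \<otimes> G)"
proof (rule is_speciesI)
  fix U :: "'a set" assume U: "finite U"
  have "structs (F \<otimes> G) U \<subseteq>
      (Pow U \<times> Pow U) \<times> ((\<Union>U1\<in>Pow U. structs F U1) \<times> (\<Union>U2\<in>Pow U. structs G U2))"
    unfolding species_prod_def by auto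
  moreover have "finite \<dots>"
    using U by (intro finite_cartesian_product finite_UN_I species_finite[OF F] species_finite[OF G])
      (auto intro: finite_subset)
  ultimately show "finite (structs (F \<otimes> G) U)" by (rule finite_subset)
next
  fix U V :: "'a set" and \<sigma> x
  assume a: "finite U" "bij_betw \<sigma> U V" "x \<in> structs (F \<otimes> G) U"
  from a(3) obtain U1 U2 s t where x: "x = ((U1, U2), (s, t))" "U1 \<union> U2 = U" "U1 \<inter> U2 = {}"
    "s \<in> structs F U1" "t \<in> structs G U2" unfolding structs_prod by blast
  have f: "finite U1" "finite U2" using a(1) x(2) by auto
  note b = bij_betw_Un_parts[OF a(2)[folded x(2)] x(3)]
  show "transport (F \<otimes> G) U \<sigma> x \<in> structs (F \<otimes> G) V"
    unfolding structs_prod x(1) transport_prod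
    using b(3,4) species_transport[OF F f(1) b(1) x(4)] species_transport[OF G f(2) b(2) x(5)]
    by blast
next
  fix U :: "'a set" and x assume a: "finite U" "x \<in> structs (F \<otimes> G) U"
  from a(2) obtain U1 U2 s t where x: "x = ((U1, U2), (s, t))" "U1 \<union> U2 = U" "U1 \<inter> U2 = {}"
    "s \<in> structs F U1" "t \<in> structs G U2" unfolding structs_prod by blast
  have f: "finite U1" "finite U2" using a(1) x(2) by auto
  show "transport (F \<otimes> G) U id x = x"
    unfolding x(1) transport_prod using species_id[OF F f(1) x(4)] species_id[OF G f(2) x(5)] by simp
next
  fix U V W :: "'a set" and \<sigma> \<tau> x
  assume a: "finite U" "bij_betw \<sigma> U V" "bij_betw \<tau> V W" "x \<in> structs (F \<otimes> G) U"
  from a(4) obtain U1 U2 s t where x: "x = ((U1, U2), (s, t))" "U1 \<union> U2 = U" "U1 \<inter> U2 = {}"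
    "s \<in> structs F U1" "t \<in> structs G U2" unfolding structs_prod by blast
  have f: "finite U1" "finite U2" using a(1) x(2) by auto
  note b = bij_betw_Un_parts[OF a(2)[folded x(2)] x(3)]
  note c = bij_betw_Un_parts[OF a(3)[folded b(3)] b(4)]
  show "transport (F \<otimes> G) U (\<tau> \<circ> \<sigma>) x = transport (F \<otimes> G) V \<tau> (transport (F \<otimes> G) U \<sigma> x)"
    unfolding x(1) transport_prod
    using species_comp[OF F f(1) b(1) c(1) x(4)] species_comp[OF G f(2) b(2) c(2) x(5)]
    by (simp add: image_comp)
next
  fix U V :: "'a set" and \<sigma> \<sigma>' x
  assume a: "finite U" "bij_betw \<sigma> U V" "\<And>x. x \<in> U \<Longrightarrow> \<sigma> x = \<sigma>' x" "x \<in> structs (F \<otimes> G) U"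
  from a(4) obtain U1 U2 s t where x: "x = ((U1, U2), (s, t))" "U1 \<union> U2 = U" "U1 \<inter> U2 = {}"
    "s \<in> structs F U1" "t \<in> structs G U2" unfolding structs_prod by blast
  have f: "finite U1" "finite U2" using a(1) x(2) by auto
  note b = bij_betw_Un_parts[OF a(2)[folded x(2)] x(3)]
  have e: "\<And>x. x \<in> U1 \<Longrightarrow> \<sigma> x = \<sigma>' x" "\<And>x. x \<in> U2 \<Longrightarrow> \<sigma> x = \<sigma>' x" using a(3) x(2) by auto
  show "transport (F \<otimes> G) U \<sigma> x = transport (F \<otimes> G) U \<sigma>' x"
    unfolding x(1) transport_prod
    using species_cong[OF F f(1) b(1) e(1) x(4)] species_cong[OF G f(2) b(2) e(2) x(5)] e
    by (simp cong: image_cong)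
qed


subsection \<open>Semiring laws up to natural isomorphism\<close>

lemma iso_sum_cong:
  assumes "F \<cong> F'" "G \<cong> G'" shows "F \<oplus> G \<cong> F' \<oplus> G'"
proof -
  from assms obtain \<eta> \<theta> where n: "natural_iso F F' \<eta>" "natural_iso G G' \<theta>"
    unfolding isomorphic_def by blast
  show ?thesis
  proof (rule isomorphicI[where \<eta> = "\<lambda>U. map_sum (\<eta> U) (\<theta> U)"], rule natural_isoI[OF
      is_species_sum[OF natural_iso_species1[OF n(1)] natural_iso_species1[OF n(2)]]
      is_species_sum[OF natural_iso_species2[OF n(1)] natural_iso_species2[OF n(2)]]])
    fix U :: "'a set" assume "finite U"
    then have b: "bij_betw (\<eta> U) (structs F U) (structs F' U)"
      "bij_betw (\<theta> U) (structs G U) (structs G' U)" using n natural_iso_bij by blast+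
    show "bij_betw (map_sum (\<eta> U) (\<theta> U)) (structs (F \<oplus> G) U) (structs (F' \<oplus> G') U)"
      unfolding bij_betw_def
    proof
      show "inj_on (map_sum (\<eta> U) (\<theta> U)) (structs (F \<oplus> G) U)"
        using b unfolding species_sum_def bij_betw_def species.sel
        by (intro inj_onI) (elim PlusE conjE; simp add: inj_on_eq_iff)
      show "map_sum (\<eta> U) (\<theta> U) ` structs (F \<oplus> G) U = structs (F' \<oplus> G') U"
        unfolding species_sum_def species.sel Plus_def b[THEN bij_betw_imp_surj_on, symmetric]
        by (simp add: image_Un image_image)
    qed
  next
    fix U V :: "'a set" and \<sigma> s assume "finite U" "bij_betw \<sigma> U V" "s \<in> structs (F \<oplus> G) U"
    then show "map_sum (\<eta> V) (\<theta> V) (transport (F \<oplus> G) U \<sigma> s)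
        = transport (F' \<oplus> G') U \<sigma> (map_sum (\<eta> U) (\<theta> U) s)"
      using natural_iso_natural[OF n(1), of U \<sigma> V] natural_iso_natural[OF n(2), of U \<sigma> V]
      unfolding species_sum_def species.sel by (elim PlusE) simp_all
  qed
qed

lemma iso_sum_commute:
  assumes "is_species F" "is_species G" shows "F \<oplus> G \<cong> G \<oplus> F"
proof (rule isomorphicI[where \<eta> = "\<lambda>U. case_sum Inr Inl"], rule natural_isoI[OF is_species_sum[OF assms]
    is_species_sum[OF assms(2,1)]])
  fix U :: "'a set"
  show "bij_betw (case_sum Inr Inl) (structs (F \<oplus> G) U) (structs (G \<oplus> F) U)"
    by (rule bij_betw_byWitness[where f' = "case_sum Inr Inl"]) (auto simp: species_sum_def)
qed (auto simp: species_sum_def)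

lemma iso_sum_assoc:
  assumes "is_species F" "is_species G" "is_species H"
  shows "(F \<oplus> G) \<oplus> H \<cong> F \<oplus> (G \<oplus> H)"
proof (rule isomorphicI[where \<eta> = "\<lambda>U. case_sum (case_sum Inl (Inr \<circ> Inl)) (Inr \<circ> Inr)"], rule natural_isoI[OF is_species_sum[OF is_species_sum[OF assms(1,2)] assms(3)]
    is_species_sum[OF assms(1) is_species_sum[OF assms(2,3)]]])
  fix U :: "'a set"
  show "bij_betw (case_sum (case_sum Inl (Inr \<circ> Inl)) (Inr \<circ> Inr))
      (structs ((F \<oplus> G) \<oplus> H) U) (structs (F \<oplus> (G \<oplus> H)) U)"
    by (rule bij_betw_byWitness[where f' = "case_sum (Inl \<circ> Inl) (case_sum (Inl \<circ> Inr) Inr)"])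
      (auto simp: species_sum_def)
qed (auto simp: species_sum_def)

lemma iso_sum_zero:
  assumes "is_species F" shows "species_zero \<oplus> F \<cong> F"
proof (rule isomorphicI[where \<eta> = "\<lambda>U. projr"], rule natural_isoI[OF is_species_sum[OF is_species_zero assms]
    assms])
  fix U :: "'a set"
  show "bij_betw projr (structs (species_zero \<oplus> F) U) (structs F U)"
    by (rule bij_betw_byWitness[where f' = Inr]) (auto simp: species_sum_def species_zero_def)
qed (auto simp: species_sum_def species_zero_def)

text \<open>The difference of bijections: follow the bijection until the common summand is left.\<close>

lemma iso_sum_cancel:
  fixes F :: "('a, 's) species" and G :: "('a, 't) species" and H :: "('a, 'u) species"
  assumes F: "is_species F" and G: "is_species G" and H: "is_species H"
    and iso: "F \<oplus> H \<cong> G \<oplus> H"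
  shows "F \<cong> G"
proof -
  from iso obtain \<phi> where n: "natural_iso (F \<oplus> H) (G \<oplus> H) \<phi>" unfolding isomorphic_def by blast
  define X where "X = (\<lambda>U. structs F U <+> structs H U)"
  define Y where "Y = (\<lambda>U. structs G U <+> structs H U)"
  have X: "structs (F \<oplus> H) U = X U" and Y: "structs (G \<oplus> H) U = Y U" for U
    by (auto simp: X_def Y_def species_sum_def)
  have inj: "inj_on (\<phi> U) (X U)" and im: "\<phi> U ` X U = Y U" if "finite U" for U
    using natural_iso_bij[OF n that] by (auto simp: bij_betw_def X Y)
  define T where "T = (\<lambda>U. {(x :: 's + 'u, y :: 's + 'u). x \<in> X U \<and> (\<exists>c. \<phi> U x = Inr c \<and> y = Inr c)})"
  define R where "R = (\<lambda>U a b. \<exists>z. (Inl a, z) \<in> (T U)\<^sup>* \<and> z \<in> X U \<and> \<phi> U z = Inl b)"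
  have TX: "z \<in> X U" if "finite U" "(x, z) \<in> (T U)\<^sup>*" "x \<in> X U" for U x z
    using that(2,3)
  proof (induction rule: rtrancl_induct)
    case (step y z)
    then obtain c where "\<phi> U y = Inr c" "z = Inr c" unfolding T_def by auto
    moreover have "\<phi> U y \<in> Y U" using im[OF that(1)] step by blast
    ultimately show ?case unfolding X_def Y_def by auto
  qed
  have ex: "\<exists>b. R U a b" if U: "finite U" and a: "a \<in> structs F U" for U a
  proof (rule ccontr)
    assume no: "\<not> ?thesis"
    define D where "D = {z. (Inl a, z) \<in> (T U)\<^sup>*}"
    have aX: "Inl a \<in> X U" using a unfolding X_def by (rule InlI)
    have D: "D \<subseteq> X U" using TX[OF U _ aX] unfolding D_def by blast
    have fin: "finite D"
      using D species_finite[OF F U] species_finite[OF H U] unfolding X_def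
      by (meson finite_Plus finite_subset)
    have r: "\<exists>c. \<phi> U z = Inr c" if "z \<in> D" for z
      using no that D unfolding R_def D_def by (cases "\<phi> U z") auto
    define g where "g = (\<lambda>z. Inr (projr (\<phi> U z)) :: 's + 'u)"
    have "inj_on g D"
    proof (rule inj_onI)
      fix x y assume xy: "x \<in> D" "y \<in> D" "g x = g y"
      then have "\<phi> U x = \<phi> U y" using r[OF xy(1)] r[OF xy(2)] unfolding g_def by auto
      then show "x = y" using inj[OF U] D xy(1,2) by (meson inj_onD subsetD)
    qed
    moreover have "g ` D \<subseteq> D - {Inl a}"
    proof (rule image_subsetI)
      fix z assume z: "z \<in> D"
      then have "(z, g z) \<in> T U" using r[OF z] D unfolding T_def g_def by auto
      then have "g z \<in> D" using z unfolding D_def by (simp add: rtrancl_into_rtrancl)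
      then show "g z \<in> D - {Inl a}" by (simp add: g_def)
    qed
    ultimately have "card D \<le> card (D - {Inl a})" using fin by (meson card_inj_on_le finite_Diff)
    moreover have "Inl a \<in> D" by (simp add: D_def)
    ultimately show False using fin by (meson card_Diff1_less leD)
  qed
  have sv: "single_valued (T U)" for U unfolding T_def single_valued_def by auto
  have svc: "single_valued ((T U)\<inverse>)" if "finite U" for U
    using inj[OF that] unfolding T_def single_valued_def inj_on_def by auto
  have det: "b = b'" if r: "R U a b" "R U a b'" for U a b b'
  proof -
    obtain z z' where z: "(Inl a, z) \<in> (T U)\<^sup>*" "\<phi> U z = Inl b"
      "(Inl a, z') \<in> (T U)\<^sup>*" "\<phi> U z' = Inl b'" using r unfolding R_def by blast
    have stop: "x = z" if "(x, z) \<in> (T U)\<^sup>*" "\<phi> U x = Inl d" for x z d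
      using that by (cases rule: converse_rtranclE) (auto simp: T_def)
    have "(z, z') \<in> (T U)\<^sup>* \<or> (z', z) \<in> (T U)\<^sup>*" using single_valued_confluent[OF sv z(1) z(3)] .
    then have "z = z'" using stop z by metis
    then show ?thesis using z by simp
  qed
  have injR: "a = a'" if U: "finite U" and r: "R U a b" "R U a' b" for U a a' b
  proof -
    obtain z z' where z: "(Inl a, z) \<in> (T U)\<^sup>*" "\<phi> U z = Inl b" "z \<in> X U"
      "(Inl a', z') \<in> (T U)\<^sup>*" "\<phi> U z' = Inl b" "z' \<in> X U" using r unfolding R_def by blast
    have "z = z'" using inj[OF U] z by (metis inj_onD)
    have "(z, Inl a) \<in> ((T U)\<inverse>)\<^sup>*" "(z, Inl a') \<in> ((T U)\<inverse>)\<^sup>*"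
      using z \<open>z = z'\<close> by (simp_all add: rtrancl_converse)
    from single_valued_confluent[OF svc[OF U] this]
    have *: "(Inl a', Inl a) \<in> (T U)\<^sup>* \<or> (Inl a, Inl a') \<in> (T U)\<^sup>*" by (simp add: rtrancl_converse)
    have start: "x = Inl d" if "(x, Inl d) \<in> (T U)\<^sup>*" for x d
      using that by (cases rule: rtranclE) (auto simp: T_def)
    from * start show ?thesis by blast
  qed
  have memR: "b \<in> structs G U" if "finite U" "R U a b" for U a b
  proof -
    obtain z where "z \<in> X U" "\<phi> U z = Inl b" using \<open>R U a b\<close> unfolding R_def by blast
    then have "Inl b \<in> Y U" using im[OF that(1)] by force
    then show ?thesis by (auto simp: Y_def)
  qed
  define \<psi> where "\<psi> = (\<lambda>U a. THE b. R U a b)"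
  have \<psi>: "\<psi> U a = b" if "R U a b" for U a b
    unfolding \<psi>_def using that det by blast
  have R\<psi>: "R U a (\<psi> U a)" if "finite U" "a \<in> structs F U" for U a
    using ex[OF that] \<psi> by metis
  have inj\<psi>: "inj_on (\<psi> U) (structs F U)" if "finite U" for U
    by (rule inj_onI) (metis that R\<psi> injR)
  have mem\<psi>: "\<psi> U ` structs F U \<subseteq> structs G U" if "finite U" for U
    using R\<psi>[OF that] memR[OF that] by blast
  have card: "card (structs F U) = card (structs G U)" if U: "finite U" for U
  proof -
    have "card (X U) = card (Y U)" using natural_iso_bij[OF n U] bij_betw_same_card X Y by metis
    then show ?thesis
      using species_finite[OF F U] species_finite[OF G U] species_finite[OF H U]
      unfolding X_def Y_def by (simp add: card_Plus)
  qed
  show ?thesis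
  proof (rule isomorphicI[where \<eta> = \<psi>], rule natural_isoI[OF F G])
    fix U :: "'a set" assume U: "finite U"
    have "\<psi> U ` structs F U = structs G U"
      using species_finite[OF G U] mem\<psi>[OF U] card_image[OF inj\<psi>[OF U]] card[OF U]
      by (metis card_subset_eq)
    then show "bij_betw (\<psi> U) (structs F U) (structs G U)" using inj\<psi>[OF U] by (simp add: bij_betw_def)
  next
    fix U V :: "'a set" and \<sigma> a assume s: "finite U" "bij_betw \<sigma> U V" "a \<in> structs F U"
    have V: "finite V" using s bij_betw_finite by blast
    let ?t = "transport (F \<oplus> H) U \<sigma>"
    have t: "?t x \<in> X V" if "x \<in> X U" for x
      using species_transport[OF is_species_sum[OF F H] s(1,2)] that unfolding X by blast
    have nat: "\<phi> V (?t x) = transport (G \<oplus> H) U \<sigma> (\<phi> U x)" if "x \<in> X U" for x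
      using natural_iso_natural[OF n s(1,2)] that unfolding X by blast
    have tr: "(?t (Inl a), ?t z) \<in> (T V)\<^sup>*" if "(Inl a, z) \<in> (T U)\<^sup>*" for z
      using that
    proof (induction rule: rtrancl_induct)
      case (step y z)
      then obtain c where c: "y \<in> X U" "\<phi> U y = Inr c" "z = Inr c" unfolding T_def by auto
      have "(?t y, ?t z) \<in> T V"
        using nat[OF c(1)] t[OF c(1)] c(2,3) unfolding T_def by (simp add: species_sum_def)
      with step show ?case by (meson rtrancl.rtrancl_into_rtrancl)
    qed simp
    obtain z where z: "(Inl a, z) \<in> (T U)\<^sup>*" "z \<in> X U" "\<phi> U z = Inl (\<psi> U a)"
      using R\<psi>[OF s(1,3)] unfolding R_def by blast
    have "R V (transport F U \<sigma> a) (transport G U \<sigma> (\<psi> U a))"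
      unfolding R_def using tr[OF z(1)] t[OF z(2)] nat[OF z(2)] z(3)
      by (auto simp: species_sum_def)
    then show "\<psi> V (transport F U \<sigma> a) = transport G U \<sigma> (\<psi> U a)" by (rule \<psi>)
  qed
qed

lemma iso_prod_cong:
  assumes "F \<cong> F'" "G \<cong> G'" shows "F \<otimes> G \<cong> F' \<otimes> G'"
proof -
  from assms obtain \<eta> \<theta> where n: "natural_iso F F' \<eta>" "natural_iso G G' \<theta>"
    unfolding isomorphic_def by blast
  let ?h = "\<lambda>((U1, U2), (s, t)). ((U1, U2), (\<eta> U1 s, \<theta> U2 t))"
  show ?thesis
  proof (rule isomorphicI[where \<eta> = "\<lambda>U. ?h"], rule natural_isoI[OF
      is_species_prod[OF natural_iso_species1[OF n(1)] natural_iso_species1[OF n(2)]]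
      is_species_prod[OF natural_iso_species2[OF n(1)] natural_iso_species2[OF n(2)]]])
    fix U :: "'a set" assume U: "finite U"
    have b: "bij_betw (\<eta> W) (structs F W) (structs F' W)"
      "bij_betw (\<theta> W) (structs G W) (structs G' W)" if "W \<subseteq> U" for W
      using n natural_iso_bij U finite_subset[OF that] by blast+
    show "bij_betw ?h (structs (F \<otimes> G) U) (structs (F' \<otimes> G') U)"
      unfolding bij_betw_def
    proof
      show "inj_on ?h (structs (F \<otimes> G) U)"
      proof (rule inj_onI)
        fix x y assume x: "x \<in> structs (F \<otimes> G) U" and y: "y \<in> structs (F \<otimes> G) U" and e: "?h x = ?h y"
        from x obtain U1 U2 s t where x: "x = ((U1, U2), (s, t))" "U1 \<union> U2 = U"
          "s \<in> structs F U1" "t \<in> structs G U2" unfolding structs_prod by blast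
        from y e x obtain s' t' where y: "y = ((U1, U2), (s', t'))"
          "s' \<in> structs F U1" "t' \<in> structs G U2" "\<eta> U1 s = \<eta> U1 s'" "\<theta> U2 t = \<theta> U2 t'"
          unfolding structs_prod by auto
        have "U1 \<subseteq> U" "U2 \<subseteq> U" using x by auto
        then show "x = y" using x y b by (metis bij_betw_inv_into_left)
      qed
      show "?h ` structs (F \<otimes> G) U = structs (F' \<otimes> G') U"
      proof (intro equalityI subsetI)
        fix y assume "y \<in> ?h ` structs (F \<otimes> G) U"
        then obtain x where x: "x \<in> structs (F \<otimes> G) U" "y = ?h x" by blast
        from x(1) obtain U1 U2 s t where z: "x = ((U1, U2), (s, t))" "U1 \<union> U2 = U" "U1 \<inter> U2 = {}"
          "s \<in> structs F U1" "t \<in> structs G U2" unfolding structs_prod by blast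
        have w: "U1 \<subseteq> U" "U2 \<subseteq> U" using z by auto
        have "\<eta> U1 s \<in> structs F' U1" "\<theta> U2 t \<in> structs G' U2"
          using b(1)[OF w(1)] b(2)[OF w(2)] z by (auto simp: bij_betw_def)
        then show "y \<in> structs (F' \<otimes> G') U"
          unfolding structs_prod using x(2) z by auto
      next
        fix y assume "y \<in> structs (F' \<otimes> G') U"
        then obtain U1 U2 s t where z: "y = ((U1, U2), (s, t))" "U1 \<union> U2 = U" "U1 \<inter> U2 = {}"
          "s \<in> structs F' U1" "t \<in> structs G' U2" unfolding structs_prod by blast
        have w: "U1 \<subseteq> U" "U2 \<subseteq> U" using z by auto
        obtain s' t' where "s' \<in> structs F U1" "t' \<in> structs G U2" "s = \<eta> U1 s'" "t = \<theta> U2 t'"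
          using z(4,5) unfolding b(1)[OF w(1), THEN bij_betw_imp_surj_on, symmetric]
            b(2)[OF w(2), THEN bij_betw_imp_surj_on, symmetric] by (elim imageE)
        then have "((U1, U2), (s', t')) \<in> structs (F \<otimes> G) U" "y = ?h ((U1, U2), (s', t'))"
          unfolding structs_prod using z by auto
        then show "y \<in> ?h ` structs (F \<otimes> G) U" by blast
      qed
    qed
  next
    fix U V :: "'a set" and \<sigma> x assume a: "finite U" "bij_betw \<sigma> U V" "x \<in> structs (F \<otimes> G) U"
    from a(3) obtain U1 U2 s t where x: "x = ((U1, U2), (s, t))" "U1 \<union> U2 = U" "U1 \<inter> U2 = {}"
      "s \<in> structs F U1" "t \<in> structs G U2" unfolding structs_prod by blast
    have f: "finite U1" "finite U2" using a(1) x(2) by auto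
    note b = bij_betw_Un_parts[OF a(2)[folded x(2)] x(3)]
    show "?h (transport (F \<otimes> G) U \<sigma> x) = transport (F' \<otimes> G') U \<sigma> (?h x)"
      using natural_iso_natural[OF n(1) f(1) b(1) x(4)] natural_iso_natural[OF n(2) f(2) b(2) x(5)]
      by (simp add: x(1) transport_prod)
  qed
qed

lemma iso_prod_commute:
  assumes "is_species F" "is_species G" shows "F \<otimes> G \<cong> G \<otimes> F"
proof (rule isomorphicI[where \<eta> = "\<lambda>U ((U1, U2), (s, t)). ((U2, U1), (t, s))"], rule natural_isoI[OF is_species_prod[OF assms]
    is_species_prod[OF assms(2,1)]])
  fix U :: "'a set"
  show "bij_betw (\<lambda>((U1, U2), (s, t)). ((U2, U1), (t, s))) (structs (F \<otimes> G) U) (structs (G \<otimes> F) U)"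
    by (rule bij_betw_byWitness[where f' = "\<lambda>((U1, U2), (s, t)). ((U2, U1), (t, s))"])
      (auto simp: species_prod_def)
qed (auto simp: species_prod_def)

lemma iso_prod_assoc:
  assumes "is_species F" "is_species G" "is_species H"
  shows "(F \<otimes> G) \<otimes> H \<cong> F \<otimes> (G \<otimes> H)"
proof (rule isomorphicI[where \<eta> = "\<lambda>U ((U12, U3), (((U1, U2), (s, t)), u)).
      ((U1, U2 \<union> U3), (s, ((U2, U3), (t, u))))"], rule natural_isoI[OF is_species_prod[OF is_species_prod[OF assms(1,2)] assms(3)]
    is_species_prod[OF assms(1) is_species_prod[OF assms(2,3)]]])
  fix U :: "'a set"
  show "bij_betw (\<lambda>((U12, U3), (((U1, U2), (s, t)), u)). ((U1, U2 \<union> U3), (s, ((U2, U3), (t, u)))))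
      (structs ((F \<otimes> G) \<otimes> H) U) (structs (F \<otimes> (G \<otimes> H)) U)"
    by (rule bij_betw_byWitness[where f' = "\<lambda>((U1, U23), (s, ((U2, U3), (t, u)))).
        ((U1 \<union> U2, U3), (((U1, U2), (s, t)), u))"])
      (auto simp: species_prod_def)
qed (auto simp: species_prod_def)

lemma iso_prod_one:
  assumes "is_species F" shows "species_one \<otimes> F \<cong> F"
proof (rule isomorphicI[where \<eta> = "\<lambda>U ((U1, U2), (s, t)). t"], rule natural_isoI[OF is_species_prod[OF is_species_one assms]
    assms])
  fix U :: "'a set"
  show "bij_betw (\<lambda>((U1, U2), (s, t)). t) (structs (species_one \<otimes> F) U) (structs F U)"
    by (rule bij_betw_byWitness[where f' = "\<lambda>t. (({}, U), ((), t))"])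
      (auto simp: species_prod_def species_one_def species_restrict_def species_E_def split: if_splits)
qed (auto simp: species_prod_def species_one_def species_restrict_def split: if_splits)

lemma iso_prod_zero:
  assumes "is_species F" shows "species_zero \<otimes> F \<cong> species_zero"
  by (rule isomorphicI[where \<eta> = "\<lambda>U x. ()"], 
      rule natural_isoI[OF is_species_prod[OF is_species_zero assms] is_species_zero])
    (auto simp: species_prod_def species_zero_def bij_betw_def)

lemma iso_distrib:
  assumes "is_species F" "is_species G" "is_species H"
  shows "(F \<oplus> G) \<otimes> H \<cong> (F \<otimes> H) \<oplus> (G \<otimes> H)"
proof (rule isomorphicI[where \<eta> = "\<lambda>U (p, (x, t)). case x of Inl s \<Rightarrow> Inl (p, (s, t)) | Inr s \<Rightarrow> Inr (p, (s, t))"],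
    rule natural_isoI[OF is_species_prod[OF is_species_sum[OF assms(1,2)] assms(3)]
    is_species_sum[OF is_species_prod[OF assms(1,3)] is_species_prod[OF assms(2,3)]]])
  fix U :: "'a set"
  show "bij_betw (\<lambda>(p, (x, t)). case x of Inl s \<Rightarrow> Inl (p, (s, t)) | Inr s \<Rightarrow> Inr (p, (s, t)))
     (structs ((F \<oplus> G) \<otimes> H) U) (structs ((F \<otimes> H) \<oplus> (G \<otimes> H)) U)"
    by (rule bij_betw_byWitness[where
          f' = "case_sum (\<lambda>(p, (s, t)). (p, (Inl s, t))) (\<lambda>(p, (s, t)). (p, (Inr s, t)))"])
      (auto simp: species_prod_def species_sum_def)
qed (auto simp: species_prod_def species_sum_def)


section \<open>The semiring of species and the ring of virtual species\<close>

text \<open>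
  Since structure sets are finite, every species is isomorphic to one whose structures are natural
  numbers; so isomorphism classes of species, whatever their type of structures, are represented by
  species of type \<open>('a, nat) species\<close>.
\<close>

definition species_code :: "('a, 's) species \<Rightarrow> ('a, nat) species" where
  "species_code F = Species
     (\<lambda>U. to_nat_on (structs F U) ` structs F U)
     (\<lambda>U \<sigma> k. to_nat_on (structs F (\<sigma> ` U)) (transport F U \<sigma> (from_nat_into (structs F U) k)))"

lemma iso_code:
  assumes F: "is_species F" shows "F \<cong> species_code F"
proof -
  have b: "bij_betw (to_nat_on (structs F U)) (structs F U) (structs (species_code F) U)"
    if "finite U" for U
    using inj_on_to_nat_on[OF countable_finite[OF species_finite[OF F that]]]
    by (simp add: species_code_def bij_betw_def)
  have n: "to_nat_on (structs F V) (transport F U \<sigma> s)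
      = transport (species_code F) U \<sigma> (to_nat_on (structs F U) s)"
    if "finite U" "bij_betw \<sigma> U V" "s \<in> structs F U" for U V \<sigma> s
    using that countable_finite[OF species_finite[OF F that(1)]]
    by (simp add: species_code_def bij_betw_def)
  show ?thesis
    by (rule isomorphicI[where \<eta> = "\<lambda>U. to_nat_on (structs F U)"], rule natural_isoI)
      (use F b n is_species_transfer[OF F b n] in blast)+
qed

lemma is_species_code: "is_species F \<Longrightarrow> is_species (species_code F)"
  using iso_code isomorphic_species(2) by blast

lemma iso_code_cong: "F \<cong> G \<Longrightarrow> species_code F \<cong> species_code G"
  by (meson iso_code isomorphic_species isomorphic_sym isomorphic_trans)

quotient_type 'a spe = "('a, nat) species" / partial: "isomorphic"
proof (rule part_equivpI)
  show "\<exists>F :: ('a, nat) species. F \<cong> F"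
    using isomorphic_refl[OF is_species_code[OF is_species_zero]] by blast
qed (auto intro!: sympI transpI intro: isomorphic_sym isomorphic_trans)

definition spe_of :: "('a, 's) species \<Rightarrow> 'a spe" where
  "spe_of F = abs_spe (species_code F)"

lemma spe_of_eq_iff:
  assumes "is_species F" "is_species G"
  shows "spe_of F = spe_of G \<longleftrightarrow> F \<cong> G"
proof -
  have "spe_of F = spe_of G \<longleftrightarrow> species_code F \<cong> species_code G"
    using Quotient3_rel[OF Quotient3_spe, of "species_code F" "species_code G"]
      isomorphic_refl[OF is_species_code[OF assms(1)]] isomorphic_refl[OF is_species_code[OF assms(2)]]
    unfolding spe_of_def by simp
  also have "\<dots> \<longleftrightarrow> F \<cong> G"
    using iso_code[OF assms(1)] iso_code[OF assms(2)] isomorphic_sym isomorphic_trans by metis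
  finally show ?thesis .
qed

lemma spe_exhaust: "\<exists>F :: ('a, nat) species. is_species F \<and> (x :: 'a spe) = spe_of F"
proof -
  define F where "F = rep_spe x"
  have "F \<cong> F" unfolding F_def by (rule Quotient3_rep_reflp[OF Quotient3_spe])
  then have F: "is_species F" by (rule isomorphic_species)
  have "x = abs_spe F" unfolding F_def by (rule Quotient3_abs_rep[OF Quotient3_spe, symmetric])
  also have "\<dots> = spe_of F"
    unfolding spe_of_def by (rule Quotient3_rel_abs[OF Quotient3_spe iso_code[OF F]])
  finally show ?thesis using F by (intro exI conjI)
qed

instantiation spe :: (type) comm_semiring_1
begin

lift_definition zero_spe :: "'a spe" is "species_code species_zero"
  by (rule isomorphic_refl[OF is_species_code[OF is_species_zero]])

lift_definition one_spe :: "'a spe" is "species_code species_one"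
  by (rule isomorphic_refl[OF is_species_code[OF is_species_one]])

lift_definition plus_spe :: "'a spe \<Rightarrow> 'a spe \<Rightarrow> 'a spe" is "\<lambda>F G. species_code (F \<oplus> G)"
  by (rule iso_code_cong[OF iso_sum_cong])

lift_definition times_spe :: "'a spe \<Rightarrow> 'a spe \<Rightarrow> 'a spe" is "\<lambda>F G. species_code (F \<otimes> G)"
  by (rule iso_code_cong[OF iso_prod_cong])

lemma spe_of_zero: "spe_of species_zero = 0"
  by (simp add: spe_of_def zero_spe_def)

lemma spe_of_one: "spe_of species_one = 1"
  by (simp add: spe_of_def one_spe_def)

lemma spe_of_sum:
  assumes "is_species F" "is_species G" shows "spe_of (F \<oplus> G) = spe_of F + spe_of G"
proof -
  have "spe_of F + spe_of G = abs_spe (species_code (species_code F \<oplus> species_code G))"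
    unfolding spe_of_def
    by (rule plus_spe.abs_eq) (use assms isomorphic_refl is_species_code in blast)+
  also have "\<dots> = spe_of (F \<oplus> G)"
    unfolding spe_of_def[symmetric]
    by (subst spe_of_eq_iff)
      (use assms in \<open>auto intro!: is_species_sum is_species_code iso_sum_cong isomorphic_sym[OF iso_code]\<close>)
  finally show ?thesis by simp
qed

lemma spe_of_prod:
  assumes "is_species F" "is_species G" shows "spe_of (F \<otimes> G) = spe_of F * spe_of G"
proof -
  have "spe_of F * spe_of G = abs_spe (species_code (species_code F \<otimes> species_code G))"
    unfolding spe_of_def
    by (rule times_spe.abs_eq) (use assms isomorphic_refl is_species_code in blast)+
  also have "\<dots> = spe_of (F \<otimes> G)"
    unfolding spe_of_def[symmetric]
    by (subst spe_of_eq_iff)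
      (use assms in \<open>auto intro!: is_species_prod is_species_code iso_prod_cong isomorphic_sym[OF iso_code]\<close>)
  finally show ?thesis by simp
qed

instance
proof
  fix x y z :: "'a spe"
  obtain F G H :: "('a, nat) species" where s: "is_species F" "is_species G" "is_species H"
    and x: "x = spe_of F" "y = spe_of G" "z = spe_of H" using spe_exhaust by metis
  note S = s is_species_sum is_species_prod is_species_zero is_species_one
  show "x * y * z = x * (y * z)"
    using iso_prod_assoc[OF s] by (simp add: x S spe_of_eq_iff flip: spe_of_prod)
  show "x * y = y * x"
    using iso_prod_commute[OF s(1,2)] by (simp add: x S spe_of_eq_iff flip: spe_of_prod)
  show "1 * x = x"
    using iso_prod_one[OF s(1)] by (simp add: x S spe_of_eq_iff flip: spe_of_prod spe_of_one)
  show "x + y + z = x + (y + z)"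
    using iso_sum_assoc[OF s] by (simp add: x S spe_of_eq_iff flip: spe_of_sum)
  show "x + y = y + x"
    using iso_sum_commute[OF s(1,2)] by (simp add: x S spe_of_eq_iff flip: spe_of_sum)
  show "0 + x = x"
    using iso_sum_zero[OF s(1)] by (simp add: x S spe_of_eq_iff flip: spe_of_sum spe_of_zero)
  show z: "0 * x = 0"
    using iso_prod_zero[OF s(1)] by (simp add: x S spe_of_eq_iff flip: spe_of_prod spe_of_zero)
  show "x * 0 = 0"
    using z iso_prod_commute[OF s(1) is_species_zero]
    by (simp add: x S spe_of_eq_iff flip: spe_of_prod spe_of_zero) (metis isomorphic_trans)
  show "(x + y) * z = x * z + y * z"
    using iso_distrib[OF s] by (simp add: x S spe_of_eq_iff flip: spe_of_prod spe_of_sum)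
  show "(0 :: 'a spe) \<noteq> 1"
  proof
    assume "(0 :: 'a spe) = 1"
    then have "(species_zero :: ('a, unit) species) \<cong> species_one"
      by (simp add: S spe_of_eq_iff flip: spe_of_zero spe_of_one)
    then obtain \<eta> where "natural_iso (species_zero :: ('a, unit) species) species_one \<eta>"
      unfolding isomorphic_def by blast
    from natural_iso_bij[OF this, of "{}"] show False
      by (simp add: species_zero_def species_one_def species_restrict_def species_E_def bij_betw_def)
  qed
qed

end

instance spe :: (type) cancel_semigroup_add
proof
  have *: "y = z" if "y + x = z + x" for x y z :: "'a spe"
  proof -
    obtain F G H :: "('a, nat) species" where s: "is_species F" "is_species G" "is_species H"
      and x: "x = spe_of F" "y = spe_of G" "z = spe_of H" using spe_exhaust by metis
    from that have "G \<oplus> F \<cong> H \<oplus> F"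
      by (simp add: x s is_species_sum spe_of_eq_iff flip: spe_of_sum)
    from iso_sum_cancel[OF s(2,3,1) this] show ?thesis by (simp add: x s spe_of_eq_iff)
  qed
  show "b = c" if "b + a = c + a" for a b c :: "'a spe"
    using that by (rule *)
  show "b = c" if "a + b = a + c" for a b c :: "'a spe"
    using that unfolding add.commute[of a] by (rule *)
qed

definition virt_eq :: "'a spe \<times> 'a spe \<Rightarrow> 'a spe \<times> 'a spe \<Rightarrow> bool" where
  "virt_eq = (\<lambda>(F, G) (H, K). F + K = G + H)"

quotient_type 'a virt = "'a spe \<times> 'a spe" / virt_eq
proof (rule equivpI)
  show "reflp (virt_eq :: 'a spe \<times> 'a spe \<Rightarrow> _)"
    by (rule reflpI) (auto simp: virt_eq_def add.commute)
  show "symp (virt_eq :: 'a spe \<times> 'a spe \<Rightarrow> _)"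
    by (rule sympI) (auto simp: virt_eq_def add.commute)
  show "transp (virt_eq :: 'a spe \<times> 'a spe \<Rightarrow> _)"
  proof (rule transpI, clarsimp simp: virt_eq_def)
    fix F G H K L M :: "'a spe"
    assume a: "F + K = G + H" "H + M = K + L"
    have "(F + M) + (H + K) = (F + K) + (H + M)" by (simp add: ac_simps)
    also have "\<dots> = (G + L) + (H + K)" unfolding a by (simp add: ac_simps)
    finally show "F + M = G + L" by simp
  qed
qed

text \<open>The class \<open>F - 0\<close> with which a species \<open>F\<close> is identified.\<close>

definition virt_of :: "('a, 's) species \<Rightarrow> 'a virt" where
  "virt_of F = abs_virt (spe_of F, 0)"

instantiation virt :: (type) comm_ring_1
begin

lift_definition zero_virt :: "'a virt" is "(0, 0)" .

lift_definition one_virt :: "'a virt" is "(1, 0)" .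

lift_definition plus_virt :: "'a virt \<Rightarrow> 'a virt \<Rightarrow> 'a virt"
  is "\<lambda>(F, G) (H, K). (F + H, G + K)"
proof (clarsimp simp: virt_eq_def)
  fix F G F' G' H K H' K' :: "'a spe"
  assume a: "F + G' = G + F'" "H + K' = K + H'"
  have "F + H + (G' + K') = (F + G') + (H + K')" by (simp add: ac_simps)
  also have "\<dots> = G + K + (F' + H')" unfolding a by (simp add: ac_simps)
  finally show "F + H + (G' + K') = G + K + (F' + H')" .
qed

lift_definition uminus_virt :: "'a virt \<Rightarrow> 'a virt" is "\<lambda>(F, G). (G, F)"
  by (auto simp: virt_eq_def)

lift_definition minus_virt :: "'a virt \<Rightarrow> 'a virt \<Rightarrow> 'a virt"
  is "\<lambda>(F, G) (H, K). (F + K, G + H)"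
proof (clarsimp simp: virt_eq_def)
  fix F G F' G' H K H' K' :: "'a spe"
  assume a: "F + G' = G + F'" "H + K' = K + H'"
  have "F + K + (G' + H') = (F + G') + (K + H')" by (simp add: ac_simps)
  also have "\<dots> = G + H + (F' + K')" unfolding a(1) a(2)[symmetric] by (simp add: ac_simps)
  finally show "F + K + (G' + H') = G + H + (F' + K')" .
qed

lift_definition times_virt :: "'a virt \<Rightarrow> 'a virt \<Rightarrow> 'a virt"
  is "\<lambda>(F, G) (H, K). (F * H + G * K, F * K + G * H)"
proof (clarsimp simp: virt_eq_def)
  fix F G F' G' H K H' K' :: "'a spe"
  assume a: "F + G' = G + F'" "H + K' = K + H'"
  have 1: "F * H + G * K + (F' * K + G' * H) = F * K + G * H + (F' * H + G' * K)"
  proof -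
    have "F * H + G * K + (F' * K + G' * H) = (F + G') * H + (G + F') * K" by (simp add: algebra_simps)
    also have "\<dots> = (G + F') * H + (F + G') * K" by (simp add: a)
    finally show ?thesis by (simp add: algebra_simps)
  qed
  have 2: "F' * H + G' * K + (F' * K' + G' * H') = F' * K + G' * H + (F' * H' + G' * K')"
  proof -
    have "F' * H + G' * K + (F' * K' + G' * H') = F' * (H + K') + G' * (K + H')" by (simp add: algebra_simps)
    also have "\<dots> = F' * (K + H') + G' * (H + K')" by (simp add: a)
    finally show ?thesis by (simp add: algebra_simps)
  qed
  have "(F * H + G * K + (F' * K' + G' * H')) + ((F' * K + G' * H) + (F' * H + G' * K))
      = (F * H + G * K + (F' * K + G' * H)) + (F' * H + G' * K + (F' * K' + G' * H'))"
    by (simp only: ac_simps)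
  also have "\<dots> = (F * K + G * H + (F' * H' + G' * K')) + ((F' * K + G' * H) + (F' * H + G' * K))"
    unfolding 1 2 by (simp only: ac_simps)
  finally show "F * H + G * K + (F' * K' + G' * H') = F * K + G * H + (F' * H' + G' * K')"
    by (simp only: add_right_cancel)
qed

instance
proof
  fix x y z :: "'a virt"
  show "x * y * z = x * (y * z)" by transfer (auto simp: virt_eq_def algebra_simps)
  show "x * y = y * x" by transfer (auto simp: virt_eq_def algebra_simps)
  show "1 * x = x" by transfer (auto simp: virt_eq_def algebra_simps)
  show "x + y + z = x + (y + z)" by transfer (auto simp: virt_eq_def algebra_simps)
  show "x + y = y + x" by transfer (auto simp: virt_eq_def algebra_simps)
  show "0 + x = x" by transfer (auto simp: virt_eq_def algebra_simps)
  show "- x + x = 0" by transfer (auto simp: virt_eq_def algebra_simps)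
  show "x - y = x + - y" by transfer (auto simp: virt_eq_def algebra_simps)
  show "(x + y) * z = x * z + y * z" by transfer (auto simp: virt_eq_def algebra_simps)
  show "(0 :: 'a virt) \<noteq> 1" by transfer (auto simp: virt_eq_def)
qed

end

lemma virt_of_eq_iff:
  assumes "is_species F" "is_species G"
  shows "virt_of F = virt_of G \<longleftrightarrow> F \<cong> G"
  using spe_of_eq_iff[OF assms] by (simp add: virt_of_def virt.abs_eq_iff virt_eq_def)

lemma virt_of_sum: "is_species F \<Longrightarrow> is_species G \<Longrightarrow> virt_of (F \<oplus> G) = virt_of F + virt_of G"
  by (simp add: virt_of_def plus_virt.abs_eq spe_of_sum)

lemma virt_of_prod: "is_species F \<Longrightarrow> is_species G \<Longrightarrow> virt_of (F \<otimes> G) = virt_of F * virt_of G"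
  by (simp add: virt_of_def times_virt.abs_eq spe_of_prod)


subsection \<open>Infinite sums of virtual species\<close>

text \<open>
  \<open>virt_trunc n\<close> keeps the structures on sets with at most \<open>n\<close> elements. In the topology below, a
  sequence converges iff each of its truncations is eventually constant; so \<open>f sums V\<close> means that,
  for every \<open>n\<close>, only finitely many \<open>f m\<close> have a nonzero truncation at \<open>n\<close>, and that the
  truncation of \<open>V\<close> is the sum of these.
\<close>

abbreviation species_trunc :: "nat \<Rightarrow> ('a, 's) species \<Rightarrow> ('a, 's) species" where
  "species_trunc n \<equiv> species_restrict (\<lambda>U. card U \<le> n)"

lemma is_species_trunc: "is_species F \<Longrightarrow> is_species (species_trunc n F)"
  by (rule is_species_restrict) (auto simp: bij_betw_same_card)

lemma iso_trunc_cong: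
  fixes F :: "('a, 's) species" and G :: "('a, 't) species"
  assumes "F \<cong> G" shows "species_trunc n F \<cong> species_trunc n G"
proof -
  from assms obtain \<eta> where n: "natural_iso F G \<eta>" unfolding isomorphic_def by blast
  have e: "bij_betw f {} {}" for f :: "'s \<Rightarrow> 't" by (simp add: bij_betw_def)
  show ?thesis
    by (rule isomorphicI[where \<eta> = \<eta>],
        rule natural_isoI[OF is_species_trunc[OF natural_iso_species1[OF n]]
          is_species_trunc[OF natural_iso_species2[OF n]]])
      (use natural_iso_bij[OF n] natural_iso_natural[OF n] e
       in \<open>auto simp: species_restrict_def bij_betw_same_card split: if_splits\<close>)
qed

lemma trunc_sum: "species_trunc n (F \<oplus> G) = species_trunc n F \<oplus> species_trunc n G"
  by (auto simp: species_restrict_def species_sum_def fun_eq_iff)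

lemma trunc_trunc: "species_trunc m (species_trunc n F) = species_trunc (min m n) F"
  by (auto simp: species_restrict_def fun_eq_iff)

lift_definition spe_trunc :: "nat \<Rightarrow> 'a spe \<Rightarrow> 'a spe" is species_trunc
  by (rule iso_trunc_cong)

lemma spe_trunc_of:
  assumes "is_species F" shows "spe_trunc n (spe_of F) = spe_of (species_trunc n F)"
proof -
  have "spe_trunc n (spe_of F) = abs_spe (species_trunc n (species_code F))"
    unfolding spe_of_def by (rule spe_trunc.abs_eq) (use assms isomorphic_refl is_species_code in blast)
  also have "\<dots> = spe_of (species_trunc n F)"
    unfolding spe_of_def
    by (rule Quotient3_rel_abs[OF Quotient3_spe], rule isomorphic_trans)
      (rule iso_trunc_cong[OF isomorphic_sym[OF iso_code[OF assms]]],
        rule iso_code[OF is_species_trunc[OF assms]])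
  finally show ?thesis .
qed

lemma spe_trunc_add: "spe_trunc n (x + y) = spe_trunc n x + spe_trunc n y"
proof -
  obtain F G :: "('a, nat) species" where s: "is_species F" "is_species G"
    and x: "x = spe_of F" "y = spe_of G" using spe_exhaust by metis
  then show ?thesis
    by (simp add: x s is_species_sum is_species_trunc spe_trunc_of trunc_sum flip: spe_of_sum)
qed

lemma spe_trunc_trunc: "spe_trunc m (spe_trunc n x) = spe_trunc (min m n) x"
proof -
  obtain F :: "('a, nat) species" where "is_species F" "x = spe_of F" using spe_exhaust by metis
  then show ?thesis by (simp add: spe_trunc_of is_species_trunc trunc_trunc)
qed

lemma spe_eqI:
  assumes "\<And>n. spe_trunc n x = spe_trunc n y" shows "x = y"
proof -
  obtain F G :: "('a, nat) species" where s: "is_species F" "is_species G"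
    and x: "x = spe_of F" "y = spe_of G" using spe_exhaust by metis
  have "species_trunc n F \<cong> species_trunc n G" for n
    using assms[of n] by (simp add: x s spe_trunc_of is_species_trunc spe_of_eq_iff)
  then obtain \<eta> where n: "\<And>n. natural_iso (species_trunc n F) (species_trunc n G) (\<eta> n)"
    unfolding isomorphic_def by metis
  have "natural_iso F G (\<lambda>U. \<eta> (card U) U)"
  proof (rule natural_isoI[OF s])
    fix U :: "'a set" assume "finite U"
    from natural_iso_bij[OF n[of "card U"] this]
    show "bij_betw (\<eta> (card U) U) (structs F U) (structs G U)" by (simp add: species_restrict_def)
  next
    fix U V :: "'a set" and \<sigma> s assume a: "finite U" "bij_betw \<sigma> U V" "s \<in> structs F U"
    from natural_iso_natural[OF n[of "card U"] a(1,2)] a(3) bij_betw_same_card[OF a(2)]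
    show "\<eta> (card V) V (transport F U \<sigma> s) = transport G U \<sigma> (\<eta> (card U) U s)"
      by (simp add: species_restrict_def)
  qed
  then show ?thesis unfolding x using spe_of_eq_iff[OF s] isomorphicI by blast
qed

lift_definition virt_trunc :: "nat \<Rightarrow> 'a virt \<Rightarrow> 'a virt"
  is "\<lambda>n (F, G). (spe_trunc n F, spe_trunc n G)"
  by (auto simp: virt_eq_def simp flip: spe_trunc_add)

lemma virt_trunc_add: "virt_trunc n (x + y) = virt_trunc n x + virt_trunc n y"
  by transfer (auto simp: virt_eq_def spe_trunc_add ac_simps)

lemma virt_trunc_trunc: "virt_trunc m (virt_trunc n x) = virt_trunc (min m n) x"
  by transfer (auto simp: virt_eq_def spe_trunc_trunc ac_simps)

lemma virt_eqI:
  assumes "\<And>n. virt_trunc n x = virt_trunc n y" shows "x = y"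
  using assms by transfer (auto simp: virt_eq_def simp flip: spe_trunc_add intro: spe_eqI)

instantiation virt :: (type) t2_space
begin

definition open_virt :: "'a virt set \<Rightarrow> bool" where
  "open_virt S \<longleftrightarrow> (\<forall>x\<in>S. \<exists>n. \<forall>y. virt_trunc n y = virt_trunc n x \<longrightarrow> y \<in> S)"

instance
proof
  show "open (UNIV :: 'a virt set)" by (simp add: open_virt_def)
  show "open (S \<inter> T)" if ST: "open S" "open T" for S T :: "'a virt set"
    unfolding open_virt_def
  proof
    fix x assume "x \<in> S \<inter> T"
    then obtain m n where mn: "\<And>y. virt_trunc m y = virt_trunc m x \<Longrightarrow> y \<in> S"
      "\<And>y. virt_trunc n y = virt_trunc n x \<Longrightarrow> y \<in> T"
      using ST unfolding open_virt_def by blast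
    have "y \<in> S \<inter> T" if y: "virt_trunc (max m n) y = virt_trunc (max m n) x" for y
      using mn arg_cong[OF y, of "virt_trunc m"] arg_cong[OF y, of "virt_trunc n"]
      by (simp add: virt_trunc_trunc)
    then show "\<exists>n. \<forall>y. virt_trunc n y = virt_trunc n x \<longrightarrow> y \<in> S \<inter> T" by blast
  qed
  show "open (\<Union>K)" if "\<forall>S\<in>K. open S" for K :: "'a virt set set"
    using that unfolding open_virt_def by (meson Union_iff)
  show "\<exists>S T. open S \<and> open T \<and> x \<in> S \<and> y \<in> T \<and> S \<inter> T = {}" if xy: "x \<noteq> y" for x y :: "'a virt"
  proof -
    obtain n where n: "virt_trunc n x \<noteq> virt_trunc n y" using xy virt_eqI by blast
    have o: "open {z. virt_trunc n z = c}" for c :: "'a virt" unfolding open_virt_def by fastforce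
    show ?thesis
      by (intro exI[of _ "{z. virt_trunc n z = virt_trunc n x}"]
          exI[of _ "{z. virt_trunc n z = virt_trunc n y}"]) (use n o in auto)
  qed
qed

end

lemma tendsto_virt_iff:
  fixes X :: "nat \<Rightarrow> 'a virt"
  shows "X \<longlonglongrightarrow> L \<longleftrightarrow> (\<forall>n. eventually (\<lambda>k. virt_trunc n (X k) = virt_trunc n L) sequentially)"
proof
  assume X: "X \<longlonglongrightarrow> L"
  have "open {z. virt_trunc n z = virt_trunc n L}" for n
    unfolding open_virt_def by (auto intro!: exI[of _ n])
  from topological_tendstoD[OF X this]
  show "\<forall>n. eventually (\<lambda>k. virt_trunc n (X k) = virt_trunc n L) sequentially" by simp
next
  assume "\<forall>n. eventually (\<lambda>k. virt_trunc n (X k) = virt_trunc n L) sequentially"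
  then show "X \<longlonglongrightarrow> L"
    unfolding tendsto_def open_virt_def by (meson eventually_mono)
qed

definition virt_E_inv :: "'a virt" where
  "virt_E_inv = (\<Sum>k. (-1) ^ k * virt_of species_E_plus ^ k)"


section \<open>Interval orders and ballot matrices\<close>

definition interval_order_on :: "'a set \<Rightarrow> ('a \<times> 'a) set \<Rightarrow> bool" where
  "interval_order_on U R \<longleftrightarrow> R \<subseteq> U \<times> U \<and> irrefl R \<and> trans R \<and>
     \<not> (\<exists>a\<in>U. \<exists>b\<in>U. \<exists>c\<in>U. \<exists>d\<in>U. distinct [a, b, c, d] \<and>
          R \<inter> ({a, b, c, d} \<times> {a, b, c, d}) = {(a, b), (c, d)})"

definition species_I :: "('a, ('a \<times> 'a) set) species" where
  "species_I = Species (\<lambda>U. {R. interval_order_on U R}) (\<lambda>U \<sigma> R. map_prod \<sigma> \<sigma> ` R)"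

type_synonym 'a ballot = "'a set list"

definition is_ballot :: "'a ballot \<Rightarrow> bool" where
  "is_ballot b \<longleftrightarrow> {} \<notin> set b \<and>
     (\<forall>p < length b. \<forall>q < length b. p \<noteq> q \<longrightarrow> b ! p \<inter> b ! q = {})"

text \<open>
  A matrix is a pair of its dimension \<open>m\<close> and its entries at the positions \<open>(i, j)\<close>,
  \<open>1 \<le> i \<le> j \<le> m\<close>; at all other positions the entry function is the empty ballot.
\<close>

type_synonym 'a bmat = "nat \<times> (nat \<Rightarrow> nat \<Rightarrow> 'a ballot)"

definition is_ballot_matrix :: "'a set \<Rightarrow> 'a bmat \<Rightarrow> bool" where
  "is_ballot_matrix U = (\<lambda>(m, A).
     (\<forall>i j. \<not> (1 \<le> i \<and> i \<le> j \<and> j \<le> m) \<longrightarrow> A i j = []) \<and>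
     (\<forall>i j. is_ballot (A i j)) \<and>
     (\<forall>i j k l. (i, j) \<noteq> (k, l) \<longrightarrow> \<Union>(set (A i j)) \<inter> \<Union>(set (A k l)) = {}) \<and>
     (\<Union>i. \<Union>j. \<Union>(set (A i j))) = U \<and>
     (\<forall>i\<in>{1..m}. \<exists>j. \<Union>(set (A i j)) \<noteq> {}))"

definition row_blocks :: "'a bmat \<Rightarrow> nat \<Rightarrow> nat" where
  "row_blocks = (\<lambda>(m, A) i. \<Sum>j=1..m. length (A i j))"

definition num_blocks :: "'a bmat \<Rightarrow> nat" where
  "num_blocks M = (\<Sum>i=1..fst M. row_blocks M i)"

definition positive_bmat :: "'a bmat \<Rightarrow> bool" where
  "positive_bmat M \<longleftrightarrow> even (num_blocks M + fst M)"

definition bmat_transport :: "('a \<Rightarrow> 'a) \<Rightarrow> 'a bmat \<Rightarrow> 'a bmat" where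
  "bmat_transport \<sigma> = (\<lambda>(m, A). (m, \<lambda>i j. map ((`) \<sigma>) (A i j)))"

definition species_B_plus :: "('a, 'a bmat) species" where
  "species_B_plus =
     Species (\<lambda>U. {M. is_ballot_matrix U M \<and> positive_bmat M}) (\<lambda>U. bmat_transport)"

definition species_B_minus :: "('a, 'a bmat) species" where
  "species_B_minus =
     Species (\<lambda>U. {M. is_ballot_matrix U M \<and> \<not> positive_bmat M}) (\<lambda>U. bmat_transport)"

definition row_of :: "'a bmat \<Rightarrow> 'a \<Rightarrow> nat" where
  "row_of = (\<lambda>(m, A) x. THE i. \<exists>j. x \<in> \<Union>(set (A i j)))"

definition col_of :: "'a bmat \<Rightarrow> 'a \<Rightarrow> nat" where
  "col_of = (\<lambda>(m, A) x. THE j. \<exists>i. x \<in> \<Union>(set (A i j)))"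

definition bmat_order :: "'a set \<Rightarrow> 'a bmat \<Rightarrow> ('a \<times> 'a) set" where
  "bmat_order U M = {(x, y). x \<in> U \<and> y \<in> U \<and> col_of M x < row_of M y}"


subsection \<open>The moves\<close>

definition first_col :: "'a bmat \<Rightarrow> nat \<Rightarrow> nat" where
  "first_col = (\<lambda>(m, A) i. LEAST j. A i j \<noteq> [])"

definition empty_cols :: "'a bmat \<Rightarrow> nat set" where
  "empty_cols = (\<lambda>(m, A). {j \<in> {1..m}. \<forall>i. A i j = []})"

definition splittable :: "'a bmat \<Rightarrow> nat \<Rightarrow> bool" where
  "splittable M i \<longleftrightarrow> i \<in> {1..fst M} \<and> row_blocks M i \<ge> 2"

text \<open>The condition \<open>i < m\<close> is automatic for ballot matrices, whose last column is nonempty.\<close>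

definition mergeable :: "'a bmat \<Rightarrow> nat \<Rightarrow> bool" where
  "mergeable M i \<longleftrightarrow> i \<in> {1..<fst M} \<and> row_blocks M i = 1 \<and> i \<in> empty_cols M \<and>
     first_col M i \<le> first_col M (i + 1)"

definition set_entry ::
  "nat \<Rightarrow> nat \<Rightarrow> 'a ballot \<Rightarrow> (nat \<Rightarrow> nat \<Rightarrow> 'a ballot) \<Rightarrow> nat \<Rightarrow> nat \<Rightarrow> 'a ballot" where
  "set_entry i j b A = (\<lambda>k l. if k = i \<and> l = j then b else A k l)"

definition insert_row_col ::
  "nat \<Rightarrow> (nat \<Rightarrow> nat \<Rightarrow> 'a ballot) \<Rightarrow> nat \<Rightarrow> nat \<Rightarrow> 'a ballot" where
  "insert_row_col i A = (\<lambda>k l. if k = i \<or> l = i then []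
     else A (if k < i then k else k - 1) (if l < i then l else l - 1))"

definition delete_row_col ::
  "nat \<Rightarrow> (nat \<Rightarrow> nat \<Rightarrow> 'a ballot) \<Rightarrow> nat \<Rightarrow> nat \<Rightarrow> 'a ballot" where
  "delete_row_col i A = (\<lambda>k l. A (if k < i then k else k + 1) (if l < i then l else l + 1))"

definition split_row :: "nat \<Rightarrow> 'a bmat \<Rightarrow> 'a bmat" where
  "split_row i M = (case M of (m, A) \<Rightarrow>
     let j = first_col M i; B = hd (A i j) in
       (m + 1, set_entry i (j + 1) [B] (insert_row_col i (set_entry i j (tl (A i j)) A))))"

definition merge_row :: "nat \<Rightarrow> 'a bmat \<Rightarrow> 'a bmat" where
  "merge_row i M = (case M of (m, A) \<Rightarrow>
     let j = first_col M i; B = hd (A i j) in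
       (m - 1, delete_row_col i (set_entry (i + 1) j (B # A (i + 1) j) A)))"

definition theta :: "'a bmat \<Rightarrow> 'a bmat" where
  "theta M = (if \<exists>i. splittable M i \<or> mergeable M i
     then let i = (LEAST i. splittable M i \<or> mergeable M i) in
       if splittable M i then split_row i M else merge_row i M
     else M)"

definition species_B_plus_nonfixed :: "('a, 'a bmat) species" where
  "species_B_plus_nonfixed = Species
     (\<lambda>U. {M. is_ballot_matrix U M \<and> positive_bmat M \<and> theta M \<noteq> M}) (\<lambda>U. bmat_transport)"

definition species_Fix_theta :: "('a, 'a bmat) species" where
  "species_Fix_theta = Species
     (\<lambda>U. {M. is_ballot_matrix U M \<and> theta M = M}) (\<lambda>U. bmat_transport)"

end

theory Submission
  imports Defs
begin

text \<open>
  Ballot matrices, with the sign \<open>(-1) ^ (k + m)\<close> for \<open>k\<close> blocks and dimension \<open>m\<close>, are counted in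
  two ways.

  Counting by dimension: a matrix of dimension \<open>m\<close> is a family of \<open>m\<close> rows on disjoint sets, and
  row \<open>i\<close> is a family of \<open>m + 1 - i\<close> ballots that are not all empty. Signed counts turn families into
  products (\<open>signed_family\<close>). A ballot with \<open>k\<close> blocks is a structure of the \<open>k\<close>-th power of
  \<open>E\<^sub>+\<close>, so the signed count of ballots is the inverse of \<open>E\<close> (\<open>signed_Bal\<close>). A row with \<open>i\<close> entries
  contributes \<open>virt_E_inv ^ i - 1\<close>, and dimension \<open>m\<close> contributes the product over \<open>i = 1..m\<close>
  with the sign \<open>(-1) ^ m\<close> (\<open>signed_B_sums\<close>).

  Cancellation: a split takes the first block out of a row and puts it alone into a new row just above
  it; a merge undoes this. Neither changes the set of blocks, but the dimension changes by one, so the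
  sign is reversed. A move at row \<open>i\<close> does not influence which moves the earlier rows admit, since it
  only shifts the columns from \<open>i\<close> on, preserving their order. Hence the least row admitting a move
  is the same before and after, the two moves there are inverse to each other, and \<open>theta\<close> is an
  involution (\<open>theta_nonfixed\<close>). A fixed matrix has one block in each row and so is positive.

  What survives is the set of fixed matrices, and these are the interval orders. In an interval order
  the down-sets form a chain under inclusion, and so do the up-sets. In a fixed matrix, the blocks are
  the classes of elements with equal down-set and equal up-set, and the rows list them by
  increasing down-set and, for equal down-sets, by increasing up-set: rows \<open>i\<close> and \<open>i + 1\<close> have
  the same down-set exactly if column \<open>i\<close> is empty, and then, as no merge is possible, row \<open>i + 1\<close>
  reaches less far to the right (\<open>fixed_key_less\<close>). So the matrix can be read off from the order
  (\<open>order_matrix_bmat_order\<close>), and reading it off from an arbitrary interval order gives a fixed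
  matrix with that order (\<open>bmat_order_order_matrix\<close>, \<open>order_matrix_fixed\<close>).
\<close>


section \<open>Subspecies and signed counting\<close>

definition species_sub :: "('s \<Rightarrow> bool) \<Rightarrow> ('a, 's) species \<Rightarrow> ('a, 's) species" where
  "species_sub P F = Species (\<lambda>U. {s \<in> structs F U. P s}) (transport F)"

text \<open>
  Used for predicates and for numerical weights alike.
\<close>

definition invariant :: "('a, 's) species \<Rightarrow> ('s \<Rightarrow> 'b) \<Rightarrow> bool" where
  "invariant F w \<longleftrightarrow> (\<forall>U V \<sigma>. finite U \<longrightarrow> bij_betw \<sigma> U V \<longrightarrow>
     (\<forall>s\<in>structs F U. w (transport F U \<sigma> s) = w s))"

text \<open>
  The count of the \<open>F\<close>-structures in which \<open>s\<close> has the sign \<open>(-1) ^ w s\<close>. All computations with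
  virtual species below are done with such signed counts: they are additive, multiplicative and
  preserved by isomorphisms that respect \<open>w\<close>.
\<close>

definition signed :: "('a, 's) species \<Rightarrow> ('s \<Rightarrow> nat) \<Rightarrow> 'a virt" where
  "signed F w = virt_of (species_sub (\<lambda>s. even (w s)) F) - virt_of (species_sub (\<lambda>s. odd (w s)) F)"

lemma structs_sub [simp]: "structs (species_sub P F) U = {s \<in> structs F U. P s}"
  and transport_sub [simp]: "transport (species_sub P F) = transport F"
  by (simp_all add: species_sub_def)

lemma sub_sub: "species_sub P (species_sub Q F) = species_sub (\<lambda>s. Q s \<and> P s) F"
  by (simp add: species_sub_def)

lemma sub_cong:
  assumes "\<And>U s. s \<in> structs F U \<Longrightarrow> P s = Q s"
  shows "species_sub P F = species_sub Q F"
  using assms by (auto simp: species_sub_def fun_eq_iff)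

lemma invariantD:
  "invariant F w \<Longrightarrow> finite U \<Longrightarrow> bij_betw \<sigma> U V \<Longrightarrow> s \<in> structs F U \<Longrightarrow> w (transport F U \<sigma> s) = w s"
  by (simp add: invariant_def)

lemma invariantI:
  "(\<And>U V \<sigma> s. finite U \<Longrightarrow> bij_betw \<sigma> U V \<Longrightarrow> s \<in> structs F U \<Longrightarrow> w (transport F U \<sigma> s) = w s) \<Longrightarrow>
   invariant F w"
  by (simp add: invariant_def)

lemma invariant_comp: "invariant F w \<Longrightarrow> invariant F (\<lambda>s. h (w s))"
  by (simp add: invariant_def)

lemma invariant_comp2: "invariant F v \<Longrightarrow> invariant F w \<Longrightarrow> invariant F (\<lambda>s. h (v s) (w s))"
  by (simp add: invariant_def)

lemma invariant_sub: "invariant F w \<Longrightarrow> invariant (species_sub P F) w"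
  by (auto simp: invariant_def)

lemma is_species_sub:
  assumes F: "is_species F" and P: "invariant F P"
  shows "is_species (species_sub P F)"
proof (rule is_speciesI)
  show "transport (species_sub P F) U \<sigma> s = transport (species_sub P F) U \<sigma>' s"
    if "finite U" "bij_betw \<sigma> U V" "\<And>x. x \<in> U \<Longrightarrow> \<sigma> x = \<sigma>' x" "s \<in> structs (species_sub P F) U"
    for U V \<sigma> \<sigma>' s
    using species_cong[OF F that(1-3)] that(4) by simp
qed (use species_finite[OF F] species_transport[OF F] species_id[OF F] species_comp[OF F]
      invariantD[OF P] in auto)

text \<open>
  The values of a species at infinite sets are meaningless, and isomorphism ignores them.
\<close>

lemma isomorphic_if_same_on_finite:
  assumes F: "is_species F" and s: "\<And>U. finite U \<Longrightarrow> structs F U = structs G U"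
    and t: "\<And>U \<sigma> s. transport F U \<sigma> s = transport G U \<sigma> s"
  shows "F \<cong> G"
proof -
  have b: "bij_betw (\<lambda>s. s) (structs F U) (structs G U)" if "finite U" for U
    using s[OF that] by (simp add: bij_betw_def)
  have G: "is_species G" by (rule is_species_transfer[OF F b]) (simp_all add: t)
  have "natural_iso F G (\<lambda>U s. s)" by (rule natural_isoI[OF F G b]) (simp_all add: t)
  then show ?thesis by (rule isomorphicI)
qed

lemma virt_of_sub_split:
  assumes F: "is_species F" and P: "invariant F P"
  shows "virt_of F = virt_of (species_sub P F) + virt_of (species_sub (\<lambda>s. \<not> P s) F)"
proof -
  let ?A = "species_sub P F" and ?B = "species_sub (\<lambda>s. \<not> P s) F"
  have s: "is_species ?A" "is_species ?B"
    using is_species_sub[OF F P] is_species_sub[OF F invariant_comp[OF P, of Not]] by simp_all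
  have "natural_iso F (?A \<oplus> ?B) (\<lambda>U s. if P s then Inl s else Inr s)"
  proof (rule natural_isoI[OF F is_species_sum[OF s]])
    fix U :: "'a set"
    show "bij_betw (\<lambda>s. if P s then Inl s else Inr s) (structs F U) (structs (?A \<oplus> ?B) U)"
      by (rule bij_betw_byWitness[where f' = "case_sum (\<lambda>s. s) (\<lambda>s. s)"])
        (auto simp: species_sum_def split: if_splits)
  qed (use invariantD[OF P] in \<open>auto simp: species_sum_def\<close>)
  then have "F \<cong> ?A \<oplus> ?B" by (rule isomorphicI)
  then show ?thesis
    using virt_of_eq_iff[OF F is_species_sum[OF s]] virt_of_sum[OF s] by simp
qed

lemma virt_of_empty:
  assumes F: "is_species F" and e: "\<And>U. finite U \<Longrightarrow> structs F U = {}"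
  shows "virt_of F = 0"
proof -
  have i: "invariant F (\<lambda>s. True)" by (rule invariantI) simp
  have 1: "species_sub (\<lambda>s. True) F = F" by (cases F) (simp add: species_sub_def)
  have E: "species_sub (\<lambda>s. \<not> True) F \<cong> F"
    by (rule isomorphic_if_same_on_finite[OF is_species_sub[OF F invariant_comp[OF i, of Not]]])
      (use e in auto)
  then have "virt_of (species_sub (\<lambda>s. \<not> True) F) = virt_of F"
    using virt_of_eq_iff[OF isomorphic_species[OF E]] by simp
  with virt_of_sub_split[OF F i] show ?thesis unfolding 1 by simp
qed

lemma virt_of_one: "virt_of species_one = 1"
  by (simp add: virt_of_def one_virt_def spe_of_one)

lemma signed_cong:
  assumes "\<And>U s. s \<in> structs F U \<Longrightarrow> w s = v s"
  shows "signed F w = signed F v"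
  unfolding signed_def using assms by (auto cong: sub_cong)

lemma signed_even:
  assumes F: "is_species F" and w: "\<And>U s. s \<in> structs F U \<Longrightarrow> even (w s)"
  shows "signed F w = virt_of F"
proof -
  have 1: "species_sub (\<lambda>s. even (w s)) F = F" using w by (cases F) (auto simp: species_sub_def)
  have 2: "species_sub (\<lambda>s. odd (w s)) F = species_sub (\<lambda>s. False) F"
    by (rule sub_cong) (use w in auto)
  have "virt_of (species_sub (\<lambda>s. False) F) = 0"
    by (rule virt_of_empty[OF is_species_sub[OF F invariantI]]) auto
  then show ?thesis by (simp add: signed_def 1 2)
qed

lemma signed_shift: "signed F (\<lambda>s. w s + c) = (-1) ^ c * signed F w"
proof (cases "even c")
  case False
  then have "(-1 :: 'a virt) ^ c = -1" by simp
  with False show ?thesis by (simp add: signed_def)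
qed (simp add: signed_def)

lemma natural_iso_sub:
  fixes F :: "('a, 's) species" and G :: "('a, 't) species"
  assumes n: "natural_iso F G \<eta>" and Q: "invariant G Q"
    and PQ: "\<And>U s. finite U \<Longrightarrow> s \<in> structs F U \<Longrightarrow> Q (\<eta> U s) = P s"
  shows "natural_iso (species_sub P F) (species_sub Q G) \<eta>"
proof -
  have m: "\<eta> U s \<in> structs G U" if "finite U" "s \<in> structs F U" for U s
    using natural_iso_bij[OF n that(1)] that(2) by (auto simp: bij_betw_def)
  have P: "invariant F P"
  proof (rule invariantI)
    fix U V :: "'a set" and \<sigma> s assume a: "finite U" "bij_betw \<sigma> U V" "s \<in> structs F U"
    have V: "finite V" using a bij_betw_finite by blast
    show "P (transport F U \<sigma> s) = P s"
      using PQ[OF V species_transport[OF natural_iso_species1[OF n] a]] PQ[OF a(1,3)]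
        natural_iso_natural[OF n a] invariantD[OF Q a(1,2) m[OF a(1,3)]] by simp
  qed
  show ?thesis
  proof (rule natural_isoI[OF is_species_sub[OF natural_iso_species1[OF n] P]
        is_species_sub[OF natural_iso_species2[OF n] Q]])
    fix U :: "'a set" assume U: "finite U"
    have "\<eta> U ` {s \<in> structs F U. P s} = {s \<in> structs G U. Q s}"
      using PQ[OF U] unfolding bij_betw_imp_surj_on[OF natural_iso_bij[OF n U], symmetric] by auto
    moreover have "inj_on (\<eta> U) {s \<in> structs F U. P s}"
      using natural_iso_bij[OF n U] unfolding bij_betw_def by (auto intro: inj_on_subset)
    ultimately show "bij_betw (\<eta> U) (structs (species_sub P F) U) (structs (species_sub Q G) U)"
      by (simp add: bij_betw_def)
  qed (use natural_iso_natural[OF n] in auto)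
qed

lemma signed_iso:
  assumes n: "natural_iso F G \<eta>" and v: "invariant G v"
    and vw: "\<And>U s. finite U \<Longrightarrow> s \<in> structs F U \<Longrightarrow> v (\<eta> U s) = w s"
  shows "signed F w = signed G v"
proof -
  have "virt_of (species_sub (\<lambda>s. h (w s)) F) = virt_of (species_sub (\<lambda>s. h (v s)) G)" for h
  proof -
    have i: "species_sub (\<lambda>s. h (w s)) F \<cong> species_sub (\<lambda>s. h (v s)) G"
      by (rule isomorphicI[OF natural_iso_sub[OF n invariant_comp[OF v]]]) (simp add: vw)
    then show ?thesis using virt_of_eq_iff[OF isomorphic_species[OF i]] by simp
  qed
  then show ?thesis unfolding signed_def by simp
qed

lemma signed_split:
  assumes F: "is_species F" and w: "invariant F w" and P: "invariant F P"
  shows "signed F w = signed (species_sub P F) w + signed (species_sub (\<lambda>s. \<not> P s) F) w"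
proof -
  have "virt_of (species_sub (\<lambda>s. h (w s)) F) =
      virt_of (species_sub (\<lambda>s. h (w s)) (species_sub P F)) +
      virt_of (species_sub (\<lambda>s. h (w s)) (species_sub (\<lambda>s. \<not> P s) F))" for h
    using virt_of_sub_split[OF is_species_sub[OF F invariant_comp[OF w, of h]] invariant_sub[OF P]]
    by (simp add: sub_sub conj_commute)
  from this[of even] this[of odd] show ?thesis unfolding signed_def by simp
qed

lemma sub_prod:
  "species_sub (\<lambda>(p, s, t). P s \<and> Q t) (F \<otimes> G) = species_sub P F \<otimes> species_sub Q G"
  by (auto simp: species_sub_def species_prod_def fun_eq_iff)

lemma invariant_prod:
  fixes F :: "('a, 's) species" and G :: "('a, 't) species"
  assumes v: "invariant F v" and w: "invariant G w"
  shows "invariant (F \<otimes> G) (\<lambda>(p, s, t). h (v s) (w t))"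
proof (rule invariantI)
  fix U V :: "'a set" and \<sigma> x assume a: "finite U" "bij_betw \<sigma> U V" "x \<in> structs (F \<otimes> G) U"
  from a(3) obtain U1 U2 s t where x: "x = ((U1, U2), (s, t))" "U1 \<union> U2 = U" "U1 \<inter> U2 = {}"
    "s \<in> structs F U1" "t \<in> structs G U2" unfolding structs_prod by blast
  have f: "finite U1" "finite U2" using a(1) x(2) by auto
  note b = bij_betw_Un_parts[OF a(2)[folded x(2)] x(3)]
  show "(\<lambda>(p, s, t). h (v s) (w t)) (transport (F \<otimes> G) U \<sigma> x) = (\<lambda>(p, s, t). h (v s) (w t)) x"
    using invariantD[OF v f(1) b(1) x(4)] invariantD[OF w f(2) b(2) x(5)]
    by (simp add: x(1) transport_prod)
qed

text \<open>
  The sign of a pair is the product of the signs of its components: a pair is even iff both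
  components are even or both are odd, which is the product rule for formal differences.
\<close>

lemma signed_prod:
  assumes F: "is_species F" and G: "is_species G" and v: "invariant F v" and w: "invariant G w"
  shows "signed (F \<otimes> G) (\<lambda>(p, s, t). v s + w t) = signed F v * signed G w"
proof -
  let ?F = "\<lambda>h. species_sub (\<lambda>s. h (v s)) F" and ?G = "\<lambda>h. species_sub (\<lambda>s. h (w s)) G"
  have s: "is_species (?F h)" "is_species (?G h)" for h :: "nat \<Rightarrow> bool"
    using is_species_sub[OF F invariant_comp[OF v]] is_species_sub[OF G invariant_comp[OF w]] by auto
  have p: "virt_of (species_sub (\<lambda>(p, s, t). h (v s + w t)) (F \<otimes> G))
      = virt_of (?F even) * virt_of (?G h) + virt_of (?F odd) * virt_of (?G (\<lambda>n. \<not> h n))"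
    if h: "h = even \<or> h = odd" for h
  proof -
    let ?S = "species_sub (\<lambda>(p, s, t). h (v s + w t)) (F \<otimes> G)"
    have S: "is_species ?S"
      by (rule is_species_sub[OF is_species_prod[OF F G] invariant_prod[OF v w]])
    have i: "invariant ?S (\<lambda>(p, s, t). even (v s))"
      by (rule invariant_sub, rule invariant_prod[OF v w])
    have 1: "species_sub (\<lambda>(p, s, t). even (v s)) ?S = ?F even \<otimes> ?G h"
      unfolding sub_sub sub_prod[symmetric] by (rule sub_cong) (use h in auto)
    have 2: "species_sub (\<lambda>x. \<not> (\<lambda>(p, s, t). even (v s)) x) ?S = ?F odd \<otimes> ?G (\<lambda>n. \<not> h n)"
      unfolding sub_sub sub_prod[symmetric] by (rule sub_cong) (use h in auto)
    show ?thesis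
      unfolding virt_of_sub_split[OF S i] 1 2
      by (simp add: virt_of_prod s(1)[of even] s(1)[of odd] s(2)[of h] s(2)[of "\<lambda>n. \<not> h n"])
  qed
  have q: "(\<lambda>x. h ((\<lambda>(p, s, t). v s + w t) x)) = (\<lambda>(p, s, t). h (v s + w t))" for h :: "nat \<Rightarrow> bool"
    by auto
  show ?thesis
    unfolding signed_def q[of even] q[of odd] p[of even, OF disjI1[OF refl]]
      p[of odd, OF disjI2[OF refl]]
    by (simp add: algebra_simps)
qed


section \<open>Graded species\<close>

lemma virt_trunc_diff: "virt_trunc n (x - y) = virt_trunc n x - virt_trunc n y"
  using virt_trunc_add[of n "x - y" y] by (simp add: eq_diff_eq)

lemma virt_trunc_of:
  fixes F :: "('a, 's) species"
  assumes "is_species F" shows "virt_trunc n (virt_of F) = virt_of (species_trunc n F)"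
proof -
  have "(species_trunc n species_zero :: ('a, unit) species) = species_zero"
    by (simp add: species_restrict_def species_zero_def fun_eq_iff)
  then have "spe_trunc n (0 :: 'a spe) = 0"
    using spe_trunc_of[OF is_species_zero[where 'a = 'a], of n] by (simp add: spe_of_zero)
  then show ?thesis by (simp add: virt_of_def virt_trunc.abs_eq spe_trunc_of[OF assms])
qed

lemma virt_trunc_signed:
  assumes F: "is_species F" and w: "invariant F w"
  shows "virt_trunc n (signed F w) = signed (species_trunc n F) w"
proof -
  have "species_trunc n (species_sub P F) = species_sub P (species_trunc n F)" for P
    by (auto simp: species_restrict_def species_sub_def fun_eq_iff)
  then show ?thesis
    using is_species_sub[OF F invariant_comp[OF w, of even]]
      is_species_sub[OF F invariant_comp[OF w, of odd]]
    by (simp add: signed_def virt_trunc_diff virt_trunc_of)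
qed

text \<open>
  A bounded grade may take infinitely many values on all finite sets together, but only finitely many
  on each of them; so finiteness of the structure sets is inherited from the graded pieces.
\<close>

lemma is_species_graded:
  fixes F :: "('a, 's) species" and g :: "'s \<Rightarrow> nat"
  assumes F: "\<And>k. is_species (species_sub (\<lambda>s. g s = k) F)"
    and g: "\<And>U s. finite U \<Longrightarrow> s \<in> structs F U \<Longrightarrow> g s \<le> card U"
  shows "is_species F" and "invariant F g"
proof -
  let ?F = "\<lambda>s. species_sub (\<lambda>s'. g s' = g s) F"
  have m: "s \<in> structs (?F s) U" if "s \<in> structs F U" for s U using that by simp
  note s = species_transport[OF F _ _ m] and i = species_id[OF F _ m] and
    c = species_comp[OF F _ _ _ m]
  show "is_species F"
  proof (rule is_speciesI)
    fix U :: "'a set" assume U: "finite U"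
    have "structs F U \<subseteq> (\<Union>k\<le>card U. structs (species_sub (\<lambda>s. g s = k) F) U)"
      using g[OF U] by auto
    moreover have "finite \<dots>" using species_finite[OF F U] by blast
    ultimately show "finite (structs F U)" by (rule finite_subset)
  next
    fix U V :: "'a set" and \<sigma> \<sigma>' s
    assume a: "finite U" "bij_betw \<sigma> U V" "\<And>x. x \<in> U \<Longrightarrow> \<sigma> x = \<sigma>' x" "s \<in> structs F U"
    show "transport F U \<sigma> s = transport F U \<sigma>' s"
      using species_cong[OF F a(1-3) m[OF a(4)]] by simp
  qed (use s i c in simp_all)
  show "invariant F g" by (rule invariantI) (use s in simp)
qed

text \<open>
  A grade bounded by the size of the underlying set gives a summable decomposition: the truncation at
  \<open>n\<close> only sees the grades up to \<open>n\<close>, so all partial sums with more than \<open>n\<close> terms agree there.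
\<close>

lemma signed_graded_sums:
  fixes F :: "('a, 's) species" and g :: "'s \<Rightarrow> nat"
  assumes F: "is_species F" and w: "invariant F w" and i: "invariant F g"
    and g: "\<And>U s. finite U \<Longrightarrow> s \<in> structs F U \<Longrightarrow> g s \<le> card U"
  shows "(\<lambda>k. signed (species_sub (\<lambda>s. g s = k) F) w) sums signed F w"
proof -
  let ?F = "\<lambda>k. species_sub (\<lambda>s. g s < k) F"
  have s: "is_species (?F k)" for k by (rule is_species_sub[OF F invariant_comp[OF i]])
  have part: "(\<Sum>j<k. signed (species_sub (\<lambda>s. g s = j) F) w) = signed (?F k) w" for k
  proof (induction k)
    case 0
    have "virt_of (species_sub P (?F 0)) = 0" for P
      by (rule virt_of_empty) (auto simp: sub_sub intro!: is_species_sub[OF F] invariantI)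
    then show ?case by (simp add: signed_def)
  next
    case (Suc k)
    have 1: "species_sub (\<lambda>s. g s < k) (?F (Suc k)) = ?F k"
      unfolding sub_sub by (rule sub_cong) auto
    have 2: "species_sub (\<lambda>s. \<not> g s < k) (?F (Suc k)) = species_sub (\<lambda>s. g s = k) F"
      unfolding sub_sub by (rule sub_cong) auto
    show ?case
      using signed_split[OF s[of "Suc k"] invariant_sub[OF w] invariant_sub[OF invariant_comp[OF i]],
          of "\<lambda>n. n < k"]
      unfolding 1 2 by (simp add: Suc add.commute)
  qed
  have tr: "virt_trunc n (signed (?F k) w) = virt_trunc n (signed F w)" if k: "k > n" for n k
  proof -
    have t: "is_species (species_trunc n (?F k))" "is_species (species_trunc n F)"
      by (rule is_species_trunc[OF s], rule is_species_trunc[OF F])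
    have wt: "invariant (species_trunc n F) w"
      using w by (auto simp: invariant_def species_restrict_def)
    have "natural_iso (species_trunc n (?F k)) (species_trunc n F) (\<lambda>U s. s)"
    proof (rule natural_isoI[OF t])
      fix U :: "'a set" assume U: "finite U"
      show "bij_betw (\<lambda>s. s) (structs (species_trunc n (?F k)) U) (structs (species_trunc n F) U)"
        using g[OF U] k by (force simp: species_restrict_def bij_betw_def)
    qed (auto simp: species_restrict_def)
    from signed_iso[OF this wt] show ?thesis
      by (simp add: virt_trunc_signed[OF F w] virt_trunc_signed[OF s invariant_sub[OF w]])
  qed
  show ?thesis
    unfolding sums_def part tendsto_virt_iff
  proof
    fix n
    show "\<forall>\<^sub>F k in sequentially. virt_trunc n (signed (?F k) w) = virt_trunc n (signed F w)"
      using eventually_gt_at_top[of n] by eventually_elim (rule tr)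
  qed
qed


section \<open>Families of structures on disjoint sets\<close>

text \<open>
  A species whose structures determine the set they live on: \<open>ok\<close> says what a structure is, and
  \<open>car\<close> is its underlying set. The type of \<open>ok\<close> does not mention this set, so that a structure of
  this kind can in turn be an entry of a larger structure.
\<close>

definition carried ::
  "('s \<Rightarrow> bool) \<Rightarrow> ('s \<Rightarrow> 'a set) \<Rightarrow> (('a \<Rightarrow> 'a) \<Rightarrow> 's \<Rightarrow> 's) \<Rightarrow> ('a, 's) species" where
  "carried ok car tr = Species (\<lambda>U. {s. ok s \<and> car s = U}) (\<lambda>U. tr)"

text \<open>
  Families of structures on pairwise disjoint sets. Outside of the index set the entry is a
  default \<open>d\<close> on the empty set, so that equal families are equal functions. Rows are families
  of ballots, and matrices are families of rows.
\<close>

definition family ::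
  "'i set \<Rightarrow> ('i \<Rightarrow> 's \<Rightarrow> bool) \<Rightarrow> ('s \<Rightarrow> 'a set) \<Rightarrow> 's \<Rightarrow> ('i \<Rightarrow> 's) \<Rightarrow> bool" where
  "family I ok car d t \<longleftrightarrow> (\<forall>i\<in>I. ok i (t i)) \<and> (\<forall>i. i \<notin> I \<longrightarrow> t i = d) \<and>
     (\<forall>i j. i \<noteq> j \<longrightarrow> car (t i) \<inter> car (t j) = {})"

lemma
  assumes "family I ok car d t"
  shows family_member: "i \<in> I \<Longrightarrow> ok i (t i)"
    and family_default: "i \<notin> I \<Longrightarrow> t i = d"
    and family_disjoint: "i \<noteq> j \<Longrightarrow> car (t i) \<inter> car (t j) = {}"
  using assms by (simp_all add: family_def)

lemma familyI:
  assumes "\<And>i. i \<in> I \<Longrightarrow> ok i (t i)" "\<And>i. i \<notin> I \<Longrightarrow> t i = d"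
    and "\<And>i j. i \<noteq> j \<Longrightarrow> car (t i) \<inter> car (t j) = {}"
  shows "family I ok car d t"
  using assms by (simp add: family_def)

abbreviation family_species ::
  "'i set \<Rightarrow> ('i \<Rightarrow> 's \<Rightarrow> bool) \<Rightarrow> ('s \<Rightarrow> 'a set) \<Rightarrow> 's \<Rightarrow> (('a \<Rightarrow> 'a) \<Rightarrow> 's \<Rightarrow> 's) \<Rightarrow>
     ('a, 'i \<Rightarrow> 's) species" where
  "family_species I ok car d tr \<equiv>
     carried (family I ok car d) (\<lambda>t. \<Union>i. car (t i)) (\<lambda>\<sigma> t i. tr \<sigma> (t i))"

lemma structs_carried [simp]: "structs (carried ok car tr) U = {s. ok s \<and> car s = U}"
  and transport_carried [simp]: "transport (carried ok car tr) U = tr"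
  by (simp_all add: carried_def)

lemma sub_carried: "species_sub P (carried ok car tr) = carried (\<lambda>s. ok s \<and> P s) car tr"
  by (auto simp: species_sub_def carried_def)

text \<open>
  A family over \<open>insert i I\<close> is its entry at \<open>i\<close> together with a family over \<open>I\<close> on the
  complementary set.
\<close>

lemma family_insert_bij:
  fixes ok :: "'i \<Rightarrow> 's \<Rightarrow> bool" and car :: "'s \<Rightarrow> 'a set"
  assumes i: "i \<notin> I" and d: "car d = {}"
  shows "bij_betw (\<lambda>(p, s, t). t(i := s))
    (structs (carried (ok i) car tr \<otimes> family_species I ok car d tr) U)
    (structs (family_species (insert i I) ok car d tr) U)"
proof (rule bij_betw_byWitness[where
      f' = "\<lambda>t. ((car (t i), \<Union>k\<in>-{i}. car (t k)), (t i, t(i := d)))"]; intro ballI image_subsetI)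
  fix x assume "x \<in> structs (carried (ok i) car tr \<otimes> family_species I ok car d tr) U"
  then obtain s t where x: "x = ((car s, \<Union>k. car (t k)), (s, t))" and U: "car s \<union> (\<Union>k. car (t k)) = U"
    and dis: "car s \<inter> (\<Union>k. car (t k)) = {}" and s: "ok i s" and t: "family I ok car d t"
    unfolding structs_prod by auto
  have ti: "t i = d" using t i by (simp add: family_def)
  then have car: "(\<Union>k\<in>-{i}. car (t k)) = (\<Union>k. car (t k))" using d by auto
  show "(\<lambda>t. ((car (t i), \<Union>k\<in>-{i}. car (t k)), (t i, t(i := d)))) ((\<lambda>(p, s, t). t(i := s)) x) = x"
    using car ti by (auto simp: x fun_eq_iff)
  have "(UNIV :: 'i set) = insert i (- {i})" by auto
  then have "(\<Union>k. car ((t(i := s)) k)) = car s \<union> (\<Union>k\<in>-{i}. car ((t(i := s)) k))"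
    by (metis (no_types, lifting) UN_insert fun_upd_same)
  also have "(\<Union>k\<in>-{i}. car ((t(i := s)) k)) = (\<Union>k\<in>-{i}. car (t k))" by auto
  finally have "(\<Union>k. car ((t(i := s)) k)) = U" using U car by simp
  moreover have "family (insert i I) ok car d (t(i := s))"
    unfolding family_def
  proof (intro conjI ballI allI impI)
    fix k l :: 'i assume "k \<noteq> l"
    moreover have "car (t k) \<inter> car (t l) = {}" if "k \<noteq> l" for k l
      using t that unfolding family_def by blast
    moreover have "car s \<inter> car (t k) = {}" for k using dis by blast
    ultimately show "car ((t(i := s)) k) \<inter> car ((t(i := s)) l) = {}" by (auto simp: Int_commute)
  qed (use s t in \<open>auto simp: family_def\<close>)
  ultimately show "(\<lambda>(p, s, t). t(i := s)) x \<in> structs (family_species (insert i I) ok car d tr) U"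
    by (simp add: x)
next
  fix t assume "t \<in> structs (family_species (insert i I) ok car d tr) U"
  then have t: "family (insert i I) ok car d t" and U: "(\<Union>k. car (t k)) = U" by auto
  show "(\<lambda>(p, s, t). t(i := s)) ((car (t i), \<Union>k\<in>-{i}. car (t k)), (t i, t(i := d))) = t"
    by simp
  have "family I ok car d (t(i := d))" using t i d by (auto simp: family_def)
  moreover have "car (t i) \<inter> (\<Union>k\<in>-{i}. car (t k)) = {}"
    using t unfolding family_def by blast
  moreover have "(\<Union>k. car ((t(i := d)) k)) = (\<Union>k\<in>-{i}. car (t k))"
    using d by (auto split: if_splits)
  moreover have "car (t i) \<union> (\<Union>k\<in>-{i}. car (t k)) = U" using U by auto
  ultimately show "((car (t i), \<Union>k\<in>-{i}. car (t k)), (t i, t(i := d)))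
      \<in> structs (carried (ok i) car tr \<otimes> family_species I ok car d tr) U"
    using t unfolding structs_prod by (auto simp: family_def)
qed

text \<open>
  By induction on the index set, peeling off one entry at a time. That the families form a species at
  all is obtained along the way, by transfer from the product in the induction step.
\<close>

lemma signed_family:
  fixes ok :: "'i \<Rightarrow> 's \<Rightarrow> bool" and car :: "'s \<Rightarrow> 'a set" and w :: "'i \<Rightarrow> 's \<Rightarrow> nat"
  assumes I: "finite I" and d: "car d = {}" "\<And>\<sigma>. tr \<sigma> d = d"
    and F: "\<And>i. i \<in> I \<Longrightarrow> is_species (carried (ok i) car tr)"
    and w: "\<And>i \<sigma> s. w i (tr \<sigma> s) = w i s"
  shows "is_species (family_species I ok car d tr)"
    and "signed (family_species I ok car d tr) (\<lambda>t. \<Sum>i\<in>I. w i (t i))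
      = (\<Prod>i\<in>I. signed (carried (ok i) car tr) (w i))"
proof -
  have "is_species (family_species I ok car d tr) \<and>
    signed (family_species I ok car d tr) (\<lambda>t. \<Sum>i\<in>I. w i (t i))
      = (\<Prod>i\<in>I. signed (carried (ok i) car tr) (w i))"
    using I F
  proof (induction I rule: finite_induct)
    case empty
    let ?E = "family_species {} ok car d tr"
    have E: "structs ?E U = (if U = {} then {\<lambda>i. d} else {})" for U
      using d(1) by (auto simp: family_def)
    have b: "bij_betw (\<lambda>u i. d) (structs species_one U) (structs ?E U)" for U
      unfolding E by (auto simp: species_one_def species_restrict_def species_E_def bij_betw_def)
    have n: "(\<lambda>i. d) = transport ?E U \<sigma> (\<lambda>i. d)" for U \<sigma> by (simp add: d)
    have S: "is_species ?E" by (rule is_species_transfer[OF is_species_one b n])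
    have i: "natural_iso species_one ?E (\<lambda>U u i. d)" by (rule natural_isoI[OF is_species_one S b n])
    have "virt_of ?E = 1"
      using virt_of_eq_iff[OF is_species_one S] isomorphicI[OF i] by (simp add: virt_of_one)
    then show ?case using S signed_even[OF S, of "\<lambda>t. 0"] by simp
  next
    case (insert i I)
    let ?F = "carried (ok i) car tr" and ?G = "family_species I ok car d tr"
    let ?H = "family_species (insert i I) ok car d tr"
    have F: "is_species ?F" and G: "is_species ?G" using insert by auto
    note b = family_insert_bij[where i = i and I = I and ok = ok and car = car and d = d and tr = tr,
        OF insert.hyps(2) d(1)]
    have n: "(\<lambda>(p, s, t). t(i := s)) (transport (?F \<otimes> ?G) U \<sigma> x)
        = transport ?H U \<sigma> ((\<lambda>(p, s, t). t(i := s)) x)" for U :: "'a set" and \<sigma> x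
      by (auto simp: species_prod_def fun_eq_iff split: prod.splits)
    have H: "is_species ?H" by (rule is_species_transfer[OF is_species_prod[OF F G] b n])
    have ni: "natural_iso (?F \<otimes> ?G) ?H (\<lambda>U (p, s, t). t(i := s))"
      by (rule natural_isoI[OF is_species_prod[OF F G] H b n])
    have inv: "invariant ?F (w i)" "invariant ?G (\<lambda>t. \<Sum>i\<in>I. w i (t i))"
      "invariant ?H (\<lambda>t. \<Sum>i\<in>insert i I. w i (t i))" by (simp_all add: invariant_def w)
    have "signed (?F \<otimes> ?G) (\<lambda>(p, s, t). w i s + (\<Sum>i\<in>I. w i (t i)))
        = signed ?H (\<lambda>t. \<Sum>i\<in>insert i I. w i (t i))"
      by (rule signed_iso[OF ni inv(3)])
        (use insert.hyps in \<open>auto intro!: sum.cong split: prod.splits\<close>)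
    then show ?case
      using H insert signed_prod[OF F G inv(1,2)] by simp
  qed
  then show "is_species (family_species I ok car d tr)"
    and "signed (family_species I ok car d tr) (\<lambda>t. \<Sum>i\<in>I. w i (t i))
      = (\<Prod>i\<in>I. signed (carried (ok i) car tr) (w i))" by auto
qed


section \<open>Ballots and the inverse of \<open>E\<close>\<close>

abbreviation ballot_car :: "'a ballot \<Rightarrow> 'a set" where
  "ballot_car b \<equiv> \<Union>(set b)"

abbreviation ballot_transport :: "('a \<Rightarrow> 'a) \<Rightarrow> 'a ballot \<Rightarrow> 'a ballot" where
  "ballot_transport \<sigma> \<equiv> map ((`) \<sigma>)"

abbreviation species_Bal :: "('a, 'a ballot) species" where
  "species_Bal \<equiv> carried is_ballot ballot_car ballot_transport"

lemma is_ballot_Nil [simp]: "is_ballot []"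
  by (simp add: is_ballot_def)

lemma is_ballot_Cons [simp]:
  "is_ballot (B # b) \<longleftrightarrow> B \<noteq> {} \<and> B \<inter> ballot_car b = {} \<and> is_ballot b"
proof -
  have "(\<forall>p<length (B # b). \<forall>q<length (B # b). p \<noteq> q \<longrightarrow> (B # b) ! p \<inter> (B # b) ! q = {}) \<longleftrightarrow>
      (\<forall>q<length b. B \<inter> b ! q = {}) \<and>
      (\<forall>p<length b. \<forall>q<length b. p \<noteq> q \<longrightarrow> b ! p \<inter> b ! q = {})"
    by (simp add: All_less_Suc2 Int_commute[of _ B]) blast
  moreover have "(\<forall>q<length b. B \<inter> b ! q = {}) \<longleftrightarrow> B \<inter> ballot_car b = {}"
    by (auto simp: in_set_conv_nth disjoint_iff) (metis in_set_conv_nth)+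
  ultimately show ?thesis by (auto simp: is_ballot_def)
qed

lemma ballot_car_eq_empty: "is_ballot b \<Longrightarrow> ballot_car b = {} \<longleftrightarrow> b = []"
  by (cases b) auto

lemma length_ballot_le: "is_ballot b \<Longrightarrow> finite (ballot_car b) \<Longrightarrow> length b \<le> card (ballot_car b)"
proof (induction b)
  case (Cons B b)
  then have "card (B \<union> ballot_car b) = card B + card (ballot_car b)"
    by (intro card_Un_disjoint) auto
  moreover have "card B > 0" using Cons.prems by (simp add: card_gt_0_iff)
  ultimately show ?case using Cons by simp
qed simp

text \<open>
  A nonempty ballot is its first block, an arbitrary nonempty set, followed by a ballot on the rest.
\<close>

lemma ballots_of_length:
  "is_species (species_sub (\<lambda>b. length b = k) (species_Bal :: ('a, 'a ballot) species)) \<and>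
   virt_of (species_sub (\<lambda>b. length b = k) (species_Bal :: ('a, 'a ballot) species))
     = virt_of species_E_plus ^ k"
proof (induction k)
  case 0
  let ?G = "species_sub (\<lambda>b. length b = 0) (species_Bal :: ('a, 'a ballot) species)"
  have b: "bij_betw (\<lambda>s. []) (structs species_one U) (structs ?G U)" for U
    by (auto simp: species_one_def species_restrict_def species_E_def bij_betw_def)
  have n: "[] = transport ?G U \<sigma> []" for U \<sigma> by simp
  have G: "is_species ?G" by (rule is_species_transfer[OF is_species_one b n])
  have i: "natural_iso species_one ?G (\<lambda>U s. [])" by (rule natural_isoI[OF is_species_one G b n])
  show ?case
    using G virt_of_eq_iff[OF is_species_one G] isomorphicI[OF i] by (simp add: virt_of_one)
next
  case (Suc k)
  let ?F = "species_E_plus \<otimes> species_sub (\<lambda>b. length b = k) (species_Bal :: ('a, 'a ballot) species)"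
  let ?G = "species_sub (\<lambda>b. length b = Suc k) (species_Bal :: ('a, 'a ballot) species)"
  let ?f = "\<lambda>((B, V), (u :: unit, b)). B # b"
  have F: "is_species ?F" using Suc is_species_prod[OF is_species_E_plus] by blast
  have b: "bij_betw ?f (structs ?F U) (structs ?G U)" for U
    by (rule bij_betw_byWitness[where f' = "\<lambda>b. ((hd b, ballot_car (tl b)), ((), tl b))"])
      (auto simp: species_E_plus_def species_restrict_def species_E_def species_prod_def
        length_Suc_conv split: if_splits)
  have n: "?f (transport ?F U \<sigma> s) = transport ?G U \<sigma> (?f s)" for U :: "'a set" and \<sigma> s
    by (auto simp: species_E_plus_def species_restrict_def species_E_def species_prod_def
        split: prod.splits)
  have G: "is_species ?G" by (rule is_species_transfer[OF F b n])
  have i: "natural_iso ?F ?G (\<lambda>U. ?f)" by (rule natural_isoI[OF F G b n])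
  have "virt_of ?G = virt_of ?F"
    using virt_of_eq_iff[OF F G] isomorphicI[OF i] by simp
  also have "\<dots> = virt_of species_E_plus ^ Suc k"
    by (simp add: virt_of_prod is_species_E_plus conjunct1[OF Suc] conjunct2[OF Suc])
  finally show ?case using G by simp
qed

text \<open>
  Grading the ballots by their number of blocks gives the series that defines \<open>virt_E_inv\<close>.
\<close>

lemma
  shows is_species_Bal: "is_species (species_Bal :: ('a, 'a ballot) species)"
    and signed_Bal: "signed (species_Bal :: ('a, 'a ballot) species) length = virt_E_inv"
proof -
  let ?B = "species_Bal :: ('a, 'a ballot) species"
  have le: "length b \<le> card U" if "finite U" "b \<in> structs ?B U" for U b
    using that length_ballot_le by auto
  note g = is_species_graded[OF conjunct1[OF ballots_of_length] le]
  show B: "is_species ?B" by (rule g)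
  have "signed (species_sub (\<lambda>b. length b = k) ?B) length = (-1) ^ k * virt_of species_E_plus ^ k" for k
  proof -
    have "signed (species_sub (\<lambda>b. length b = k) ?B) length
        = signed (species_sub (\<lambda>b. length b = k) ?B) (\<lambda>b. 0 + k)" by (rule signed_cong) simp
    also have "\<dots> = (-1) ^ k * virt_of species_E_plus ^ k"
      unfolding signed_shift
      by (simp add: signed_even[OF conjunct1[OF ballots_of_length]] ballots_of_length)
    finally show ?thesis .
  qed
  moreover have "(\<lambda>k. signed (species_sub (\<lambda>b. length b = k) ?B) length) sums signed ?B length"
    by (rule signed_graded_sums[OF B g(2) g(2) le])
  ultimately show "signed ?B length = virt_E_inv"
    unfolding virt_E_inv_def by (simp add: sums_unique)
qed


section \<open>The signed count of ballot matrices\<close>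

abbreviation row_car :: "(nat \<Rightarrow> 'a ballot) \<Rightarrow> 'a set" where
  "row_car t \<equiv> \<Union>j. ballot_car (t j)"

abbreviation ballot_row :: "nat set \<Rightarrow> (nat \<Rightarrow> 'a ballot) \<Rightarrow> bool" where
  "ballot_row J t \<equiv> family J (\<lambda>j. is_ballot) ballot_car [] t \<and> row_car t \<noteq> {}"

abbreviation species_row :: "nat set \<Rightarrow> ('a, nat \<Rightarrow> 'a ballot) species" where
  "species_row J \<equiv> carried (ballot_row J) row_car (\<lambda>\<sigma> t j. ballot_transport \<sigma> (t j))"

text \<open>
  The \<open>- 1\<close> removes the only family of ballots that leaves the whole row empty.
\<close>

lemma
  assumes J: "finite J"
  shows is_species_row: "is_species (species_row J :: ('a, nat \<Rightarrow> 'a ballot) species)"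
    and signed_row: "signed (species_row J :: ('a, nat \<Rightarrow> 'a ballot) species)
      (\<lambda>t. \<Sum>j\<in>J. length (t j)) = virt_E_inv ^ card J - 1"
proof -
  let ?T = "family_species J (\<lambda>j. is_ballot) ballot_car [] ballot_transport
    :: ('a, nat \<Rightarrow> 'a ballot) species"
  let ?w = "\<lambda>t. \<Sum>j\<in>J. length (t j)"
  let ?O = "species_sub (\<lambda>t. \<not> row_car t \<noteq> {}) ?T"
  have T: "is_species ?T" and sT: "signed ?T ?w = virt_E_inv ^ card J"
    using signed_family[OF J, where ok = "\<lambda>j. is_ballot" and car = "ballot_car :: 'a ballot \<Rightarrow> _" and d = "[]"
        and tr = ballot_transport and w = "\<lambda>j. length"]
    by (simp_all add: is_species_Bal signed_Bal)
  have P: "invariant ?T (\<lambda>t. row_car t \<noteq> {})" and w: "invariant ?T ?w"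
    by (auto simp: invariant_def)
  have row: "species_sub (\<lambda>t. row_car t \<noteq> {}) ?T = species_row J" by (rule sub_carried)
  show "is_species (species_row J :: ('a, nat \<Rightarrow> 'a ballot) species)"
    using is_species_sub[OF T P] unfolding row .
  have O: "is_species ?O" by (rule is_species_sub[OF T invariant_comp[OF P, of Not]])
  have e: "structs ?O U = (if U = {} then {\<lambda>j. []} else {})" for U
  proof -
    have nil: "t = (\<lambda>j. [])" if t: "family J (\<lambda>j. is_ballot) ballot_car [] t" "row_car t = {}" for t
    proof
      fix j
      show "t j = []"
      proof (cases "j \<in> J")
        case True
        then have "is_ballot (t j)" using t(1) by (simp add: family_def)
        moreover have "ballot_car (t j) = {}" using t(2) by blast
        ultimately show ?thesis by (simp only: ballot_car_eq_empty)
      qed (use t(1) in \<open>simp add: family_def\<close>)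
    qed
    have "family J (\<lambda>j. is_ballot) ballot_car [] (\<lambda>j. [])" by (simp add: family_def)
    moreover have "row_car (\<lambda>j. [] :: 'a ballot) = {}" by simp
    ultimately have iff: "family J (\<lambda>j. is_ballot) ballot_car [] t \<and> row_car t = {} \<longleftrightarrow> t = (\<lambda>j. [])"
      for t :: "nat \<Rightarrow> 'a ballot" using nil by blast
    show ?thesis
    proof (rule set_eqI)
      fix t
      have "t \<in> structs ?O U \<longleftrightarrow>
          (family J (\<lambda>j. is_ballot) ballot_car [] t \<and> row_car t = {}) \<and> U = {}"
        unfolding structs_sub structs_carried mem_Collect_eq by metis
      then show "t \<in> structs ?O U \<longleftrightarrow> t \<in> (if U = {} then {\<lambda>j. []} else {})"
        unfolding iff by simp
    qed
  qed
  have b: "bij_betw (\<lambda>u j. []) (structs species_one U) (structs ?O U)" for U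
    unfolding e by (auto simp: species_one_def species_restrict_def species_E_def bij_betw_def)
  have i: "natural_iso species_one ?O (\<lambda>U u j. [])"
    by (rule natural_isoI[OF is_species_one O b]) simp
  have "signed ?O ?w = virt_of ?O"
  proof (rule signed_even[OF O])
    fix U t assume "t \<in> structs ?O U"
    then have "t = (\<lambda>j. [])" unfolding e by (simp split: if_splits)
    then show "even (?w t)" by simp
  qed
  also have "\<dots> = 1"
    using virt_of_eq_iff[OF is_species_one O] isomorphicI[OF i] by (simp add: virt_of_one)
  finally show "signed (species_row J :: ('a, nat \<Rightarrow> 'a ballot) species) ?w = virt_E_inv ^ card J - 1"
    using signed_split[OF T w P] unfolding row sT by simp
qed

definition species_B :: "('a, 'a bmat) species" where
  "species_B = Species (\<lambda>U. {M. is_ballot_matrix U M}) (\<lambda>U. bmat_transport)"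

text \<open>
  This reads a matrix as a nested family, to which the product formula applies twice. Disjointness of
  all entries amounts to disjointness of the rows and disjointness within each row.
\<close>

lemma is_ballot_matrix_rows:
  "is_ballot_matrix U (m, A) \<longleftrightarrow>
     family {1..m} (\<lambda>i. ballot_row {i..m}) row_car (\<lambda>j. []) A \<and> (\<Union>i. row_car (A i)) = U"
  (is "?L \<longleftrightarrow> ?R")
proof
  assume L: ?L
  have z: "A i j = []" if "\<not> (1 \<le> i \<and> i \<le> j \<and> j \<le> m)" for i j
    using L that by (simp add: is_ballot_matrix_def)
  have ok: "is_ballot (A i j)" for i j using L by (simp add: is_ballot_matrix_def)
  have dis: "ballot_car (A i j) \<inter> ballot_car (A k l) = {}" if "(i, j) \<noteq> (k, l)" for i j k l
    using L that by (simp add: is_ballot_matrix_def)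
  have ne: "\<exists>j. ballot_car (A i j) \<noteq> {}" if "i \<in> {1..m}" for i
    using L that unfolding is_ballot_matrix_def prod.case by blast
  have "ballot_row {i..m} (A i)" if i: "i \<in> {1..m}" for i
  proof
    show "family {i..m} (\<lambda>j. is_ballot) ballot_car [] (A i)"
      by (rule familyI) (use i z ok dis in auto)
    show "row_car (A i) \<noteq> {}" using ne[OF i] by blast
  qed
  moreover have "A i = (\<lambda>j. [])" if "i \<notin> {1..m}" for i using z that by auto
  moreover have "row_car (A i) \<inter> row_car (A k) = {}" if "i \<noteq> k" for i k
  proof -
    have "ballot_car (A i j) \<inter> ballot_car (A k l) = {}" for j l using dis that by simp
    then show ?thesis by blast
  qed
  ultimately have "family {1..m} (\<lambda>i. ballot_row {i..m}) row_car (\<lambda>j. []) A"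
    by (rule familyI[where ok = "\<lambda>i. ballot_row {i..m}"])
  moreover have "(\<Union>i. row_car (A i)) = U" using L by (simp add: is_ballot_matrix_def)
  ultimately show ?R ..
next
  assume R: ?R
  note fam = conjunct1[OF R]
  note row = conjunct1[OF family_member[OF fam]] and ne = conjunct2[OF family_member[OF fam]]
  note out = fun_cong[OF family_default[OF fam]]
  have z: "A i j = []" if "\<not> (1 \<le> i \<and> i \<le> j \<and> j \<le> m)" for i j
  proof (cases "i \<in> {1..m}")
    case True
    then have "j \<notin> {i..m}" using that by auto
    then show ?thesis by (rule family_default[OF row[OF True]])
  qed (rule out)
  moreover have "is_ballot (A i j)" for i j
  proof (cases "1 \<le> i \<and> i \<le> j \<and> j \<le> m")
    case True
    then have "i \<in> {1..m}" "j \<in> {i..m}" by auto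
    then show ?thesis by (rule family_member[OF row])
  qed (simp add: z)
  moreover have "ballot_car (A i j) \<inter> ballot_car (A k l) = {}" if "(i, j) \<noteq> (k, l)" for i j k l
  proof (cases "i = k")
    case True
    then have "j \<noteq> l" using that by simp
    then show ?thesis
      using family_disjoint[OF row, of i j l] out[of i] True by (cases "i \<in> {1..m}") simp_all
  next
    case False
    from family_disjoint[OF fam this] show ?thesis by blast
  qed
  moreover have "\<exists>j. ballot_car (A i j) \<noteq> {}" if "i \<in> {1..m}" for i using ne[OF that] by blast
  ultimately show ?L using R by (simp add: is_ballot_matrix_def)
qed

lemma num_blocks_upper_triangular:
  assumes "is_ballot_matrix U (m, A)"
  shows "num_blocks (m, A) = (\<Sum>i\<in>{1..m}. \<Sum>j\<in>{i..m}. length (A i j))"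
proof -
  have z: "A i j = []" if "\<not> i \<le> j" for i j
    using assms that by (simp add: is_ballot_matrix_def)
  have "(\<Sum>j=1..m. length (A i j)) = (\<Sum>j\<in>{i..m}. length (A i j))" if "i \<in> {1..m}" for i
    by (rule sum.mono_neutral_right) (use that z in auto)
  then show ?thesis by (simp add: num_blocks_def row_blocks_def)
qed

lemma num_blocks_transport [simp]: "num_blocks (bmat_transport \<sigma> M) = num_blocks M"
  and dim_transport [simp]: "fst (bmat_transport \<sigma> M) = fst M"
  by (simp_all add: num_blocks_def row_blocks_def bmat_transport_def split: prod.splits)

lemma ballot_matrices_of_dim:
  fixes m :: nat
  shows "is_species (species_sub (\<lambda>M. fst M = m) species_B :: ('a, 'a bmat) species) \<and>
    signed (species_sub (\<lambda>M. fst M = m) species_B :: ('a, 'a bmat) species) num_blocks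
      = (\<Prod>i=1..m. (virt_E_inv ^ i - 1))"
proof -
  let ?tr = "\<lambda>\<sigma> (t :: nat \<Rightarrow> 'a ballot) j. ballot_transport \<sigma> (t j)"
  let ?F = "family_species {1..m} (\<lambda>i. ballot_row {i..m}) row_car (\<lambda>j. []) ?tr"
  let ?w = "\<lambda>i (t :: nat \<Rightarrow> 'a ballot). \<Sum>j\<in>{i..m}. length (t j)"
  let ?G = "species_sub (\<lambda>M. fst M = m) species_B :: ('a, 'a bmat) species"
  have F: "is_species ?F"
  proof (rule signed_family(1)[where w = ?w])
    show "is_species (species_row {i..m} :: ('a, nat \<Rightarrow> 'a ballot) species)" for i
      by (rule is_species_row) simp
  qed simp_all
  have "signed ?F (\<lambda>A. \<Sum>i\<in>{1..m}. ?w i (A i)) = (\<Prod>i\<in>{1..m}. signed (species_row {i..m}) (?w i))"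
  proof (rule signed_family(2))
    show "is_species (species_row {i..m} :: ('a, nat \<Rightarrow> 'a ballot) species)" for i
      by (rule is_species_row) simp
  qed simp_all
  also have "\<dots> = (\<Prod>i\<in>{1..m}. virt_E_inv ^ card {i..m} - 1)"
    by (rule prod.cong[OF refl], rule signed_row) simp
  finally have sF: "signed ?F (\<lambda>A. \<Sum>i\<in>{1..m}. ?w i (A i)) = (\<Prod>i\<in>{1..m}. virt_E_inv ^ card {i..m} - 1)" .
  have sF': "structs ?F U = {A. is_ballot_matrix U (m, A)}" for U
    unfolding structs_carried is_ballot_matrix_rows ..
  have b: "bij_betw (Pair m) (structs ?F U) (structs ?G U)" for U
    unfolding sF' by (rule bij_betw_byWitness[where f' = snd]) (auto simp: species_B_def)
  have n: "(m, transport ?F U \<sigma> A) = transport ?G U \<sigma> (m, A)" for U \<sigma> A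
    by (simp add: species_B_def bmat_transport_def)
  have G: "is_species ?G" by (rule is_species_transfer[where \<eta> = "\<lambda>U. Pair m", OF F b n])
  have i: "natural_iso ?F ?G (\<lambda>U. Pair m)" by (rule natural_isoI[where \<eta> = "\<lambda>U. Pair m", OF F G b n])
  have "signed ?F (\<lambda>A. \<Sum>i\<in>{1..m}. ?w i (A i)) = signed ?G num_blocks"
  proof (rule signed_iso[OF i])
    show "invariant ?G num_blocks" by (rule invariantI) (simp add: species_B_def)
    show "num_blocks (m, A) = (\<Sum>i\<in>{1..m}. ?w i (A i))" if "A \<in> structs ?F U" for U A
      by (rule num_blocks_upper_triangular) (use that[unfolded sF'] in simp)
  qed
  \<comment> \<open>Row \<open>i\<close> has \<open>m + 1 - i\<close> entries, so the product runs through the rows from the bottom up.\<close>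
  moreover have "(\<Prod>i\<in>{1..m}. virt_E_inv ^ card {i..m} - (1 :: 'a virt)) = (\<Prod>i=1..m. (virt_E_inv ^ i - 1))"
    by (rule prod.reindex_bij_witness[of _ "\<lambda>i. m + 1 - i" "\<lambda>i. m + 1 - i"]) auto
  ultimately show ?thesis using G sF by simp
qed

lemma dim_le_card:
  assumes "is_ballot_matrix U (m, A)" "finite U" shows "m \<le> card U"
proof -
  have "\<exists>x. x \<in> row_car (A i)" if "i \<in> {1..m}" for i
    using assms(1) that unfolding is_ballot_matrix_def prod.case by blast
  then obtain x where x: "\<And>i. i \<in> {1..m} \<Longrightarrow> x i \<in> row_car (A i)" by metis
  have "row_car (A i) \<inter> row_car (A k) = {}" if "i \<noteq> k" for i k
    using family_disjoint[OF conjunct1[OF assms(1)[unfolded is_ballot_matrix_rows]] that] .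
  then have "inj_on x {1..m}" using x by (intro inj_onI) (metis (no_types, lifting) IntI empty_iff)
  moreover have "x ` {1..m} \<subseteq> U" using x assms(1) unfolding is_ballot_matrix_rows by blast
  ultimately have "card {1..m} \<le> card U" using assms(2) card_inj_on_le by blast
  then show ?thesis by simp
qed

text \<open>
  Here the dimension is the grade: it is at most the size of the set since every row is occupied. The
  sign \<open>(-1) ^ (k + m)\<close> of a matrix with \<open>k\<close> blocks splits off \<open>(-1) ^ m\<close> in dimension \<open>m\<close>.
\<close>

lemma
  shows is_species_B: "is_species (species_B :: ('a, 'a bmat) species)"
    and signed_B_sums: "(\<lambda>m. (-1) ^ m * (\<Prod>i=1..m. (virt_E_inv ^ i - 1))) sums
      signed (species_B :: ('a, 'a bmat) species) (\<lambda>M. num_blocks M + fst M)"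
proof -
  let ?B = "species_B :: ('a, 'a bmat) species" and ?w = "\<lambda>M :: 'a bmat. num_blocks M + fst M"
  have le: "fst M \<le> card U" if "finite U" "M \<in> structs ?B U" for U M
    using that dim_le_card[of U "fst M" "snd M"] by (simp add: species_B_def)
  note g = is_species_graded[OF conjunct1[OF ballot_matrices_of_dim] le]
  show B: "is_species ?B" by (rule g)
  have "signed (species_sub (\<lambda>M. fst M = m) ?B) ?w = (-1) ^ m * (\<Prod>i=1..m. (virt_E_inv ^ i - 1))" for m
  proof -
    have "signed (species_sub (\<lambda>M. fst M = m) ?B) ?w
        = signed (species_sub (\<lambda>M. fst M = m) ?B) (\<lambda>M. num_blocks M + m)"
      by (rule signed_cong) simp
    then show ?thesis by (simp add: signed_shift ballot_matrices_of_dim)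
  qed
  moreover have "(\<lambda>m. signed (species_sub (\<lambda>M. fst M = m) ?B) ?w) sums signed ?B ?w"
    by (rule signed_graded_sums[OF B _ g(2) le]) (auto simp: invariant_def species_B_def)
  ultimately show "(\<lambda>m. (-1) ^ m * (\<Prod>i=1..m. (virt_E_inv ^ i - 1))) sums signed ?B ?w"
    by simp
qed


section \<open>Ballot matrices\<close>

lemma is_ballot_distinct: "is_ballot b \<Longrightarrow> distinct b"
  by (induction b) auto

lemma
  assumes "is_ballot_matrix U (m, A)"
  shows ballot_matrix_support: "A i j \<noteq> [] \<Longrightarrow> 1 \<le> i \<and> i \<le> j \<and> j \<le> m"
    and ballot_matrix_ballot: "is_ballot (A i j)"
    and ballot_matrix_unique:
      "x \<in> ballot_car (A i j) \<Longrightarrow> x \<in> ballot_car (A k l) \<Longrightarrow> i = k \<and> j = l"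
    and ballot_matrix_union: "(\<Union>i. \<Union>j. ballot_car (A i j)) = U"
    and ballot_matrix_row: "i \<in> {1..m} \<Longrightarrow> \<exists>j. A i j \<noteq> []"
proof -
  note M = assms[unfolded is_ballot_matrix_def prod.case]
  note M2 = conjunct2[OF M] and M3 = conjunct2[OF conjunct2[OF M]]
  note M4 = conjunct2[OF M3]
  show "A i j \<noteq> [] \<Longrightarrow> 1 \<le> i \<and> i \<le> j \<and> j \<le> m" using conjunct1[OF M] by blast
  show "is_ballot (A i j)" using conjunct1[OF M2] by blast
  have d: "(i, j) \<noteq> (k, l) \<Longrightarrow> ballot_car (A i j) \<inter> ballot_car (A k l) = {}"
    using conjunct1[OF M3] by blast
  show "x \<in> ballot_car (A i j) \<Longrightarrow> x \<in> ballot_car (A k l) \<Longrightarrow> i = k \<and> j = l"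
    using d by auto
  show "(\<Union>i. \<Union>j. ballot_car (A i j)) = U" by (rule conjunct1[OF M4])
  show "\<exists>j. A i j \<noteq> []" if i: "i \<in> {1..m}"
  proof -
    obtain j where "ballot_car (A i j) \<noteq> {}" using bspec[OF conjunct2[OF M4] i] ..
    then show ?thesis by (intro exI[of _ j]) auto
  qed
qed

lemma ballot_matrixI:
  assumes s: "\<And>i j. A i j \<noteq> [] \<Longrightarrow> 1 \<le> i \<and> i \<le> j \<and> j \<le> m"
    and ok: "\<And>i j. is_ballot (A i j)"
    and d: "\<And>x i j k l. x \<in> ballot_car (A i j) \<Longrightarrow> x \<in> ballot_car (A k l) \<Longrightarrow> i = k \<and> j = l"
    and u: "(\<Union>i. \<Union>j. ballot_car (A i j)) = U"
    and r: "\<And>i. i \<in> {1..m} \<Longrightarrow> \<exists>j. A i j \<noteq> []"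
  shows "is_ballot_matrix U (m, A)"
  unfolding is_ballot_matrix_def prod.case
proof (intro conjI allI impI ballI)
  show "ballot_car (A i j) \<inter> ballot_car (A k l) = {}" if "(i, j) \<noteq> (k, l)" for i j k l
    using d[of _ i j k l] that by blast
  show "\<exists>j. ballot_car (A i j) \<noteq> {}" if "i \<in> {1..m}" for i
    using r[OF that] ballot_car_eq_empty[OF ok] by metis
  show "A i j = []" if "\<not> (1 \<le> i \<and> i \<le> j \<and> j \<le> m)" for i j using s[of i j] that by blast
qed (rule ok u)+

lemma first_col_eqI:
  "A i j \<noteq> [] \<Longrightarrow> (\<And>l. l < j \<Longrightarrow> A i l = []) \<Longrightarrow> first_col (m, A) i = j"
  unfolding first_col_def prod.case by (rule Least_equality) (auto simp: not_less[symmetric])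

lemma first_col_less: "l < first_col (m, A) i \<Longrightarrow> A i l = []"
  unfolding first_col_def prod.case using not_less_Least by blast

lemma
  assumes M: "is_ballot_matrix U (m, A)" and i: "i \<in> {1..m}"
  shows first_col_nonempty: "A i (first_col (m, A) i) \<noteq> []"
    and first_col_ge: "i \<le> first_col (m, A) i"
    and first_col_le: "first_col (m, A) i \<le> m"
proof -
  obtain j where j: "A i j \<noteq> []" using ballot_matrix_row[OF M i] ..
  show ne: "A i (first_col (m, A) i) \<noteq> []"
    unfolding first_col_def prod.case by (rule LeastI[of "\<lambda>j. A i j \<noteq> []", OF j])
  show "i \<le> first_col (m, A) i" "first_col (m, A) i \<le> m"
    using ballot_matrix_support[OF M ne] by simp_all
qed

lemma row_blocks_card:
  assumes M: "is_ballot_matrix U (m, A)"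
  shows "row_blocks (m, A) i = card (\<Union>j. set (A i j))"
proof -
  have "row_blocks (m, A) i = (\<Sum>j=1..m. card (set (A i j)))"
    using is_ballot_distinct[OF ballot_matrix_ballot[OF M]]
    by (simp add: row_blocks_def distinct_card)
  also have "\<dots> = card (\<Union>j\<in>{1..m}. set (A i j))"
  proof (rule card_UN_disjoint[symmetric]; (intro ballI impI)?)
    fix j l :: nat assume "j \<noteq> l"
    have False if "B \<in> set (A i j)" "B \<in> set (A i l)" for B
    proof -
      have "B \<noteq> {}" using ballot_matrix_ballot[OF M, of i j] that by (auto simp: is_ballot_def)
      then obtain x where "x \<in> B" by blast
      then show False using ballot_matrix_unique[OF M, of x i j i l] that \<open>j \<noteq> l\<close> by blast
    qed
    then show "set (A i j) \<inter> set (A i l) = {}" by blast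
  qed auto
  also have "(\<Union>j\<in>{1..m}. set (A i j)) = (\<Union>j. set (A i j))"
  proof
    show "(\<Union>j. set (A i j)) \<subseteq> (\<Union>j\<in>{1..m}. set (A i j))"
    proof
      fix B assume "B \<in> (\<Union>j. set (A i j))"
      then obtain j where j: "B \<in> set (A i j)" by blast
      then have "A i j \<noteq> []" by auto
      from ballot_matrix_support[OF M this] j show "B \<in> (\<Union>j\<in>{1..m}. set (A i j))" by force
    qed
  qed auto
  finally show ?thesis .
qed

text \<open>
  Blocks are nonempty and disjoint, so no block occurs twice, and the number of blocks is the size of
  the set of all blocks. This makes it evident that moving blocks around preserves their number.
\<close>

lemma num_blocks_card:
  assumes M: "is_ballot_matrix U (m, A)"
  shows "num_blocks (m, A) = card (\<Union>i. \<Union>j. set (A i j))"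
proof -
  have "num_blocks (m, A) = (\<Sum>i=1..m. card (\<Union>j. set (A i j)))"
    by (simp add: num_blocks_def row_blocks_card[OF M])
  also have "\<dots> = card (\<Union>i\<in>{1..m}. \<Union>j. set (A i j))"
  proof (rule card_UN_disjoint[symmetric]; (intro ballI impI)?)
    fix i k :: nat assume "i \<noteq> k"
    have False if "B \<in> set (A i j)" "B \<in> set (A k l)" for B j l
    proof -
      have "B \<noteq> {}" using ballot_matrix_ballot[OF M, of i j] that by (auto simp: is_ballot_def)
      then obtain x where "x \<in> B" by blast
      then show False using ballot_matrix_unique[OF M, of x i j k l] that \<open>i \<noteq> k\<close> by blast
    qed
    then show "(\<Union>j. set (A i j)) \<inter> (\<Union>j. set (A k j)) = {}" by blast
  next
    fix i assume "i \<in> {1..m}"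
    have "(\<Union>j. set (A i j)) \<subseteq> (\<Union>j\<in>{1..m}. set (A i j))"
    proof
      fix B assume "B \<in> (\<Union>j. set (A i j))"
      then obtain j where j: "B \<in> set (A i j)" by blast
      then have "A i j \<noteq> []" by auto
      from ballot_matrix_support[OF M this] j show "B \<in> (\<Union>j\<in>{1..m}. set (A i j))" by force
    qed
    then show "finite (\<Union>j. set (A i j))" by (rule finite_subset) simp
  qed auto
  also have "(\<Union>i\<in>{1..m}. \<Union>j. set (A i j)) = (\<Union>i. \<Union>j. set (A i j))"
  proof
    show "(\<Union>i. \<Union>j. set (A i j)) \<subseteq> (\<Union>i\<in>{1..m}. \<Union>j. set (A i j))"
    proof
      fix B assume "B \<in> (\<Union>i. \<Union>j. set (A i j))"
      then obtain i j where j: "B \<in> set (A i j)" by blast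
      then have "A i j \<noteq> []" by auto
      from ballot_matrix_support[OF M this] j show "B \<in> (\<Union>i\<in>{1..m}. \<Union>j. set (A i j))" by force
    qed
  qed auto
  finally show ?thesis .
qed

lemma row_blocks_remove:
  assumes M: "is_ballot_matrix U (m, A)" and j: "A i j \<noteq> []"
  shows "row_blocks (m, A) i = length (A i j) + (\<Sum>l\<in>{1..m} - {j}. length (A i l))"
proof -
  have "j \<in> {1..m}" using ballot_matrix_support[OF M j] by auto
  then show ?thesis by (simp add: row_blocks_def sum.remove)
qed

lemma single_block_iff:
  assumes M: "is_ballot_matrix U (m, A)" and j: "A i j \<noteq> []"
  shows "row_blocks (m, A) i = 1 \<longleftrightarrow> tl (A i j) = [] \<and> (\<forall>l. l \<noteq> j \<longrightarrow> A i l = [])"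
proof
  assume "row_blocks (m, A) i = 1"
  moreover have "length (A i j) \<ge> 1" using j by (simp add: Suc_le_eq)
  ultimately have 1: "length (A i j) = 1" and 0: "(\<Sum>l\<in>{1..m} - {j}. length (A i l)) = 0"
    unfolding row_blocks_remove[OF M j] by linarith+
  have "A i l = []" if "l \<noteq> j" for l
  proof (rule ccontr)
    assume "A i l \<noteq> []"
    with ballot_matrix_support[OF M this] 0 that show False by auto
  qed
  then show "tl (A i j) = [] \<and> (\<forall>l. l \<noteq> j \<longrightarrow> A i l = [])"
    using 1 by (auto simp: length_Suc_conv)
next
  assume "tl (A i j) = [] \<and> (\<forall>l. l \<noteq> j \<longrightarrow> A i l = [])"
  moreover from this have "length (A i j) = 1" using j by (cases "A i j") auto
  ultimately show "row_blocks (m, A) i = 1" unfolding row_blocks_remove[OF M j] by simp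
qed

lemma row_blocks_pos:
  assumes M: "is_ballot_matrix U (m, A)" and i: "i \<in> {1..m}"
  shows "row_blocks (m, A) i \<ge> 1"
  using row_blocks_remove[OF M first_col_nonempty[OF M i]] first_col_nonempty[OF M i]
  by (simp add: Suc_le_eq)

lemma splittable_iff:
  assumes M: "is_ballot_matrix U (m, A)" and i: "i \<in> {1..m}"
  shows "splittable (m, A) i \<longleftrightarrow> row_blocks (m, A) i \<noteq> 1"
  using row_blocks_pos[OF M i] i by (auto simp: splittable_def)


section \<open>Splitting\<close>

text \<open>
  The index changes caused by inserting (\<open>skip\<close>) and deleting (\<open>unskip\<close>) a row and a column at
  index \<open>i\<close>.
\<close>

definition skip :: "nat \<Rightarrow> nat \<Rightarrow> nat" where
  "skip i k = (if k < i then k else Suc k)"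

definition unskip :: "nat \<Rightarrow> nat \<Rightarrow> nat" where
  "unskip i k = (if k < i then k else k - 1)"

lemma unskip_skip [simp]: "unskip i (skip i k) = k"
  and skip_neq [simp]: "skip i k \<noteq> i" "i \<noteq> skip i k"
  and skip_unskip: "k \<noteq> i \<Longrightarrow> skip i (unskip i k) = k"
  and skip_eq_iff [simp]: "skip i k = skip i l \<longleftrightarrow> k = l"
  and skip_le_iff: "skip i k \<le> skip i l \<longleftrightarrow> k \<le> l"
  by (auto simp: skip_def unskip_def)

lemma unskip_eqD: "unskip i k = unskip i l \<Longrightarrow> k \<noteq> i \<Longrightarrow> l \<noteq> i \<Longrightarrow> k = l"
  by (metis skip_unskip)

text \<open>
  The entries of the split and merged matrix in closed form; \<open>j\<close> stands for the first nonempty column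
  of row \<open>i\<close>.
\<close>

definition split_at :: "nat \<Rightarrow> nat \<Rightarrow> (nat \<Rightarrow> nat \<Rightarrow> 'a ballot) \<Rightarrow> nat \<Rightarrow> nat \<Rightarrow> 'a ballot" where
  "split_at i j A k l =
     (if k = i then if l = Suc j then [hd (A i j)] else []
      else if l = i then []
      else if k = Suc i \<and> l = Suc j then tl (A i j)
      else A (unskip i k) (unskip i l))"

definition merge_at :: "nat \<Rightarrow> nat \<Rightarrow> (nat \<Rightarrow> nat \<Rightarrow> 'a ballot) \<Rightarrow> nat \<Rightarrow> nat \<Rightarrow> 'a ballot" where
  "merge_at i j A k l =
     (if k = i \<and> Suc l = j then hd (A i j) # A (Suc i) j else A (skip i k) (skip i l))"

lemma split_row_eq:
  assumes "i \<le> first_col (m, A) i"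
  shows "split_row i (m, A) = (Suc m, split_at i (first_col (m, A) i) A)"
  using assms unfolding split_row_def prod.case Let_def
  by (auto simp: fun_eq_iff split_at_def set_entry_def insert_row_col_def unskip_def)

lemma merge_row_eq:
  assumes "i < first_col (m, A) i"
  shows "merge_row i (m, A) = (m - 1, merge_at i (first_col (m, A) i) A)"
  using assms unfolding merge_row_def prod.case Let_def
  by (auto simp: fun_eq_iff merge_at_def set_entry_def delete_row_col_def skip_def)

context
  fixes U :: "'a set" and m i j :: nat and A :: "nat \<Rightarrow> nat \<Rightarrow> 'a ballot"
  assumes M: "is_ballot_matrix U (m, A)" and s: "splittable (m, A) i"
    and j_def: "j = first_col (m, A) i"
begin

lemma split_idx: "1 \<le> i" "i \<le> j" "j \<le> m" "A i j \<noteq> []" "l < j \<Longrightarrow> A i l = []"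
  using s first_col_nonempty[OF M, of i] first_col_ge[OF M, of i] first_col_le[OF M, of i]
    first_col_less[of l m A i]
  by (auto simp: splittable_def j_def)

text \<open>
  Where a block of the split matrix comes from. Rows \<open>i\<close> and \<open>i + 1\<close> both come from row \<open>i\<close>; in
  the one column where both can be occupied, they hold the head and the tail of one ballot.
\<close>

lemma split_origin:
  assumes "B \<in> set (split_at i j A k l)"
  shows "l \<noteq> i" and "k = i \<Longrightarrow> l = Suc j \<and> B = hd (A i j)"
    and "k = Suc i \<Longrightarrow> l = Suc j \<Longrightarrow> B \<in> set (tl (A i j))"
    and "B \<in> set (A (if k = i then i else unskip i k) (unskip i l))"
  using assms split_idx
  by (auto simp: split_at_def unskip_def split: if_splits dest: list.set_sel(2))

lemma split_image:
  assumes "B \<in> set (A k l)"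
  shows "B \<in> set (split_at i j A (skip i k) (skip i l)) \<or> k = i \<and> l = j \<and> B \<in> set (split_at i j A i (Suc j))"
proof (cases "k = i \<and> l = j")
  case True
  then have "B = hd (A i j) \<or> B \<in> set (tl (A i j))" using assms by (cases "A i j") auto
  then show ?thesis using True split_idx(2) by (auto simp: split_at_def skip_def)
next
  case False
  then have "\<not> (skip i k = Suc i \<and> skip i l = Suc j)" using split_idx(2) by (auto simp: skip_def split: if_splits)
  then have "split_at i j A (skip i k) (skip i l) = A k l" by (auto simp: split_at_def)
  then show ?thesis using assms by simp
qed

lemma split_all_blocks: "(\<Union>k. \<Union>l. set (split_at i j A k l)) = (\<Union>k. \<Union>l. set (A k l))"
proof (intro equalityI subsetI)
  fix B assume "B \<in> (\<Union>k. \<Union>l. set (split_at i j A k l))"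
  then obtain k l where "B \<in> set (split_at i j A k l)" by blast
  from split_origin(4)[OF this] show "B \<in> (\<Union>k. \<Union>l. set (A k l))" by blast
next
  fix B assume "B \<in> (\<Union>k. \<Union>l. set (A k l))"
  then obtain k l where "B \<in> set (A k l)" by blast
  from split_image[OF this] show "B \<in> (\<Union>k. \<Union>l. set (split_at i j A k l))" by blast
qed

lemma split_row_set:
  assumes "r < i" shows "(\<Union>l. set (split_at i j A r l)) = (\<Union>l. set (A r l))"
proof (intro equalityI subsetI)
  fix B assume "B \<in> (\<Union>l. set (split_at i j A r l))"
  then obtain l where "B \<in> set (split_at i j A r l)" by blast
  from split_origin(4)[OF this] assms show "B \<in> (\<Union>l. set (A r l))"
    by (auto simp: unskip_def)
next
  fix B assume "B \<in> (\<Union>l. set (A r l))"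
  then obtain l where "B \<in> set (A r l)" by blast
  from split_image[OF this] assms show "B \<in> (\<Union>l. set (split_at i j A r l))"
    by (auto simp: skip_def[of i r])
qed

lemma split_ballot_matrix: "is_ballot_matrix U (Suc m, split_at i j A)"
proof (rule ballot_matrixI)
  fix k l assume "split_at i j A k l \<noteq> []"
  then obtain B where B: "B \<in> set (split_at i j A k l)" by (meson list.set_sel(1))
  then have "A (if k = i then i else unskip i k) (unskip i l) \<noteq> []" using split_origin(4)[OF B] by auto
  from ballot_matrix_support[OF M this] split_origin(1,2)[OF B] split_idx
  show "1 \<le> k \<and> k \<le> l \<and> l \<le> Suc m" by (auto simp: unskip_def split: if_splits)
next
  fix k l
  have "is_ballot (hd (A i j) # tl (A i j))" using ballot_matrix_ballot[OF M, of i j] split_idx(4) by simp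
  then show "is_ballot (split_at i j A k l)"
    using ballot_matrix_ballot[OF M] by (auto simp: split_at_def)
next
  fix x k l k' l'
  assume "x \<in> ballot_car (split_at i j A k l)" "x \<in> ballot_car (split_at i j A k' l')"
  then obtain B B' where B: "B \<in> set (split_at i j A k l)" "x \<in> B"
    and B': "B' \<in> set (split_at i j A k' l')" "x \<in> B'" by blast
  have "(if k = i then i else unskip i k) = (if k' = i then i else unskip i k') \<and> unskip i l = unskip i l'"
    by (rule ballot_matrix_unique[OF M, of x])
      (use split_origin(4)[OF B(1)] split_origin(4)[OF B'(1)] B(2) B'(2) in blast)+
  then have l: "l = l'" and u: "(if k = i then i else unskip i k) = (if k' = i then i else unskip i k')"
    using split_origin(1)[OF B(1)] split_origin(1)[OF B'(1)] unskip_eqD by blast+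
  have no: False if "C \<in> set (tl (A i j))" "x \<in> C" "x \<in> hd (A i j)" for C
  proof -
    have "is_ballot (hd (A i j) # tl (A i j))" using ballot_matrix_ballot[OF M, of i j] split_idx(4) by simp
    then show False using that by auto
  qed
  have "k = k'"
  proof (rule ccontr)
    assume "k \<noteq> k'"
    with u consider "k = i" "k' = Suc i" | "k' = i" "k = Suc i"
      by (fastforce simp: unskip_def split: if_splits)
    then show False
    proof cases
      case 1
      then show False
        using split_origin(2)[OF B(1)] split_origin(3)[OF B'(1)] B(2) B'(2) l no by auto
    next
      case 2
      then show False
        using split_origin(2)[OF B'(1)] split_origin(3)[OF B(1)] B(2) B'(2) l no by auto
    qed
  qed
  with l show "k = k' \<and> l = l'" by simp
next
  have "(\<Union>k. \<Union>l. ballot_car (split_at i j A k l)) = \<Union>(\<Union>k. \<Union>l. set (split_at i j A k l))" by blast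
  also have "\<dots> = (\<Union>k. \<Union>l. ballot_car (A k l))" unfolding split_all_blocks by blast
  finally show "(\<Union>k. \<Union>l. ballot_car (split_at i j A k l)) = U"
    using ballot_matrix_union[OF M] by simp
next
  fix k assume k: "k \<in> {1..Suc m}"
  consider "k = i" | "k \<noteq> i" "k \<noteq> Suc i" | "k = Suc i" by blast
  then show "\<exists>l. split_at i j A k l \<noteq> []"
  proof cases
    case 1
    then show ?thesis by (intro exI[of _ "Suc j"]) (simp add: split_at_def)
  next
    case 2
    have "unskip i k \<in> {1..m}" using k 2 split_idx by (auto simp: unskip_def)
    from ballot_matrix_row[OF M this] obtain l where "A (unskip i k) l \<noteq> []" ..
    then show ?thesis using 2 by (intro exI[of _ "skip i l"]) (simp add: split_at_def)
  next
    case 3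
    have "\<not> (tl (A i j) = [] \<and> (\<forall>l. l \<noteq> j \<longrightarrow> A i l = []))"
      using single_block_iff[OF M split_idx(4)] s by (auto simp: splittable_def)
    then consider "tl (A i j) \<noteq> []" | l where "l \<noteq> j" "A i l \<noteq> []" by blast
    then show ?thesis
    proof cases
      case 1
      then show ?thesis using 3 split_idx by (intro exI[of _ "Suc j"]) (simp add: split_at_def)
    next
      case (2 l)
      then have "i \<le> l" using ballot_matrix_support[OF M] by blast
      then show ?thesis
        using 3 2 split_idx by (intro exI[of _ "Suc l"]) (simp add: split_at_def unskip_def)
    qed
  qed
qed

lemma split_first_col: "first_col (Suc m, split_at i j A) i = Suc j"
  by (rule first_col_eqI) (simp_all add: split_at_def)

text \<open>
  The removed block is alone in row \<open>i\<close>, column \<open>i\<close> is new, hence empty, and the blocks that it was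
  separated from start in row \<open>i + 1\<close> at the same column or further to the right.
\<close>

lemma split_mergeable: "mergeable (Suc m, split_at i j A) i"
proof -
  note N = split_ballot_matrix
  have "row_blocks (Suc m, split_at i j A) i = 1"
    using single_block_iff[OF N, of i "Suc j"] by (simp add: split_at_def)
  moreover have "i \<in> empty_cols (Suc m, split_at i j A)"
    using split_idx by (auto simp: empty_cols_def split_at_def)
  moreover have "Suc j \<le> first_col (Suc m, split_at i j A) (Suc i)"
  proof (rule ccontr)
    let ?l = "first_col (Suc m, split_at i j A) (Suc i)"
    assume l: "\<not> Suc j \<le> ?l"
    have "A i (unskip i ?l) \<noteq> []"
      using first_col_nonempty[OF N, of "Suc i"] split_idx l
      by (auto simp: split_at_def unskip_def[of i "Suc i"] split: if_splits)
    moreover have "unskip i ?l < j"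
      using first_col_ge[OF N, of "Suc i"] split_idx l by (auto simp: unskip_def)
    ultimately show False using split_idx(5) by blast
  qed
  ultimately show ?thesis using split_idx by (simp add: mergeable_def split_first_col)
qed

lemma merge_split: "merge_at i (Suc j) (split_at i j A) = A"
proof (intro ext)
  fix k l
  show "merge_at i (Suc j) (split_at i j A) k l = A k l"
  proof (cases "k = i \<and> l = j")
    case False
    then have "\<not> (skip i k = Suc i \<and> skip i l = Suc j)"
      using split_idx(2) by (auto simp: skip_def split: if_splits)
    with False show ?thesis by (auto simp: merge_at_def split_at_def)
  qed (use split_idx in \<open>simp add: merge_at_def split_at_def\<close>)
qed

lemma split_first_col_less:
  assumes r: "1 \<le> r" "r < i"
  shows "first_col (Suc m, split_at i j A) r = skip i (first_col (m, A) r)"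
proof (rule first_col_eqI)
  have r': "r \<in> {1..m}" using r split_idx by simp
  show "split_at i j A r (skip i (first_col (m, A) r)) \<noteq> []"
    using first_col_nonempty[OF M r'] r by (simp add: split_at_def unskip_def[of i r])
  fix l assume "l < skip i (first_col (m, A) r)"
  then have "l = i \<or> unskip i l < first_col (m, A) r" by (auto simp: skip_def unskip_def split: if_splits)
  then show "split_at i j A r l = []"
    using r first_col_less[of "unskip i l" m A r] by (auto simp: split_at_def unskip_def[of i r])
qed

text \<open>
  Splitting does not affect the moves of earlier rows. The shift of the columns is strictly monotone,
  so comparisons of first nonempty columns are preserved; this includes the comparison of row
  \<open>i - 1\<close> with row \<open>i\<close>, as the removed block stays in the (shifted) first nonempty column of row \<open>i\<close>.
\<close>

lemma split_moves_less:
  assumes r: "r < i"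
  shows "splittable (Suc m, split_at i j A) r \<longleftrightarrow> splittable (m, A) r"
    and "mergeable (Suc m, split_at i j A) r \<longleftrightarrow> mergeable (m, A) r"
proof -
  let ?N = "(Suc m, split_at i j A)"
  have rb: "row_blocks ?N r = row_blocks (m, A) r"
    unfolding row_blocks_card[OF M] row_blocks_card[OF split_ballot_matrix] split_row_set[OF r] ..
  then show "splittable ?N r \<longleftrightarrow> splittable (m, A) r"
    using r split_idx by (auto simp: splittable_def)
  have col: "r \<in> empty_cols ?N \<longleftrightarrow> r \<in> empty_cols (m, A)"
  proof -
    have 1: "split_at i j A k r = (if k = i then [] else A (unskip i k) r)" for k
      using r split_idx by (auto simp: split_at_def unskip_def)
    have "(\<forall>k. split_at i j A k r = []) \<longleftrightarrow> (\<forall>k. A k r = [])"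
    proof
      assume N: "\<forall>k. split_at i j A k r = []"
      show "\<forall>k. A k r = []"
      proof
        fix k show "A k r = []" using N[rule_format, of "skip i k"] unfolding 1 by simp
      qed
    qed (simp add: 1)
    then show ?thesis using r split_idx by (auto simp: empty_cols_def)
  qed
  have fc: "first_col ?N r \<le> first_col ?N (Suc r) \<longleftrightarrow> first_col (m, A) r \<le> first_col (m, A) (Suc r)"
    if "1 \<le> r"
  proof (cases "Suc r = i")
    case True
    have "first_col ?N (Suc r) = skip i (first_col (m, A) (Suc r))"
      unfolding True split_first_col using split_idx(2) by (simp add: skip_def flip: j_def)
    then show ?thesis using split_first_col_less[OF that r] by (simp add: skip_le_iff)
  next
    case False
    then show ?thesis
      using split_first_col_less[OF that r] split_first_col_less[of "Suc r"] r by (simp add: skip_le_iff)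
  qed
  show "mergeable ?N r \<longleftrightarrow> mergeable (m, A) r"
    using rb col fc r split_idx by (auto simp: mergeable_def)
qed

end


section \<open>Merging\<close>

context
  fixes U :: "'a set" and m i j :: nat and A :: "nat \<Rightarrow> nat \<Rightarrow> 'a ballot"
  assumes M: "is_ballot_matrix U (m, A)" and g: "mergeable (m, A) i"
    and j_def: "j = first_col (m, A) i"
begin

lemma merge_idx:
  shows "1 \<le> i" "i < j" "j \<le> m" "i < m" and "A i j = [hd (A i j)]"
    and "l \<noteq> j \<Longrightarrow> A i l = []" and "A k i = []" and "l < j \<Longrightarrow> A (Suc i) l = []"
proof -
  have i: "i \<in> {1..m}" using g by (auto simp: mergeable_def)
  have ne: "A i j \<noteq> []" using first_col_nonempty[OF M i] by (simp add: j_def)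
  show "1 \<le> i" "i < m" using g by (auto simp: mergeable_def)
  show "j \<le> m" using first_col_le[OF M i] by (simp add: j_def)
  have one: "tl (A i j) = [] \<and> (\<forall>l. l \<noteq> j \<longrightarrow> A i l = [])"
    using single_block_iff[OF M ne] g by (simp add: mergeable_def)
  then show "A i j = [hd (A i j)]" using ne by (metis list.collapse)
  show "l \<noteq> j \<Longrightarrow> A i l = []" using one by simp
  show col: "A k i = []" for k using g by (simp add: mergeable_def empty_cols_def)
  show "i < j" using first_col_ge[OF M i] col[of i] ne unfolding j_def by (metis le_neq_implies_less)
  show "l < j \<Longrightarrow> A (Suc i) l = []"
    using g first_col_less[of l m A "Suc i"] by (simp add: mergeable_def j_def)
qed

lemma merge_superset: "set (A (skip i k) (skip i l)) \<subseteq> set (merge_at i j A k l)"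
  using merge_idx(2) by (auto simp: merge_at_def skip_def)

text \<open>
  After the deletion of row \<open>i\<close>, the only block that does not simply follow the shift of the indices
  is the one of row \<open>i\<close>.
\<close>

lemma merge_origin:
  assumes "B \<in> set (merge_at i j A k l)"
  shows "B \<in> set (A (skip i k) (skip i l)) \<or> k = i \<and> Suc l = j \<and> B \<in> set (A i j)"
proof (cases "k = i \<and> Suc l = j")
  case True
  have "hd (A i j) \<in> set (A i j)" by (subst merge_idx(5)) simp
  with True assms merge_idx(2) show ?thesis by (auto simp: merge_at_def skip_def)
next
  case False
  with assms show ?thesis by (auto simp: merge_at_def)
qed

lemma merge_all_blocks: "(\<Union>k. \<Union>l. set (merge_at i j A k l)) = (\<Union>k. \<Union>l. set (A k l))"
proof (intro equalityI subsetI)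
  fix B assume "B \<in> (\<Union>k. \<Union>l. set (merge_at i j A k l))"
  then obtain k l where "B \<in> set (merge_at i j A k l)" by blast
  from merge_origin[OF this] show "B \<in> (\<Union>k. \<Union>l. set (A k l))" by blast
next
  fix B assume "B \<in> (\<Union>k. \<Union>l. set (A k l))"
  then obtain k l where B: "B \<in> set (A k l)" by blast
  have "l \<noteq> i" using B merge_idx(7)[of k] by auto
  show "B \<in> (\<Union>k. \<Union>l. set (merge_at i j A k l))"
  proof (cases "k = i")
    case True
    then have "l = j" using B merge_idx(6)[of l] by (cases "l = j") auto
    then have "B \<in> set (A i j)" using B True by simp
    then have "B = hd (A i j)" by (subst (asm) merge_idx(5)) simp
    then have "B \<in> set (merge_at i j A i (j - 1))" using merge_idx(2) by (simp add: merge_at_def)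
    then show ?thesis by blast
  next
    case False
    then have "B \<in> set (merge_at i j A (unskip i k) (unskip i l))"
      using merge_superset[of "unskip i k" "unskip i l"] B \<open>l \<noteq> i\<close> by (auto simp: skip_unskip)
    then show ?thesis by blast
  qed
qed

lemma merge_ballot_matrix: "is_ballot_matrix U (m - 1, merge_at i j A)"
proof (rule ballot_matrixI)
  fix k l assume "merge_at i j A k l \<noteq> []"
  then obtain B where "B \<in> set (merge_at i j A k l)" by (meson list.set_sel(1))
  from merge_origin[OF this] show "1 \<le> k \<and> k \<le> l \<and> l \<le> m - 1"
  proof
    assume "B \<in> set (A (skip i k) (skip i l))"
    then have "A (skip i k) (skip i l) \<noteq> []" by auto
    from ballot_matrix_support[OF M this] merge_idx(1,4) show ?thesis
      by (auto simp: skip_def split: if_splits)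
  qed (use merge_idx in auto)
next
  fix k l
  have "hd (A i j) \<in> set (A i j)" by (subst merge_idx(5)) simp
  then have "hd (A i j) \<noteq> {}" "hd (A i j) \<inter> ballot_car (A (Suc i) j) = {}"
    using ballot_matrix_ballot[OF M, of i j] ballot_matrix_unique[OF M, of _ i j "Suc i" j]
    by (auto simp: is_ballot_def)
  then show "is_ballot (merge_at i j A k l)"
    using ballot_matrix_ballot[OF M] by (simp add: merge_at_def)
next
  fix x k l k' l'
  assume "x \<in> ballot_car (merge_at i j A k l)" "x \<in> ballot_car (merge_at i j A k' l')"
  then obtain B B' where B: "B \<in> set (merge_at i j A k l)" "x \<in> B"
    and B': "B' \<in> set (merge_at i j A k' l')" "x \<in> B'" by blast
  have u: "p = p' \<and> q = q'" if "B \<in> set (A p q)" "B' \<in> set (A p' q')" for p q p' q'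
    using ballot_matrix_unique[OF M, of x p q p' q'] that B(2) B'(2) by blast
  from merge_origin[OF B(1)] merge_origin[OF B'(1)] show "k = k' \<and> l = l'"
  proof (elim disjE conjE)
    assume "B \<in> set (A (skip i k) (skip i l))" "B' \<in> set (A (skip i k') (skip i l'))"
    from u[OF this] show ?thesis by simp
  next
    assume "B \<in> set (A (skip i k) (skip i l))" "B' \<in> set (A i j)"
    from u[OF this] show ?thesis by simp
  next
    assume "B \<in> set (A i j)" "B' \<in> set (A (skip i k') (skip i l'))"
    from u[OF this] show ?thesis by simp
  qed simp
next
  have "(\<Union>k. \<Union>l. ballot_car (merge_at i j A k l)) = \<Union>(\<Union>k. \<Union>l. set (merge_at i j A k l))" by blast
  also have "\<dots> = (\<Union>k. \<Union>l. ballot_car (A k l))" unfolding merge_all_blocks by blast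
  finally show "(\<Union>k. \<Union>l. ballot_car (merge_at i j A k l)) = U"
    using ballot_matrix_union[OF M] by simp
next
  fix k assume "k \<in> {1..m - 1}"
  then have "skip i k \<in> {1..m}" by (auto simp: skip_def)
  from ballot_matrix_row[OF M this] obtain l where l: "A (skip i k) l \<noteq> []" ..
  then have "l \<noteq> i" using merge_idx(7) by metis
  then have "merge_at i j A k (unskip i l) \<noteq> []"
    using merge_superset[of k "unskip i l"] l by (auto simp: skip_unskip)
  then show "\<exists>l. merge_at i j A k l \<noteq> []" ..
qed

text \<open>
  The condition that row \<open>i + 1\<close> starts no earlier than row \<open>i\<close> ensures that the moved block is the
  first block of its new row, so that it is the one which splitting removes again.
\<close>

lemma merge_first_col: "first_col (m - 1, merge_at i j A) i = j - 1"
proof (rule first_col_eqI)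
  show "merge_at i j A i (j - 1) \<noteq> []" using merge_idx(2) by (simp add: merge_at_def)
  show "merge_at i j A i l = []" if "l < j - 1" for l
    using that merge_idx(2) merge_idx(8)[of "skip i l"] by (auto simp: merge_at_def skip_def)
qed

text \<open>
  The moved block joins the blocks of the row below, of which there is at least one.
\<close>

lemma merge_splittable: "splittable (m - 1, merge_at i j A) i"
proof -
  note N = merge_ballot_matrix
  have i: "i \<in> {1..m - 1}" using merge_idx by auto
  have ne: "merge_at i j A i (j - 1) \<noteq> []" using merge_idx(2) by (simp add: merge_at_def)
  have "row_blocks (m - 1, merge_at i j A) i \<noteq> 1"
  proof
    assume "row_blocks (m - 1, merge_at i j A) i = 1"
    then have t: "tl (merge_at i j A i (j - 1)) = []"
      and z: "l \<noteq> j - 1 \<Longrightarrow> merge_at i j A i l = []" for l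
      using single_block_iff[OF N ne] by simp_all
    have "A (Suc i) l = []" for l
    proof (cases "l = i \<or> l = j")
      case True
      then show ?thesis using t merge_idx(2,7) by (auto simp: merge_at_def)
    next
      case False
      then have "unskip i l \<noteq> j - 1" using merge_idx(2) by (auto simp: unskip_def)
      from z[OF this] False show ?thesis
        by (simp add: merge_at_def skip_unskip skip_def[of i i] split: if_splits)
    qed
    moreover have "Suc i \<in> {1..m}" using merge_idx by simp
    ultimately show False using ballot_matrix_row[OF M, of "Suc i"] by blast
  qed
  then show ?thesis using splittable_iff[OF N i] by simp
qed

lemma split_merge: "split_at i (j - 1) (merge_at i j A) = A"
proof (intro ext)
  fix k l
  have j: "Suc (j - 1) = j" using merge_idx(2) by simp
  consider "k = i" | "k \<noteq> i" "l = i" | "k = Suc i" "l = j" | "k \<noteq> i" "l \<noteq> i" "\<not> (k = Suc i \<and> l = j)"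
    by blast
  then show "split_at i (j - 1) (merge_at i j A) k l = A k l"
  proof cases
    case 1
    then show ?thesis using merge_idx(5) merge_idx(6)[of l] j by (auto simp: split_at_def merge_at_def)
  next
    case 2
    then show ?thesis using merge_idx(7) by (simp add: split_at_def)
  next
    case 3
    then show ?thesis using j merge_idx(2) by (simp add: split_at_def merge_at_def)
  next
    case 4
    then have "\<not> (unskip i k = i \<and> Suc (unskip i l) = j)"
      using merge_idx(2) by (auto simp: unskip_def split: if_splits)
    with 4 show ?thesis using j by (auto simp: split_at_def merge_at_def skip_unskip)
  qed
qed

end


section \<open>The involution\<close>

definition admits :: "'a bmat \<Rightarrow> nat \<Rightarrow> bool" where
  "admits M i \<longleftrightarrow> splittable M i \<or> mergeable M i"

lemma theta_fixed: "\<not> (\<exists>i. admits M i) \<Longrightarrow> theta M = M"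
  by (simp add: theta_def admits_def)

lemma theta_least:
  assumes "admits M i" "\<And>r. r < i \<Longrightarrow> \<not> admits M r"
  shows "theta M = (if splittable M i then split_row i M else merge_row i M)"
proof -
  have "(LEAST i. admits M i) = i"
    by (rule Least_equality) (use assms in \<open>auto simp: not_less[symmetric]\<close>)
  then show ?thesis using assms(1) unfolding theta_def admits_def by (auto simp: Let_def)
qed

text \<open>
  If \<open>i\<close> is the least row of \<open>M\<close> admitting a move, and this move is a split, then \<open>i\<close> is also the
  least row of the resulting matrix admitting a move, and there the move is the merge back.
\<close>

lemma theta_split:
  assumes M: "is_ballot_matrix U M" and s: "splittable M i" and l: "\<And>r. r < i \<Longrightarrow> \<not> admits M r"
  defines "N \<equiv> split_row i M"
  shows "theta M = N" and "theta N = M" and "is_ballot_matrix U N" and "fst N = Suc (fst M)"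
    and "num_blocks N = num_blocks M" and "mergeable N i" and "\<And>r. r < i \<Longrightarrow> \<not> admits N r"
proof -
  obtain m A where MA: "M = (m, A)" by (cases M)
  let ?j = "first_col (m, A) i"
  note ctx = M[unfolded MA] s[unfolded MA] refl[of ?j]
  note idx = split_idx[OF ctx]
  have N: "N = (Suc m, split_at i ?j A)" unfolding N_def MA by (rule split_row_eq[OF idx(2)])
  show g: "mergeable N i" unfolding N by (rule split_mergeable[OF ctx])
  show bm: "is_ballot_matrix U N" unfolding N by (rule split_ballot_matrix[OF ctx])
  show "fst N = Suc (fst M)" by (simp add: N MA)
  show "num_blocks N = num_blocks M"
    using num_blocks_card[OF M[unfolded MA]] num_blocks_card[OF bm[unfolded N]]
    unfolding N MA split_all_blocks[OF ctx] by simp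
  show no: "\<not> admits N r" if "r < i" for r
    using l[OF that] split_moves_less[OF ctx that] unfolding N MA admits_def by simp
  show "theta M = N" using theta_least[of M i] s l unfolding N_def admits_def by simp
  have "\<not> splittable N i" using g by (simp add: mergeable_def splittable_def)
  then have "theta N = merge_row i N" using theta_least[of N i] g no unfolding admits_def by simp
  also have "merge_row i N = M"
    using merge_row_eq[of i "Suc m" "split_at i ?j A"] idx(2)
    unfolding N MA split_first_col[OF ctx] by (simp add: merge_split[OF ctx])
  finally show "theta N = M" .
qed

text \<open>
  A merge is the inverse of a split at the same least row; this reduces all facts on merges to those
  on splits.
\<close>

lemma theta_merge:
  assumes M: "is_ballot_matrix U M" and g: "mergeable M i" and l: "\<And>r. r < i \<Longrightarrow> \<not> admits M r"
  shows "\<exists>N. is_ballot_matrix U N \<and> splittable N i \<and> (\<forall>r<i. \<not> admits N r) \<and> split_row i N = M"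
proof -
  obtain m A where MA: "M = (m, A)" by (cases M)
  let ?j = "first_col (m, A) i" let ?B = "merge_at i ?j A"
  note ctx = M[unfolded MA] g[unfolded MA] refl[of ?j]
  note idx = merge_idx[OF ctx]
  note bm = merge_ballot_matrix[OF ctx] and s = merge_splittable[OF ctx]
  note fc = merge_first_col[OF ctx]
  have "split_row i (m - 1, ?B) = (Suc (m - 1), split_at i (?j - 1) ?B)"
    using split_row_eq[of i "m - 1" ?B] idx(2) unfolding fc by simp
  also have "\<dots> = M" unfolding split_merge[OF ctx] MA using idx(4) by simp
  finally have sp: "split_row i (m - 1, ?B) = M" .
  have e: "M = (Suc (m - 1), split_at i (?j - 1) ?B)"
    unfolding split_merge[OF ctx] MA using idx(4) by simp
  have "\<not> admits (m - 1, ?B) r" if "r < i" for r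
    using split_moves_less[OF bm s fc[symmetric] that] l[OF that]
    unfolding admits_def e[symmetric] by simp
  then show ?thesis using bm s sp by blast
qed

lemma theta_nonfixed:
  assumes M: "is_ballot_matrix U M" and a: "\<exists>i. admits M i"
  shows "is_ballot_matrix U (theta M)" and "theta (theta M) = M" and "theta M \<noteq> M"
    and "positive_bmat (theta M) \<longleftrightarrow> \<not> positive_bmat M"
proof -
  define i where "i = (LEAST i. admits M i)"
  have ai: "admits M i" unfolding i_def using a by (rule LeastI_ex)
  have l: "\<not> admits M r" if "r < i" for r using that unfolding i_def by (rule not_less_Least)
  have "is_ballot_matrix U (theta M) \<and> theta (theta M) = M \<and> fst (theta M) \<noteq> fst M \<and>
    even (fst (theta M)) = odd (fst M) \<and> num_blocks (theta M) = num_blocks M"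
  proof (cases "splittable M i")
    case True
    from theta_split[OF M this l] show ?thesis by simp
  next
    case False
    then have "mergeable M i" using ai by (simp add: admits_def)
    from theta_merge[OF M this l] obtain N where N: "is_ballot_matrix U N" "splittable N i"
      "\<And>r. r < i \<Longrightarrow> \<not> admits N r" and sp: "split_row i N = M" by blast
    from theta_split[OF N] N(1) show ?thesis unfolding sp by simp
  qed
  then show "is_ballot_matrix U (theta M)" "theta (theta M) = M" "theta M \<noteq> M"
    "positive_bmat (theta M) \<longleftrightarrow> \<not> positive_bmat M" by (auto simp: positive_bmat_def)
qed

lemma theta_eq_iff: "is_ballot_matrix U M \<Longrightarrow> theta M = M \<longleftrightarrow> \<not> (\<exists>i. admits M i)"
  using theta_fixed theta_nonfixed(3) by metis

text \<open>
  A fixed matrix of dimension \<open>m\<close> has one block in each row, hence \<open>m\<close> blocks.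
\<close>

lemma fixed_positive:
  assumes M: "is_ballot_matrix U M" and f: "theta M = M"
  shows "positive_bmat M"
proof -
  obtain m A where MA: "M = (m, A)" by (cases M)
  have "row_blocks M i = 1" if "i \<in> {1..fst M}" for i
  proof -
    have "\<not> splittable M i" using f theta_eq_iff[OF M] by (auto simp: admits_def)
    then show ?thesis using splittable_iff[of U m A i] M that by (simp add: MA)
  qed
  then show ?thesis by (simp add: positive_bmat_def num_blocks_def)
qed

lemma bmat_transport_pair: "bmat_transport \<sigma> (m, A) = (m, \<lambda>i j. ballot_transport \<sigma> (A i j))"
  by (simp add: bmat_transport_def)

lemma first_col_transport [simp]: "first_col (bmat_transport \<sigma> M) i = first_col M i"
  by (simp add: first_col_def bmat_transport_def split: prod.splits)

lemma row_blocks_transport [simp]: "row_blocks (bmat_transport \<sigma> M) i = row_blocks M i"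
  by (simp add: row_blocks_def bmat_transport_def split: prod.splits)

lemma empty_cols_transport [simp]: "empty_cols (bmat_transport \<sigma> M) = empty_cols M"
  by (simp add: empty_cols_def bmat_transport_def split: prod.splits)

lemma splittable_transport [simp]: "splittable (bmat_transport \<sigma> M) i = splittable M i"
  and mergeable_transport [simp]: "mergeable (bmat_transport \<sigma> M) i = mergeable M i"
  by (simp_all add: splittable_def mergeable_def)

lemma admits_transport [simp]: "admits (bmat_transport \<sigma> M) = admits M"
  by (simp add: admits_def fun_eq_iff)

lemma positive_transport [simp]: "positive_bmat (bmat_transport \<sigma> M) = positive_bmat M"
  by (simp add: positive_bmat_def)

lemma split_row_transport:
  assumes "A i (first_col (m, A) i) \<noteq> []"
  shows "split_row i (bmat_transport \<sigma> (m, A)) = bmat_transport \<sigma> (split_row i (m, A))"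
  using assms first_col_transport[of \<sigma> "(m, A)" i]
  by (simp add: split_row_def bmat_transport_pair Let_def set_entry_def insert_row_col_def
      fun_eq_iff hd_map map_tl)

lemma merge_row_transport:
  assumes "A i (first_col (m, A) i) \<noteq> []"
  shows "merge_row i (bmat_transport \<sigma> (m, A)) = bmat_transport \<sigma> (merge_row i (m, A))"
  using assms first_col_transport[of \<sigma> "(m, A)" i]
  by (simp add: merge_row_def bmat_transport_pair Let_def set_entry_def delete_row_col_def
      fun_eq_iff hd_map)

text \<open>
  Moves depend only on the lengths of the ballots, which relabeling preserves.
\<close>

lemma theta_transport:
  assumes M: "is_ballot_matrix U M"
  shows "theta (bmat_transport \<sigma> M) = bmat_transport \<sigma> (theta M)"
proof (cases "\<exists>i. admits M i")
  case False
  then show ?thesis by (simp add: theta_fixed)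
next
  case True
  obtain m A where MA: "M = (m, A)" by (cases M)
  define i where "i = (LEAST i. admits M i)"
  have ai: "admits M i" unfolding i_def using True by (rule LeastI_ex)
  have l: "\<not> admits M r" if "r < i" for r using that unfolding i_def by (rule not_less_Least)
  have "i \<in> {1..m}" using ai by (auto simp: admits_def splittable_def mergeable_def MA)
  note ne = first_col_nonempty[OF M[unfolded MA] this]
  show ?thesis
    using theta_least[OF ai l] theta_least[of "bmat_transport \<sigma> M" i] ai l
      split_row_transport[of A i m, OF ne] merge_row_transport[of A i m, OF ne]
    by (simp add: MA)
qed

lemma species_B_plus_sub: "species_B_plus = species_sub positive_bmat species_B"
  and species_B_minus_sub: "species_B_minus = species_sub (\<lambda>M. \<not> positive_bmat M) species_B"
  and species_B_plus_nonfixed_sub: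
    "species_B_plus_nonfixed = species_sub (\<lambda>M. positive_bmat M \<and> theta M \<noteq> M) species_B"
  and species_Fix_theta_sub: "species_Fix_theta = species_sub (\<lambda>M. theta M = M) species_B"
  by (simp_all add: species_sub_def species_B_def species_B_plus_def species_B_minus_def
      species_B_plus_nonfixed_def species_Fix_theta_def)

lemma invariant_positive: "invariant species_B positive_bmat"
  by (rule invariantI) (simp add: species_B_def)

lemma invariant_fixed: "invariant species_B (\<lambda>M. theta M = M)"
proof (rule invariantI)
  fix U V :: "'a set" and \<sigma> and M :: "'a bmat"
  assume a: "finite U" "bij_betw \<sigma> U V" "M \<in> structs species_B U"
  have "is_ballot_matrix U M" "is_ballot_matrix V (bmat_transport \<sigma> M)"
    using species_transport[OF is_species_B a] a(3) by (simp_all add: species_B_def)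
  then show "(theta (transport species_B U \<sigma> M) = transport species_B U \<sigma> M) = (theta M = M)"
    by (simp add: species_B_def theta_eq_iff)
qed

text \<open>
  The involution reverses signs wherever it moves a matrix, and it moves every negative one.
\<close>

lemma theta_natural_iso: "natural_iso species_B_plus_nonfixed species_B_minus (\<lambda>U. theta)"
proof (rule natural_isoI)
  show "is_species species_B_plus_nonfixed"
    unfolding species_B_plus_nonfixed_sub
    by (rule is_species_sub[OF is_species_B invariant_comp2[OF invariant_positive invariant_fixed]])
  show "is_species species_B_minus"
    unfolding species_B_minus_sub
    by (rule is_species_sub[OF is_species_B invariant_comp[OF invariant_positive]])
  fix U :: "'a set"
  show "bij_betw theta (structs species_B_plus_nonfixed U) (structs species_B_minus U)"
  proof (rule bij_betw_byWitness[where f' = theta])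
    show "\<forall>M\<in>structs species_B_plus_nonfixed U. theta (theta M) = M"
      by (auto simp: species_B_plus_nonfixed_def theta_eq_iff theta_nonfixed(2))
    have a: "\<exists>i. admits M i" if "is_ballot_matrix U M" "\<not> positive_bmat M" for M
      using that fixed_positive theta_eq_iff by blast
    show "\<forall>M\<in>structs species_B_minus U. theta (theta M) = M"
      using a by (auto simp: species_B_minus_def theta_nonfixed(2))
    show "theta ` structs species_B_plus_nonfixed U \<subseteq> structs species_B_minus U"
    proof
      fix N assume "N \<in> theta ` structs species_B_plus_nonfixed U"
      then obtain M where M: "is_ballot_matrix U M" "positive_bmat M" "\<exists>i. admits M i" "N = theta M"
        by (auto simp: species_B_plus_nonfixed_def theta_eq_iff)
      then show "N \<in> structs species_B_minus U"
        using theta_nonfixed[OF M(1,3)] by (simp add: species_B_minus_def)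
    qed
    show "theta ` structs species_B_minus U \<subseteq> structs species_B_plus_nonfixed U"
    proof
      fix N assume "N \<in> theta ` structs species_B_minus U"
      then obtain M where M: "is_ballot_matrix U M" "\<not> positive_bmat M" "N = theta M"
        by (auto simp: species_B_minus_def)
      then show "N \<in> structs species_B_plus_nonfixed U"
        using theta_nonfixed[OF M(1) a[OF M(1,2)]] by (simp add: species_B_plus_nonfixed_def)
    qed
  qed
  fix V \<sigma> and M :: "'a bmat" assume "M \<in> structs species_B_plus_nonfixed U"
  then have "is_ballot_matrix U M" by (simp add: species_B_plus_nonfixed_def)
  from theta_transport[OF this]
  show "theta (transport species_B_plus_nonfixed U \<sigma> M) = transport species_B_minus U \<sigma> (theta M)"
    by (simp add: species_B_plus_nonfixed_def species_B_minus_def)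
qed


section \<open>The interval order of a ballot matrix\<close>

lemma
  assumes M: "is_ballot_matrix U (m, A)" and x: "x \<in> ballot_car (A i j)"
  shows row_of_eq: "row_of (m, A) x = i" and col_of_eq: "col_of (m, A) x = j"
  unfolding row_of_def col_of_def prod.case
  by (rule the_equality; use x ballot_matrix_unique[OF M x] in blast)+

lemma
  assumes M: "is_ballot_matrix U (m, A)" and x: "x \<in> U"
  shows in_entry: "x \<in> ballot_car (A (row_of (m, A) x) (col_of (m, A) x))"
    and row_of_ge: "1 \<le> row_of (m, A) x" and row_of_le: "row_of (m, A) x \<le> col_of (m, A) x"
    and col_of_le: "col_of (m, A) x \<le> m"
proof -
  obtain i j where ij: "x \<in> ballot_car (A i j)" using x ballot_matrix_union[OF M] by blast
  then have e: "row_of (m, A) x = i" "col_of (m, A) x = j" using row_of_eq[OF M] col_of_eq[OF M] by auto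
  show "x \<in> ballot_car (A (row_of (m, A) x) (col_of (m, A) x))" using ij e by simp
  have "A i j \<noteq> []" using ij by auto
  from ballot_matrix_support[OF M this] e
  show "1 \<le> row_of (m, A) x" "row_of (m, A) x \<le> col_of (m, A) x" "col_of (m, A) x \<le> m"
    by simp_all
qed

text \<open>
  The element \<open>x\<close> is represented by the interval from \<open>row x\<close> to \<open>col x\<close>. In an induced \<open>2 + 2\<close> with
  \<open>a < b\<close> and \<open>c < d\<close>, the incomparabilities give
  \<open>col a < row b \<le> col c < row d \<le> col a\<close>, a contradiction.
\<close>

lemma bmat_order_interval_order:
  assumes M: "is_ballot_matrix U M" shows "interval_order_on U (bmat_order U M)"
proof -
  have le: "row_of M x \<le> col_of M x" if "x \<in> U" for x
    using row_of_le[of U "fst M" "snd M" x] M that by simp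
  show ?thesis
    unfolding interval_order_on_def
  proof (intro conjI notI)
    show "bmat_order U M \<subseteq> U \<times> U" by (auto simp: bmat_order_def)
    show "irrefl (bmat_order U M)" using le by (force simp: irrefl_def bmat_order_def)
    show "trans (bmat_order U M)"
    proof (rule transI)
      fix x y z assume "(x, y) \<in> bmat_order U M" "(y, z) \<in> bmat_order U M"
      then show "(x, z) \<in> bmat_order U M" using le[of y] by (auto simp: bmat_order_def)
    qed
    assume "\<exists>a\<in>U. \<exists>b\<in>U. \<exists>c\<in>U. \<exists>d\<in>U. distinct [a, b, c, d] \<and>
      bmat_order U M \<inter> ({a, b, c, d} \<times> {a, b, c, d}) = {(a, b), (c, d)}"
    then obtain a b c d where abcd: "a \<in> U" "b \<in> U" "c \<in> U" "d \<in> U" "distinct [a, b, c, d]"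
      and e: "bmat_order U M \<inter> ({a, b, c, d} \<times> {a, b, c, d}) = {(a, b), (c, d)}" by blast
    have "(a, b) \<in> bmat_order U M" "(c, d) \<in> bmat_order U M" using e by blast+
    moreover have "(a, d) \<notin> bmat_order U M"
    proof
      assume "(a, d) \<in> bmat_order U M"
      then have "(a, d) \<in> {(a, b), (c, d)}" unfolding e[symmetric] by simp
      then show False using abcd(5) by auto
    qed
    moreover have "(c, b) \<notin> bmat_order U M"
    proof
      assume "(c, b) \<in> bmat_order U M"
      then have "(c, b) \<in> {(a, b), (c, d)}" unfolding e[symmetric] by simp
      then show False using abcd(5) by auto
    qed
    ultimately show False by (auto simp: bmat_order_def)
  qed
qed

lemma bmat_order_transport:
  assumes M: "is_ballot_matrix U M" and N: "is_ballot_matrix V (bmat_transport \<sigma> M)"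
    and \<sigma>: "bij_betw \<sigma> U V"
  shows "bmat_order V (bmat_transport \<sigma> M) = map_prod \<sigma> \<sigma> ` bmat_order U M"
proof -
  obtain m A where MA: "M = (m, A)" by (cases M)
  have e: "row_of (bmat_transport \<sigma> M) (\<sigma> x) = row_of M x \<and> col_of (bmat_transport \<sigma> M) (\<sigma> x) = col_of M x"
    if "x \<in> U" for x
  proof -
    have "\<sigma> x \<in> ballot_car (ballot_transport \<sigma> (A (row_of M x) (col_of M x)))"
      using in_entry[OF M[unfolded MA] that] unfolding MA by auto
    then show ?thesis
      using row_of_eq[OF N[unfolded MA bmat_transport_pair]] col_of_eq[OF N[unfolded MA bmat_transport_pair]]
      unfolding MA bmat_transport_pair by blast
  qed
  have V: "V = \<sigma> ` U" using \<sigma> by (simp add: bij_betw_def)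
  show ?thesis
  proof (intro equalityI subsetI)
    fix p assume "p \<in> bmat_order V (bmat_transport \<sigma> M)"
    then obtain x y where "x \<in> U" "y \<in> U" "p = (\<sigma> x, \<sigma> y)"
      "col_of (bmat_transport \<sigma> M) (\<sigma> x) < row_of (bmat_transport \<sigma> M) (\<sigma> y)"
      unfolding bmat_order_def V by blast
    then have "(x, y) \<in> bmat_order U M" "p = map_prod \<sigma> \<sigma> (x, y)" using e by (auto simp: bmat_order_def)
    then show "p \<in> map_prod \<sigma> \<sigma> ` bmat_order U M" by blast
  qed (use e V in \<open>auto simp: bmat_order_def\<close>)
qed


section \<open>The canonical matrix of an interval order\<close>

text \<open>
  The key compares the down-sets first and the up-sets second, by their sizes: it is the pair of sizes
  in base \<open>card U + 1\<close>, which exceeds the size of any up-set. The rows of the canonical matrix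
  are the classes of elements with equal keys, in the order of the keys; the row index is the
  rank of the key.
\<close>

definition order_key :: "'a set \<Rightarrow> ('a \<times> 'a) set \<Rightarrow> 'a \<Rightarrow> nat" where
  "order_key U R x = card (R\<inverse> `` {x}) * Suc (card U) + card (R `` {x})"

definition order_row :: "'a set \<Rightarrow> ('a \<times> 'a) set \<Rightarrow> 'a \<Rightarrow> nat" where
  "order_row U R x = card (order_key U R ` {y \<in> U. order_key U R y \<le> order_key U R x})"

text \<open>
  The elements not above \<open>x\<close> fill an initial segment of the rows, and \<open>x\<close> is put into the column where
  this segment ends. Thus \<open>y\<close> is above \<open>x\<close> iff its row lies beyond the column of \<open>x\<close>.
\<close>

definition order_col :: "'a set \<Rightarrow> ('a \<times> 'a) set \<Rightarrow> 'a \<Rightarrow> nat" where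
  "order_col U R x = card (order_key U R ` {y \<in> U. (x, y) \<notin> R})"

definition one_block_matrix :: "'a set \<Rightarrow> ('a \<Rightarrow> nat) \<Rightarrow> ('a \<Rightarrow> nat) \<Rightarrow> nat \<Rightarrow> nat \<Rightarrow> 'a ballot" where
  "one_block_matrix U r c i j =
     (let B = {x \<in> U. r x = i \<and> c x = j} in if B = {} then [] else [B])"

definition order_matrix :: "'a set \<Rightarrow> ('a \<times> 'a) set \<Rightarrow> 'a bmat" where
  "order_matrix U R =
     (card (order_key U R ` U), one_block_matrix U (order_row U R) (order_col U R))"

lemma card_image_eq:
  assumes "\<And>x y. x \<in> S \<Longrightarrow> y \<in> S \<Longrightarrow> f x = f y \<longleftrightarrow> g x = g y"
  shows "card (f ` S) = card (g ` S)"
proof -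
  have "bij_betw (g \<circ> inv_into S f) (f ` S) (g ` S)"
  proof (rule bij_betw_imageI)
    have 1: "g (inv_into S f (f x)) = g x" if "x \<in> S" for x
      using assms[of "inv_into S f (f x)" x] that by (simp add: inv_into_into f_inv_into_f)
    show "inj_on (g \<circ> inv_into S f) (f ` S)" using assms by (auto simp: inj_on_def 1)
    show "(g \<circ> inv_into S f) ` f ` S = g ` S" by (simp add: image_image 1)
  qed
  then show ?thesis by (rule bij_betw_same_card)
qed

lemma order_key_less:
  assumes U: "finite U" and R: "R \<subseteq> U \<times> U"
    and D: "R\<inverse> `` {x} \<subset> R\<inverse> `` {y} \<or> R\<inverse> `` {x} = R\<inverse> `` {y} \<and> R `` {x} \<subset> R `` {y}"
  shows "order_key U R x < order_key U R y"
proof -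
  have f: "finite (R\<inverse> `` {z})" "finite (R `` {z})" for z
    using R by (auto intro: finite_subset[OF _ U])
  have u: "card (R `` {z}) \<le> card U" for z using R by (intro card_mono[OF U]) auto
  from D show ?thesis
  proof
    assume "R\<inverse> `` {x} \<subset> R\<inverse> `` {y}"
    then have "Suc (card (R\<inverse> `` {x})) \<le> card (R\<inverse> `` {y})" using psubset_card_mono[OF f(1)] Suc_leI by blast
    then have "Suc (card (R\<inverse> `` {x})) * Suc (card U) \<le> card (R\<inverse> `` {y}) * Suc (card U)"
      by (rule mult_le_mono1)
    then show ?thesis using u[of x] by (simp add: order_key_def)
  next
    assume "R\<inverse> `` {x} = R\<inverse> `` {y} \<and> R `` {x} \<subset> R `` {y}"
    then show ?thesis using psubset_card_mono[OF f(2), of "R `` {x}" y] by (simp add: order_key_def)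
  qed
qed


section \<open>Fixed matrices are determined by their order\<close>

context
  fixes U :: "'a set" and m :: nat and A :: "nat \<Rightarrow> nat \<Rightarrow> 'a ballot"
  assumes M: "is_ballot_matrix U (m, A)" and f: "theta (m, A) = (m, A)" and U: "finite U"
begin

private abbreviation "mrow \<equiv> row_of (m, A)"
private abbreviation "mcol \<equiv> col_of (m, A)"
private abbreviation "mord \<equiv> bmat_order U (m, A)"
private abbreviation "mkey \<equiv> order_key U mord"

lemma fixed_no_move: "\<not> splittable (m, A) i" "\<not> mergeable (m, A) i"
  using f theta_eq_iff[OF M] by (auto simp: admits_def)

lemma fixed_row_blocks: "i \<in> {1..m} \<Longrightarrow> row_blocks (m, A) i = 1"
  using splittable_iff[OF M] fixed_no_move(1) by blast

text \<open>
  A matrix with one block per row is determined by the positions of the elements.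
\<close>

lemma fixed_entry: "A i j = one_block_matrix U mrow mcol i j"
proof (cases "A i j = []")
  case True
  then have "{x \<in> U. mrow x = i \<and> mcol x = j} = {}" using in_entry[OF M] by fastforce
  then show ?thesis using True by (simp add: one_block_matrix_def)
next
  case False
  then have "i \<in> {1..m}" using ballot_matrix_support[OF M False] by simp
  then have "tl (A i j) = []" using single_block_iff[OF M False] fixed_row_blocks by simp
  then obtain B where B: "A i j = [B]" using False by (cases "A i j") auto
  have "B = {x \<in> U. mrow x = i \<and> mcol x = j}"
  proof (intro equalityI subsetI)
    fix x assume "x \<in> B"
    then have x: "x \<in> ballot_car (A i j)" using B by simp
    then show "x \<in> {x \<in> U. mrow x = i \<and> mcol x = j}"
      using row_of_eq[OF M x] col_of_eq[OF M x] ballot_matrix_union[OF M] by blast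
  next
    fix x assume "x \<in> {x \<in> U. mrow x = i \<and> mcol x = j}"
    then show "x \<in> B" using in_entry[OF M, of x] B by auto
  qed
  moreover have "B \<noteq> {}" using ballot_matrix_ballot[OF M, of i j] B by simp
  ultimately show ?thesis using B by (simp add: one_block_matrix_def Let_def)
qed

lemma fixed_col: "x \<in> U \<Longrightarrow> mcol x = first_col (m, A) (mrow x)"
proof -
  assume x: "x \<in> U"
  have i: "mrow x \<in> {1..m}" using row_of_ge[OF M x] row_of_le[OF M x] col_of_le[OF M x] by simp
  have "A (mrow x) (mcol x) \<noteq> []" using in_entry[OF M x] by auto
  then show ?thesis
    using single_block_iff[OF M first_col_nonempty[OF M i]] fixed_row_blocks[OF i] by blast
qed

lemma fixed_row_exists:
  assumes "i \<in> {1..m}" shows "\<exists>x\<in>U. mrow x = i"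
proof -
  obtain j where "A i j \<noteq> []" using ballot_matrix_row[OF M assms] ..
  then have "ballot_car (A i j) \<noteq> {}" using ballot_car_eq_empty[OF ballot_matrix_ballot[OF M]] by simp
  then obtain x where x: "x \<in> ballot_car (A i j)" by blast
  then show ?thesis using row_of_eq[OF M x] ballot_matrix_union[OF M] by blast
qed

lemma fixed_row_image: "k \<le> m \<Longrightarrow> mrow ` {y \<in> U. mrow y \<le> k} = {1..k}"
proof (intro equalityI subsetI)
  fix i assume k: "k \<le> m" and "i \<in> {1..k}"
  then obtain x where "x \<in> U" "mrow x = i" using fixed_row_exists[of i] by auto
  then show "i \<in> mrow ` {y \<in> U. mrow y \<le> k}" using \<open>i \<in> {1..k}\<close> by auto
qed (use row_of_ge[OF M] in auto)

text \<open>
  The heart of the reconstruction: from a fixed matrix, the order recovers the order of the rows.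
  Later rows have larger down-sets. If the down-sets of \<open>x\<close> and \<open>y\<close> are equal, then all columns from
  \<open>row x\<close> to \<open>row y - 1\<close> are empty, since an element in such a column would be below \<open>y\<close> but not
  below \<open>x\<close>. As none of these rows is mergeable, the first nonempty columns decrease strictly from
  \<open>row x\<close> to \<open>row y\<close>; so \<open>y\<close> ends before \<open>x\<close>, and its up-set is strictly larger.
\<close>

lemma fixed_key_less:
  assumes x: "x \<in> U" and y: "y \<in> U" and xy: "mrow x < mrow y"
  shows "mkey x < mkey y"
proof (rule order_key_less[OF U])
  show "mord \<subseteq> U \<times> U" by (auto simp: bmat_order_def)
  have D: "mord\<inverse> `` {z} = {w \<in> U. mcol w < mrow z}" and Up: "mord `` {z} = {w \<in> U. mcol z < mrow w}"
    if "z \<in> U" for z using that by (auto simp: bmat_order_def)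
  have sub: "mord\<inverse> `` {x} \<subseteq> mord\<inverse> `` {y}" using xy by (auto simp: D x y)
  have "mord `` {x} \<subset> mord `` {y}" if eq: "mord\<inverse> `` {x} = mord\<inverse> `` {y}"
  proof -
    have xr: "1 \<le> mrow x" "mcol x \<le> m" and yr: "mrow y \<le> m"
      using row_of_ge[OF M x] row_of_le[OF M y] col_of_le[OF M x] col_of_le[OF M y] by simp_all
    have desc: "first_col (m, A) (Suc k) < first_col (m, A) k" if k: "mrow x \<le> k" "k < mrow y" for k
    proof -
      have "A i k = []" for i
      proof (rule ccontr)
        assume "A i k \<noteq> []"
        then have "ballot_car (A i k) \<noteq> {}"
          using ballot_car_eq_empty[OF ballot_matrix_ballot[OF M]] by simp
        then obtain z where z: "z \<in> ballot_car (A i k)" by blast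
        then have "z \<in> U" "mcol z = k" using col_of_eq[OF M z] ballot_matrix_union[OF M] by blast+
        then have "z \<in> mord\<inverse> `` {y}" "z \<notin> mord\<inverse> `` {x}" using k by (auto simp: D x y)
        then show False using eq by simp
      qed
      then have "k \<in> empty_cols (m, A)" using k xr yr by (auto simp: empty_cols_def)
      moreover have "row_blocks (m, A) k = 1" using fixed_row_blocks[of k] k xr yr by simp
      ultimately show ?thesis
        using fixed_no_move(2)[of k] k xr yr by (auto simp: mergeable_def)
    qed
    have "first_col (m, A) k < first_col (m, A) (mrow x)" if "Suc (mrow x) \<le> k" "k \<le> mrow y" for k
      using that
    proof (induction k rule: dec_induct)
      case base
      then show ?case using desc[of "mrow x"] by simp
    next
      case (step k)
      then show ?case using desc[of k] by simp
    qed
    from this[of "mrow y"] have lt: "mcol y < mcol x" using xy by (simp add: fixed_col x y)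
    \<comment> \<open>The element in row \<open>col x\<close> separates the up-sets: it starts after \<open>y\<close> ends, but not after \<open>x\<close> ends.\<close>
    have "mcol x \<in> {1..m}" using xr row_of_le[OF M x] by simp
    then obtain z where z: "z \<in> U" "mrow z = mcol x" using fixed_row_exists by blast
    then have "z \<in> mord `` {y}" "z \<notin> mord `` {x}" using lt by (auto simp: Up x y)
    moreover have "mord `` {x} \<subseteq> mord `` {y}" using lt by (auto simp: Up x y)
    ultimately show ?thesis by blast
  qed
  with sub show "mord\<inverse> `` {x} \<subset> mord\<inverse> `` {y} \<or> mord\<inverse> `` {x} = mord\<inverse> `` {y} \<and> mord `` {x} \<subset> mord `` {y}"
    by blast
qed

lemma fixed_key_le_iff:
  assumes x: "x \<in> U" and y: "y \<in> U" shows "mkey x \<le> mkey y \<longleftrightarrow> mrow x \<le> mrow y"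
proof -
  have "mkey x = mkey y" if e: "mrow x = mrow y"
  proof -
    have "mcol x = mcol y" using e by (simp add: fixed_col x y)
    with e have "mord\<inverse> `` {x} = mord\<inverse> `` {y}" "mord `` {x} = mord `` {y}" using x y by (auto simp: bmat_order_def)
    then show ?thesis by (simp add: order_key_def)
  qed
  then show ?thesis
    using fixed_key_less[OF x y] fixed_key_less[OF y x] by (metis leD le_less_linear le_neq_implies_less order_refl less_imp_le)
qed

lemma fixed_key_eq_iff: "x \<in> U \<Longrightarrow> y \<in> U \<Longrightarrow> mkey x = mkey y \<longleftrightarrow> mrow x = mrow y"
  using fixed_key_le_iff by (metis order_antisym order_refl)

text \<open>
  Since keys and rows are ordered alike, the rank of a key is the row index. Likewise the elements
  not above \<open>x\<close> are those in the rows up to \<open>col x\<close>, and counting their keys gives \<open>col x\<close>.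
\<close>

lemma order_matrix_bmat_order: "order_matrix U mord = (m, A)"
proof -
  have card: "card (mkey ` S) = card (mrow ` S)" if "S \<subseteq> U" for S
    by (rule card_image_eq) (use fixed_key_eq_iff that in blast)
  have row: "order_row U mord x = mrow x" if x: "x \<in> U" for x
  proof -
    have "{y \<in> U. mkey y \<le> mkey x} = {y \<in> U. mrow y \<le> mrow x}" using fixed_key_le_iff x by blast
    then have "order_row U mord x = card (mrow ` {y \<in> U. mrow y \<le> mrow x})"
      unfolding order_row_def by (simp add: card)
    then show ?thesis
      using fixed_row_image[of "mrow x"] row_of_le[OF M x] col_of_le[OF M x] by simp
  qed
  have col: "order_col U mord x = mcol x" if x: "x \<in> U" for x
  proof -
    have "{y \<in> U. (x, y) \<notin> mord} = {y \<in> U. mrow y \<le> mcol x}" using x by (auto simp: bmat_order_def)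
    then have "order_col U mord x = card (mrow ` {y \<in> U. mrow y \<le> mcol x})"
      unfolding order_col_def by (simp add: card)
    then show ?thesis using fixed_row_image[of "mcol x"] col_of_le[OF M x] by simp
  qed
  have "mrow ` U = {1..m}"
  proof -
    have "{y \<in> U. mrow y \<le> m} = U" using row_of_le[OF M] col_of_le[OF M] le_trans by blast
    then show ?thesis using fixed_row_image[of m] by simp
  qed
  then have "card (mkey ` U) = m" by (simp add: card)
  moreover have "one_block_matrix U (order_row U mord) (order_col U mord) = A"
  proof (intro ext)
    fix i j
    have "{x \<in> U. order_row U mord x = i \<and> order_col U mord x = j} = {x \<in> U. mrow x = i \<and> mcol x = j}"
      using row col by auto
    then have "one_block_matrix U (order_row U mord) (order_col U mord) i j = one_block_matrix U mrow mcol i j"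
      unfolding one_block_matrix_def by (simp only:)
    also have "\<dots> = A i j" by (rule fixed_entry[symmetric])
    finally show "one_block_matrix U (order_row U mord) (order_col U mord) i j = A i j" .
  qed
  ultimately show ?thesis by (simp add: order_matrix_def)
qed

end


section \<open>Every interval order comes from a fixed matrix\<close>

context
  fixes U :: "'a set" and R :: "('a \<times> 'a) set"
  assumes io: "interval_order_on U R" and U: "finite U"
begin

private abbreviation "D x \<equiv> R\<inverse> `` {x}"
private abbreviation "Up x \<equiv> R `` {x}"
private abbreviation "key \<equiv> order_key U R"
private abbreviation "r \<equiv> order_row U R"
private abbreviation "c \<equiv> order_col U R"
private abbreviation "m \<equiv> card (key ` U)"
private abbreviation "A \<equiv> one_block_matrix U r c"

lemma order_field: "R \<subseteq> U \<times> U" and order_irrefl: "(x, x) \<notin> R"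
  and order_trans: "(x, y) \<in> R \<Longrightarrow> (y, z) \<in> R \<Longrightarrow> (x, z) \<in> R"
  using io by (auto simp: interval_order_on_def irrefl_def dest: transD)

text \<open>
  Elements \<open>a\<close>, \<open>b\<close> below exactly one of \<open>x\<close>, \<open>y\<close> each, but not the same one, would form a
  \<open>2 + 2\<close> with \<open>x\<close> and \<open>y\<close>.
\<close>

lemma down_sets_chain: "D x \<subseteq> D y \<or> D y \<subseteq> D x"
proof (rule ccontr)
  assume "\<not> ?thesis"
  then obtain a b where ab: "(a, x) \<in> R" "(a, y) \<notin> R" "(b, y) \<in> R" "(b, x) \<notin> R" by blast
  have "a \<in> U" "x \<in> U" "b \<in> U" "y \<in> U" using ab order_field by auto
  moreover have "distinct [a, x, b, y]" using ab order_irrefl order_trans by auto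
  moreover have "R \<inter> ({a, x, b, y} \<times> {a, x, b, y}) = {(a, x), (b, y)}"
  proof -
    have "(a, b) \<notin> R" "(x, a) \<notin> R" "(x, y) \<notin> R" "(b, a) \<notin> R" "(y, x) \<notin> R" "(y, b) \<notin> R"
      using ab order_irrefl order_trans by blast+
    moreover from this have "(x, b) \<notin> R" "(y, a) \<notin> R" using ab order_trans by blast+
    ultimately show ?thesis using ab order_irrefl by auto
  qed
  ultimately show False using io unfolding interval_order_on_def by blast
qed

lemma up_sets_chain: "Up x \<subseteq> Up y \<or> Up y \<subseteq> Up x"
proof (rule ccontr)
  assume "\<not> ?thesis"
  then obtain a b where "(x, a) \<in> R" "(y, a) \<notin> R" "(y, b) \<in> R" "(x, b) \<notin> R" by blast
  then show False using down_sets_chain[of a b] by blast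
qed

text \<open>
  Because down-sets and up-sets form chains, comparing their sizes is the same as comparing the sets.
\<close>

lemma key_le_down: "key x \<le> key y \<Longrightarrow> D x \<subseteq> D y"
  using down_sets_chain[of x y] order_key_less[OF U order_field, of y x] by (meson leD subset_not_subset_eq)

lemma key_less_up:
  assumes "key x < key y" "D x = D y" shows "Up x \<subset> Up y"
proof (rule ccontr)
  assume "\<not> ?thesis"
  then have "Up y \<subset> Up x \<or> Up y = Up x" using up_sets_chain[of x y] by blast
  then have "key y \<le> key x"
  proof
    assume "Up y \<subset> Up x"
    then show ?thesis using order_key_less[OF U order_field, of y x] assms(2) by simp
  qed (use assms(2) in \<open>simp add: order_key_def\<close>)
  with assms(1) show False by simp
qed

lemma key_eqD:
  assumes "key x = key y" shows "D x = D y" and "Up x = Up y"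
proof -
  show D: "D x = D y" using key_le_down[of x y] key_le_down[of y x] assms by auto
  show "Up x = Up y"
    using up_sets_chain[of x y] order_key_less[OF U order_field, of x y]
      order_key_less[OF U order_field, of y x] D assms by (metis less_irrefl psubsetI)
qed

lemma order_row_less: "y \<in> U \<Longrightarrow> key x < key y \<Longrightarrow> r x < r y"
proof -
  assume y: "y \<in> U" and xy: "key x < key y"
  have "key y \<in> key ` {z \<in> U. key z \<le> key y}" using y by simp
  moreover have "key y \<notin> key ` {z \<in> U. key z \<le> key x}" using xy by auto
  moreover have "key ` {z \<in> U. key z \<le> key x} \<subseteq> key ` {z \<in> U. key z \<le> key y}" using xy by auto
  ultimately have "key ` {z \<in> U. key z \<le> key x} \<subset> key ` {z \<in> U. key z \<le> key y}" by blast
  then show "r x < r y" unfolding order_row_def using U by (intro psubset_card_mono) auto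
qed

lemma order_row_le_iff:
  assumes "x \<in> U" "y \<in> U" shows "r x \<le> r y \<longleftrightarrow> key x \<le> key y"
proof -
  have "key x = key y \<Longrightarrow> r x = r y" by (simp add: order_row_def)
  then show ?thesis
    using order_row_less[of y x] order_row_less[of x y] assms
    by (metis leD le_less_linear le_neq_implies_less order_refl less_imp_le)
qed

lemma order_row_eq_iff: "x \<in> U \<Longrightarrow> y \<in> U \<Longrightarrow> r x = r y \<longleftrightarrow> key x = key y"
  using order_row_le_iff by (metis order_antisym order_refl)

lemma order_row_image: "r ` U = {1..m}"
proof (rule card_subset_eq)
  show "r ` U \<subseteq> {1..m}"
  proof (rule image_subsetI)
    fix x assume x: "x \<in> U"
    have "key ` {y \<in> U. key y \<le> key x} \<noteq> {}" using x by auto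
    then have "r x > 0" unfolding order_row_def using U by (simp add: card_gt_0_iff)
    moreover have "r x \<le> m" unfolding order_row_def using U by (intro card_mono) auto
    ultimately show "r x \<in> {1..m}" by simp
  qed
  show "card (r ` U) = card {1..m}" using card_image_eq[of U r key] order_row_eq_iff by simp
qed simp

text \<open>
  As down-sets grow with the key, everything with a larger key than an element above \<open>x\<close> is itself
  above \<open>x\<close>. So the keys of the elements not above \<open>x\<close> are an initial segment, whose size \<open>col x\<close> is
  compared with the rank \<open>row y\<close>.
\<close>

lemma order_iff:
  assumes x: "x \<in> U" and y: "y \<in> U" shows "(x, y) \<in> R \<longleftrightarrow> c x < r y"
proof
  assume xy: "(x, y) \<in> R"
  have "key z < key y" if z: "z \<in> U" "(x, z) \<notin> R" for z
  proof (rule ccontr)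
    assume "\<not> key z < key y"
    then have "D y \<subseteq> D z" using key_le_down by simp
    then show False using xy z(2) by blast
  qed
  then have "key ` {z \<in> U. (x, z) \<notin> R} \<subset> key ` {z \<in> U. key z \<le> key y}"
    using y by (auto simp: psubset_eq set_eq_iff image_iff) (metis less_imp_le, metis less_irrefl order_refl)
  then show "c x < r y" unfolding order_row_def order_col_def using U by (intro psubset_card_mono) auto
next
  assume lt: "c x < r y"
  show "(x, y) \<in> R"
  proof (rule ccontr)
    assume xy: "(x, y) \<notin> R"
    have "(x, z) \<notin> R" if "key z \<le> key y" for z using key_le_down[OF that] xy by blast
    then have "key ` {z \<in> U. key z \<le> key y} \<subseteq> key ` {z \<in> U. (x, z) \<notin> R}" by blast
    then have "r y \<le> c x" unfolding order_row_def order_col_def using U by (intro card_mono) auto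
    with lt show False by simp
  qed
qed

lemma one_block_car: "ballot_car (A i j) = {x \<in> U. r x = i \<and> c x = j}"
  by (simp add: one_block_matrix_def Let_def)

lemma one_block_nonempty_iff: "A i j \<noteq> [] \<longleftrightarrow> (\<exists>x\<in>U. r x = i \<and> c x = j)"
  by (auto simp: one_block_matrix_def Let_def)

lemma order_ballot_matrix: "is_ballot_matrix U (m, A)"
proof (rule ballot_matrixI)
  fix i j assume "A i j \<noteq> []"
  then obtain x where x: "x \<in> U" "r x = i" "c x = j" unfolding one_block_nonempty_iff by blast
  have "\<not> c x < r x" using order_iff[OF x(1,1)] order_irrefl by simp
  moreover have "c x \<le> m" unfolding order_col_def using U by (intro card_mono) auto
  moreover have "r x \<in> {1..m}" using order_row_image x(1) by blast
  ultimately show "1 \<le> i \<and> i \<le> j \<and> j \<le> m" using x by simp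
next
  show "is_ballot (A i j)" for i j by (simp add: one_block_matrix_def Let_def)
next
  fix i assume "i \<in> {1..m}"
  then have "i \<in> r ` U" by (simp add: order_row_image)
  then show "\<exists>j. A i j \<noteq> []" unfolding one_block_nonempty_iff by blast
qed (auto simp: one_block_car)

lemma order_matrix_row_col:
  assumes "x \<in> U" shows "row_of (m, A) x = r x" and "col_of (m, A) x = c x"
  using row_of_eq[OF order_ballot_matrix, of x "r x" "c x"]
    col_of_eq[OF order_ballot_matrix, of x "r x" "c x"] assms by (simp_all add: one_block_car)

lemma bmat_order_order_matrix: "bmat_order U (m, A) = R"
  using order_matrix_row_col order_iff order_field by (auto simp: bmat_order_def)

lemma order_col_cong: "x \<in> U \<Longrightarrow> y \<in> U \<Longrightarrow> r x = r y \<Longrightarrow> c x = c y"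
proof -
  assume "x \<in> U" "y \<in> U" "r x = r y"
  then have "Up x = Up y" using key_eqD(2)[of x y] order_row_eq_iff[of x y] by simp
  then have "(x, z) \<in> R \<longleftrightarrow> (y, z) \<in> R" for z by blast
  then show "c x = c y" by (simp add: order_col_def)
qed

lemma order_first_col: "x \<in> U \<Longrightarrow> first_col (m, A) (r x) = c x"
  by (rule first_col_eqI) (use one_block_nonempty_iff order_col_cong in \<open>blast, metis less_irrefl\<close>)

text \<open>
  Each row has one block, so no row can be split. If row \<open>i\<close> could be merged, its column being empty,
  then no element would lie below row \<open>i + 1\<close> but not below row \<open>i\<close>; the two rows would have the same
  down-set, hence the later one the larger up-set, and its block would be in an earlier column,
  against the condition for merging.
\<close>

lemma order_matrix_fixed: "theta (m, A) = (m, A)"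
proof -
  have "\<not> splittable (m, A) i" for i
  proof
    assume s: "splittable (m, A) i"
    then have i: "i \<in> {1..m}" by (simp add: splittable_def)
    then obtain x where x: "x \<in> U" "r x = i" using order_row_image by (metis imageE)
    have "A i (c x) \<noteq> []" using x one_block_nonempty_iff by blast
    moreover have "A i l = []" if "l \<noteq> c x" for l
      using x order_col_cong that one_block_nonempty_iff by metis
    moreover have "tl (A i l) = []" for l by (simp add: one_block_matrix_def Let_def)
    ultimately have "row_blocks (m, A) i = 1" using single_block_iff[OF order_ballot_matrix] by blast
    then show False using s by (simp add: splittable_def)
  qed
  moreover have "\<not> mergeable (m, A) i" for i
  proof
    assume g: "mergeable (m, A) i"
    then have i: "i \<in> {1..m}" "Suc i \<in> {1..m}" by (auto simp: mergeable_def)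
    then obtain x y where x: "x \<in> U" "r x = i" and y: "y \<in> U" "r y = Suc i"
      using order_row_image by (metis imageE)
    have key: "key x < key y" using order_row_le_iff[OF y(1) x(1)] x y by simp
    have "z \<in> D x" if z: "z \<in> D y" for z
    proof -
      have "z \<in> U" using z order_field by blast
      moreover have "A i' i = []" for i' using g by (simp add: mergeable_def empty_cols_def)
      ultimately have "c z \<noteq> i" using one_block_nonempty_iff by blast
      moreover have "c z < Suc i" using order_iff[OF \<open>z \<in> U\<close> y(1)] z y(2) by simp
      ultimately show ?thesis using order_iff[OF \<open>z \<in> U\<close> x(1)] x(2) by simp
    qed
    then have "D x = D y" using key_le_down[of x y] key by auto
    then have "Up x \<subset> Up y" by (rule key_less_up[OF key])
    then obtain w where w: "(y, w) \<in> R" "(x, w) \<notin> R" by blast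
    then have "w \<in> U" using order_field by blast
    then have "c y < c x" using order_iff[OF y(1), of w] order_iff[OF x(1), of w] w by simp
    moreover have "c x \<le> c y"
      using g order_first_col[OF x(1)] order_first_col[OF y(1)] x y by (simp add: mergeable_def)
    ultimately show False by simp
  qed
  ultimately show ?thesis by (intro theta_fixed) (auto simp: admits_def)
qed

end

lemma bmat_order_natural_iso: "natural_iso species_Fix_theta species_I bmat_order"
proof -
  have F: "is_species species_Fix_theta"
    unfolding species_Fix_theta_sub by (rule is_species_sub[OF is_species_B invariant_fixed])
  have b: "bij_betw (bmat_order U) (structs species_Fix_theta U) (structs species_I U)"
    if U: "finite U" for U :: "'a set"
  proof (rule bij_betw_byWitness[where f' = "order_matrix U"])
    show "\<forall>M\<in>structs species_Fix_theta U. order_matrix U (bmat_order U M) = M"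
      using order_matrix_bmat_order U by (auto simp: species_Fix_theta_def)
    show "\<forall>R\<in>structs species_I U. bmat_order U (order_matrix U R) = R"
      using bmat_order_order_matrix U by (auto simp: species_I_def order_matrix_def)
    show "bmat_order U ` structs species_Fix_theta U \<subseteq> structs species_I U"
      using bmat_order_interval_order by (auto simp: species_Fix_theta_def species_I_def)
    show "order_matrix U ` structs species_I U \<subseteq> structs species_Fix_theta U"
      using order_ballot_matrix order_matrix_fixed U
      by (auto simp: species_Fix_theta_def species_I_def order_matrix_def)
  qed
  have n: "bmat_order V (transport species_Fix_theta U \<sigma> M) = transport species_I U \<sigma> (bmat_order U M)"
    if a: "finite U" "bij_betw \<sigma> U V" "M \<in> structs species_Fix_theta U" for U V :: "'a set" and \<sigma> M
    using bmat_order_transport[OF _ _ a(2), of M] species_transport[OF F a] a(3)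
    by (simp add: species_Fix_theta_def species_I_def)
  show ?thesis by (rule natural_isoI[OF F is_species_transfer[OF F b n] b n])
qed


section \<open>Interval orders as a signed count of ballot matrices\<close>

theorem theorem5p8:
  shows "natural_iso (species_B_plus_nonfixed :: ('a, 'a bmat) species) species_B_minus (\<lambda>U. theta)
    \<and> natural_iso (species_Fix_theta :: ('a, 'a bmat) species) species_I bmat_order
    \<and> (species_B_plus :: ('a, 'a bmat) species) \<cong> species_B_minus \<oplus> species_I
    \<and> (\<lambda>m. (-1) ^ m * (\<Prod>i=1..m. (virt_E_inv ^ i - 1))) sums (virt_of species_I :: 'a virt)"
proof (intro conjI)
  let ?P = "species_B_plus :: ('a, 'a bmat) species" and ?N = "species_B_minus :: ('a, 'a bmat) species"
  let ?I = "species_I :: ('a, ('a \<times> 'a) set) species"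
  let ?X = "species_B_plus_nonfixed :: ('a, 'a bmat) species"
  let ?F = "species_Fix_theta :: ('a, 'a bmat) species"
  show \<theta>: "natural_iso ?X ?N (\<lambda>U. theta)" by (rule theta_natural_iso)
  show \<pi>: "natural_iso ?F ?I bmat_order" by (rule bmat_order_natural_iso)
  have P: "is_species ?P"
    unfolding species_B_plus_sub by (rule is_species_sub[OF is_species_B invariant_positive])
  have N: "is_species ?N" and X: "is_species ?X" and I: "is_species ?I" and F: "is_species ?F"
    using natural_iso_species1[OF \<theta>] natural_iso_species2[OF \<theta>]
      natural_iso_species1[OF \<pi>] natural_iso_species2[OF \<pi>] by simp_all
  \<comment> \<open>The positive matrices are the fixed ones, counted by \<open>?I\<close>, and the others, matched with \<open>?N\<close>.\<close>
  have iX: "species_sub (\<lambda>M. \<not> theta M = M) ?P = ?X"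
    unfolding species_B_plus_sub species_B_plus_nonfixed_sub sub_sub ..
  have iF: "species_sub (\<lambda>M. theta M = M) ?P = ?F"
    unfolding species_B_plus_sub species_Fix_theta_sub sub_sub
    by (rule sub_cong) (auto simp: species_B_def fixed_positive)
  have "invariant ?P (\<lambda>M. theta M = M)"
    unfolding species_B_plus_sub by (rule invariant_sub[OF invariant_fixed])
  then have "virt_of ?P = virt_of ?F + virt_of ?X"
    using virt_of_sub_split[OF P] iX iF by simp
  also have "\<dots> = virt_of ?I + virt_of ?N"
    using virt_of_eq_iff[OF X N] virt_of_eq_iff[OF F I] isomorphicI[OF \<theta>] isomorphicI[OF \<pi>] by simp
  finally have eq: "virt_of ?P = virt_of ?N + virt_of ?I" by simp
  then show "?P \<cong> ?N \<oplus> ?I"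
    using virt_of_eq_iff[OF P is_species_sum[OF N I]] virt_of_sum[OF N I] by simp
  have "signed (species_B :: ('a, 'a bmat) species) (\<lambda>M. num_blocks M + fst M) = virt_of ?P - virt_of ?N"
    unfolding signed_def species_B_plus_sub species_B_minus_sub by (simp add: positive_bmat_def[abs_def])
  also have "\<dots> = virt_of ?I" using eq by simp
  finally show "(\<lambda>m. (-1) ^ m * (\<Prod>i=1..m. (virt_E_inv ^ i - 1))) sums virt_of ?I"
    using signed_B_sums[where 'a = 'a] by simp
qed

end
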